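(* Let $X$ be a random vector in $\mathbb{R}^n$, $n\geq 3$, with the standard normal distribution, and let $0\leq r<\infty$, $1\leq p<\infty$ and $t>0$. In each of the following four cases, definitions are given for $R$, $S$ and $|\cdot|_{\sharp}$, and in each case, $$\mathbb{P}\left\{|X|_{\sharp}\leq S\right\}\geq 1-C\exp\left(-t^2/2\right)\qquad\text{and}\qquad |X|_{\sharp}\leq S\ \Rightarrow\ \sum_{i=1}^{n}i^{-2r}X_{[i]}^{2(p-1)}\leq R.$$ **Case I:** If $p\in[3/2,\infty)$ then for all $x\in\mathbb{R}^n$ set $$|x|_{\sharp}=\left(\sum_{i=1}^{n}i^{-2r}x_{[i]}^{2(p-1)}\right)^{\frac{1}{2(p-1)}}$$ and $R=S^{2(p-1)}=A+Bt^{2(p-1)}$, where $$A=\frac{C^p p^p n^{1-2r}(\ln n)^p}{[p+(1-2r)\ln n]^p}1_{\{0\leq r\leq 1/2\}}+\left(\frac{C^p(\ln n)^p}{1+(2r-1)\ln n}+C^p(\ln n)^{p-1}\right)1_{\{1/2<r<\infty\}}$$ and $$B=C\left[1+\left(\frac{\ln n}{1+|2-2r-p|\ln n}\right)^{2-p}\left(1+n^{2-2r-p}\right)\right]1_{\{3/2\leq p<2\}}+C^p1_{\{2\leq p<\infty\}}.$$ In this case $|\cdot|_{\sharp}$ is a norm. **Case II:** If $p\in[1,3/2)$ then for all $x\in\mathbb{R}^n$, $$\sum_{i=1}^{n}i^{-2r}x_{[i]}^{2(p-1)}\leq C\left(\sum_{i=1}^{n/e}i^{-2r}\left(\ln\frac{n}{i}+\frac{t^2}{i}\right)^{p-1}\right)^{3-2p}|x|_{\sharp}^{2(p-1)},$$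 where $$|x|_{\sharp}=\sum_{i=1}^{n/e}\frac{i^{-2r}x_{[i]}}{\left(\ln\frac{n}{i}+\frac{t^2}{i}\right)^{\frac{3-2p}{2}}}$$ and $$R=S=C\sum_{i=1}^{n/e}i^{-2r}\left(\ln\frac{n}{i}+\frac{t^2}{i}\right)^{p-1},$$ which is at most $$\frac{Cn^{1-2r}(\ln n)^p}{[1+(1-2r)\ln n]^p}1_{\{0\leq r\leq 1/2\}}+C\left(\frac{(\ln n)^p}{1+(2r-1)\ln n}+(\ln n)^{p-1}\right)1_{\{1/2<r<\infty\}}+C\left(1+\frac{1+n^{2-2r-p}}{1+|2-2r-p|\ln n}\ln n\right)t^{2(p-1)}.$$ Under the added assumption that $p\geq 3/2-2r$, and because the sums have been restricted to $1\leq i\leq n/e$, $|\cdot|_{\sharp}$ is a norm. **Case III:** If $p<3/2-2r$ (so necessarily $0\leq r<1/4$ and $1\leq p<3/2$), then for all $x\in\mathbb{R}^n$, $$\sum_{i=1}^{n}i^{-2r}x_{[i]}^{2(p-1)}\leq Cn^{(1-2r)(3-2p)}|x|_{\sharp}^{2(p-1)},\qquad\text{where}\quad |x|_{\sharp}=\sum_{i=1}^{n}i^{-2r}x_{[i]},$$ and $$S=Cn^{1-2r}+Cn^{\frac{1-4r}{2}}\left(\frac{\ln n}{1+(1-4r)\ln n}\right)^{\frac12}t,$$ $$R=Cn^{(1-2r)(3-2p)}S^{2(p-1)}\leq Cn^{1-2r}+Cn^{2-2r-p}\left(\frac{\ln n}{1+(1-4r)\ln n}\right)^{p-1}t^{2(p-1)}.$$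 **Case IV:** When $r\in(1/4,1/2]$ and $p=2(1-r)$, in which case $p\in[1,3/2)$, the result in Case II can be improved as follows. *Case IVa:* If $(1-2r)\ln n\geq e$ (which excludes the case $p=1$), then for all $x\in\mathbb{R}^n$, $$\sum_{i=1}^{n}i^{-2r}x_{[i]}^{2(p-1)}\leq C(\ln n)^{3-2p}|x|_{\sharp}^{2(p-1)},$$ where $$|x|_{\sharp}=\sum_{i=1}^{n/e}\beta_i^{\frac{-(3-2p)}{2(p-1)}}i^{\frac{-r}{p-1}}x_{[i]},\qquad \beta_i=\frac{(1-2r)^p\ln n}{n^{1-2r}}i^{-2r}\left(\ln\frac{n}{i}\right)^{p-1}+i^{-1}.$$ The coefficient $\beta_i^{\frac{-(3-2p)}{2(p-1)}}i^{\frac{-r}{p-1}}$ is non-increasing in $i$ for $1\leq i\leq n/e$ (so that $|\cdot|_{\sharp}$ is a norm). In this case $$S=C^{\frac{1}{p-1}}(1-2r)^{\frac{-p}{2(p-1)}}(\ln n)^{\frac{-(3-2p)}{2(p-1)}}n^{\frac12}+C^{\frac{1}{p-1}}(\ln n)^{\frac12}t$$ and $$R=C(\ln n)^{3-2p}S^{2(p-1)}\leq C(1-2r)^{-1}n^{1-2r}+C(\ln n)^{2-p}t^{2(p-1)}.$$ *Case IVb:* If $(1-2r)\ln n<e$, then for all $x\in\mathbb{R}^n$, $$\sum_{i=1}^{n}i^{-2r}x_{[i]}^{2(p-1)}\leq C(\ln n)|x|_{\sharp}^{2(p-1)},$$ where $|\cdot|_{\sharp}=|\cdot|$ is the standard Euclidean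 norm, $S=Cn^{\frac12}+t$, and $$R=C(\ln n)S^{2(p-1)}\leq C(\ln n)t^{2(p-1)}.$$
   Context: The symbol $C$ denotes a positive universal constant (not depending on $n,r,p,t$) that may take a different value at each appearance. For $x\in\mathbb{R}^n$, $(x_{[i]})_{i=1}^n$ denotes the non-increasing rearrangement of $(|x_i|)_{i=1}^n$. The standard normal distribution on $\mathbb{R}^n$ is that of a vector with i.i.d. $N(0,1)$ coordinates. $1_{\{\cdot\}}$ is the indicator function of a condition. $\sum_{i=1}^{n/e}$ denotes summation over all integers $i$ with $1\leq i\leq n/e$, where $e$ is the base of the natural logarithm.
   Formalization: In Case II, R and S are the same sum with possibly different universal constants C (R = S with one C fails as p tends to 3/2); in Case IVb the last bound on R has max(1,t) in place of t (with t it fails as t tends to 0). *)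

theory Defs
  imports "HOL-Probability.Probability"
begin

(* A vector of R^n is a function x :: nat => real of which only the coordinates
   x 1, ..., x n are used.  The dimension is a natural number (not a type), so that
   constants can be chosen before n. *)

(* x_[i] for i in {1..n} *)
definition rearr :: "nat \<Rightarrow> (nat \<Rightarrow> real) \<Rightarrow> nat \<Rightarrow> real" where
  "rearr n x i = rev (sort (map (\<lambda>j. \<bar>x j\<bar>) [1..<Suc n])) ! (i - 1)"

(* Vectors are identified when they agree on {1..n}; that N respects this follows from
   the triangle inequality together with definiteness. *)
definition is_norm :: "nat \<Rightarrow> ((nat \<Rightarrow> real) \<Rightarrow> real) \<Rightarrow> bool" where
  "is_norm n N \<longleftrightarrow>
     (\<forall>x. 0 \<le> N x) \<and>
     (\<forall>x. N x = 0 \<longleftrightarrow> (\<forall>i\<in>{1..n}. x i = 0)) \<and>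
     (\<forall>c x. N (\<lambda>i. c * x i) = \<bar>c\<bar> * N x) \<and>
     (\<forall>x y. N (\<lambda>i. x i + y i) \<le> N x + N y)"

definition std_normal_vector :: "'a measure \<Rightarrow> nat \<Rightarrow> ('a \<Rightarrow> nat \<Rightarrow> real) \<Rightarrow> bool" where
  "std_normal_vector M n X \<longleftrightarrow>
     prob_space M \<and>
     prob_space.indep_vars M (\<lambda>_. borel) (\<lambda>i \<omega>. X \<omega> i) {1..n} \<and>
     (\<forall>i\<in>{1..n}. distributed M lborel (\<lambda>\<omega>. X \<omega> i) std_normal_density)"

(* Power of a nonnegative base with the convention 0^0 = 1; powr has 0 powr 0 = 0.
   It matters for the exponent 2(p-1) when p = 1.  All other powers in the statement have
   a positive base or a positive exponent, and use powr. *)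
definition pow0 :: "real \<Rightarrow> real \<Rightarrow> real" where
  "pow0 x a = (if a = 0 then 1 else x powr a)"

(* the integers i with 1 \<le> i \<le> n/e *)
definition idx_e :: "nat \<Rightarrow> nat set" where
  "idx_e n = {i. 1 \<le> i \<and> real i \<le> real n / exp 1}"

definition wsum :: "nat \<Rightarrow> real \<Rightarrow> real \<Rightarrow> (nat \<Rightarrow> real) \<Rightarrow> real" where
  "wsum n r p x = (\<Sum>i=1..n. real i powr (-2*r) * pow0 (rearr n x i) (2*(p-1)))"

definition concentrates ::
  "'a measure \<Rightarrow> nat \<Rightarrow> real \<Rightarrow> real \<Rightarrow> real \<Rightarrow> ('a \<Rightarrow> nat \<Rightarrow> real) \<Rightarrow>
   ((nat \<Rightarrow> real) \<Rightarrow> real) \<Rightarrow> real \<Rightarrow> real \<Rightarrow> real \<Rightarrow> bool" where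
  "concentrates M n r p t X N S R C \<longleftrightarrow>
     measure M {\<omega> \<in> space M. N (X \<omega>) \<le> S} \<ge> 1 - C * exp (- (t^2) / 2) \<and>
     (\<forall>\<omega>\<in>space M. N (X \<omega>) \<le> S \<longrightarrow> wsum n r p (X \<omega>) \<le> R)"

(* In the following, the parameters c, c1, c2, ... stand for the successive occurrences
   of the universal constant C in a formula. *)

definition norm_I :: "nat \<Rightarrow> real \<Rightarrow> real \<Rightarrow> (nat \<Rightarrow> real) \<Rightarrow> real" where
  "norm_I n r p x = (wsum n r p x) powr (1 / (2*(p-1)))"

definition A_I :: "real \<Rightarrow> real \<Rightarrow> real \<Rightarrow> nat \<Rightarrow> real \<Rightarrow> real \<Rightarrow> real" where
  "A_I c1 c2 c3 n r p =
     c1 powr p * p powr p * real n powr (1-2*r) * ln (real n) powr p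
       / (p + (1-2*r) * ln (real n)) powr p * indicator {0..1/2} r
     + (c2 powr p * ln (real n) powr p / (1 + (2*r-1) * ln (real n))
        + c3 powr p * ln (real n) powr (p-1)) * indicator {1/2<..} r"

definition B_I :: "real \<Rightarrow> real \<Rightarrow> nat \<Rightarrow> real \<Rightarrow> real \<Rightarrow> real" where
  "B_I c1 c2 n r p =
     c1 * (1 + (ln (real n) / (1 + \<bar>2-2*r-p\<bar> * ln (real n))) powr (2-p)
               * (1 + real n powr (2-2*r-p))) * indicator {3/2..<2} p
     + c2 powr p * indicator {2..} p"

(* ln(n/i) + t^2/i *)
definition L_II :: "nat \<Rightarrow> real \<Rightarrow> nat \<Rightarrow> real" where
  "L_II n t i = ln (real n / real i) + t^2 / real i"

definition norm_II :: "nat \<Rightarrow> real \<Rightarrow> real \<Rightarrow> real \<Rightarrow> (nat \<Rightarrow> real) \<Rightarrow> real" where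
  "norm_II n r p t x =
     (\<Sum>i\<in>idx_e n. real i powr (-2*r) * rearr n x i / L_II n t i powr ((3-2*p)/2))"

definition sum_II :: "nat \<Rightarrow> real \<Rightarrow> real \<Rightarrow> real \<Rightarrow> real" where
  "sum_II n r p t = (\<Sum>i\<in>idx_e n. real i powr (-2*r) * L_II n t i powr (p-1))"

definition bound_II ::
  "real \<Rightarrow> real \<Rightarrow> real \<Rightarrow> nat \<Rightarrow> real \<Rightarrow> real \<Rightarrow> real \<Rightarrow> real" where
  "bound_II c1 c2 c3 n r p t =
     c1 * real n powr (1-2*r) * ln (real n) powr p
       / (1 + (1-2*r) * ln (real n)) powr p * indicator {0..1/2} r
     + c2 * (ln (real n) powr p / (1 + (2*r-1) * ln (real n)) + ln (real n) powr (p-1))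
       * indicator {1/2<..} r
     + c3 * (1 + (1 + real n powr (2-2*r-p)) / (1 + \<bar>2-2*r-p\<bar> * ln (real n)) * ln (real n))
       * t powr (2*(p-1))"

definition norm_III :: "nat \<Rightarrow> real \<Rightarrow> (nat \<Rightarrow> real) \<Rightarrow> real" where
  "norm_III n r x = (\<Sum>i=1..n. real i powr (-2*r) * rearr n x i)"

definition S_III :: "real \<Rightarrow> real \<Rightarrow> nat \<Rightarrow> real \<Rightarrow> real \<Rightarrow> real" where
  "S_III c1 c2 n r t =
     c1 * real n powr (1-2*r)
     + c2 * real n powr ((1-4*r)/2)
       * (ln (real n) / (1 + (1-4*r) * ln (real n))) powr (1/2) * t"

definition beta_IV :: "nat \<Rightarrow> real \<Rightarrow> real \<Rightarrow> nat \<Rightarrow> real" where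
  "beta_IV n r p i =
     (1-2*r) powr p * ln (real n) / real n powr (1-2*r)
       * real i powr (-2*r) * ln (real n / real i) powr (p-1)
     + 1 / real i"

definition coef_IV :: "nat \<Rightarrow> real \<Rightarrow> real \<Rightarrow> nat \<Rightarrow> real" where
  "coef_IV n r p i = beta_IV n r p i powr (-(3-2*p) / (2*(p-1))) * real i powr (-r/(p-1))"

definition norm_IVa :: "nat \<Rightarrow> real \<Rightarrow> real \<Rightarrow> (nat \<Rightarrow> real) \<Rightarrow> real" where
  "norm_IVa n r p x = (\<Sum>i\<in>idx_e n. coef_IV n r p i * rearr n x i)"

definition S_IVa :: "real \<Rightarrow> real \<Rightarrow> nat \<Rightarrow> real \<Rightarrow> real \<Rightarrow> real \<Rightarrow> real" where
  "S_IVa c1 c2 n r p t =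
     c1 powr (1/(p-1)) * (1-2*r) powr (-p/(2*(p-1)))
       * ln (real n) powr (-(3-2*p)/(2*(p-1))) * real n powr (1/2)
     + c2 powr (1/(p-1)) * ln (real n) powr (1/2) * t"

definition norm_IVb :: "nat \<Rightarrow> (nat \<Rightarrow> real) \<Rightarrow> real" where
  "norm_IVb n x = L2_set x {1..n}"

end

theory Submission
  imports Defs "HOL-Combinatorics.List_Permutation"
begin

text \<open>
  With probability at least \<open>1 - exp (- t\<^sup>2 / 2)\<close> a Gaussian vector satisfies
  \<open>x\<^sub>[\<^sub>1\<^sub>]\<^sup>2 + \<dots> + x\<^sub>[\<^sub>k\<^sub>]\<^sup>2 \<le> 12 (k ln (en/k) + t\<^sup>2)\<close> for all \<open>k\<close> simultaneously: for one set of
  \<open>k\<close> coordinates this is the Chernoff bound for a chi-square variable, and the number of such sets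
  is at most \<open>(en/k)\<^sup>k\<close>. Everything else is deterministic. On this event \<open>x\<^sub>[\<^sub>i\<^sub>]\<^sup>2 \<le> 24 ln (en/i)\<close>
  for all \<open>i\<close> except an initial segment, over which the squares sum to at most \<open>24 t\<^sup>2\<close>. The
  logarithmic part gives the terms without \<open>t\<close>, and Hoelder's inequality on the initial segment
  gives the terms with \<open>t\<close>, so Gaussian concentration for Lipschitz functions is not needed. In
  Case II the consequence \<open>x\<^sub>[\<^sub>i\<^sub>]\<^sup>2 \<le> 12 (ln (en/i) + t\<^sup>2/i)\<close> suffices, and Case IVb is a chi-square
  tail bound for the whole vector. The comparisons of the weighted sum with a power of
  \<open>|x|\<^sub>\<sharp>\<close> are Hoelder's inequality, and the triangle inequalities combine Minkowski's inequality
  with the rearrangement inequality.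
\<close>

section \<open>Non-increasing rearrangements\<close>

text \<open>The constants must not depend on n, r or p, whereas the sums of i^(d-1) that occur
  change behaviour at d = 0, where n^d/d turns into ln n. They are therefore bounded through ln n /
  (1 + |d| ln n), which is comparable to the smaller of ln n and 1/|d| and stays meaningful at d =
  0; this is the origin of the denominators in the stated bounds. The pointwise estimate with t^2/i
  alone would cost a factor ln n when these terms are summed. Partial sums of squares avoid that
  loss: the excess over the logarithmic part has total mass at most a multiple of t^2, and a
  weighted sum of its powers costs only a dual norm of the weights. A weighted sum of the x_[i]
  satisfies the triangle inequality when the weights are non-increasing. The weights of Cases II and
  IVa involve i ln (n/i), which increases only up to n/e; that fixes the range of summation
  there.\<close>

lemma rearr_bij:
  obtains \<sigma> where "bij_betw \<sigma> {1..n} {1..n}" "\<And>i. i \<in> {1..n} \<Longrightarrow> rearr n x i = \<bar>x (\<sigma> i)\<bar>"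
proof -
  define xs where "xs = map (\<lambda>j. \<bar>x j\<bar>) [1..<Suc n]"
  define ys where "ys = rev (sort xs)"
  have len: "length xs = n" "length ys = n" by (auto simp: xs_def ys_def)
  have "mset ys = mset xs" by (simp add: ys_def)
  from permutation_Ex_bij[OF this] obtain f where f: "bij_betw f {..<n} {..<n}"
    and fi: "\<And>i. i < n \<Longrightarrow> ys ! i = xs ! f i" by (auto simp: len)
  \<comment> \<open>Positions in the list start at 0, coordinates at 1; the permutation of positions
    is conjugated by the shift.\<close>
  have s1: "bij_betw (\<lambda>i. i - 1) {1..n} {..<n}"
    by (rule bij_betw_byWitness[where f' = Suc]) auto
  have s2: "bij_betw Suc {..<n} {1..n}"
    by (rule bij_betw_byWitness[where f' = "\<lambda>i. i - 1"]) auto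
  have b: "bij_betw (Suc \<circ> f \<circ> (\<lambda>i. i - 1)) {1..n} {1..n}"
    using bij_betw_trans[OF bij_betw_trans[OF s1 f] s2] by (simp add: o_assoc)
  show thesis
  proof (rule that[OF b])
    fix i assume i: "i \<in> {1..n}"
    then have "i - 1 < n" by auto
    moreover from this have "f (i - 1) < n" using f by (auto simp: bij_betw_def)
    ultimately show "rearr n x i = \<bar>x ((Suc \<circ> f \<circ> (\<lambda>i. i - 1)) i)\<bar>"
      using fi[of "i - 1"] by (simp add: rearr_def xs_def ys_def del: upt_Suc)
  qed
qed

lemma rearr_antimono:
  assumes "1 \<le> i" "i \<le> j" "j \<le> n"
  shows "rearr n x j \<le> rearr n x i"
proof -
  have "sorted_wrt (\<ge>) (rev (sort (map (\<lambda>j. \<bar>x j\<bar>) [1..<Suc n])))"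
    by (simp add: sorted_wrt_rev)
  from sorted_wrt_nth_less[OF this, of "i-1" "j-1"] assms show ?thesis
    by (cases "i = j") (auto simp: rearr_def simp del: upt_Suc)
qed

lemma rearr_nonneg:
  assumes "i \<in> {1..n}"
  shows "0 \<le> rearr n x i"
  using rearr_bij[of n x] assms by (metis abs_ge_zero)

text \<open>The sets \<open>J - {1..k}\<close> and \<open>{1..k} - J\<close> have the same size;
  each value on the first is at most \<open>y k\<close>, each value on the second at least
  \<open>y k\<close>.\<close>

lemma sum_subset_le_sum_initial:
  fixes y :: "nat \<Rightarrow> real"
  assumes anti: "\<And>i j. 1 \<le> i \<Longrightarrow> i \<le> j \<Longrightarrow> j \<le> n \<Longrightarrow> y j \<le> y i"
    and J: "J \<subseteq> {1..n}" "card J = k"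
  shows "sum y J \<le> sum y {1..k}"
proof (cases "k = 0")
  case True
  then show ?thesis using J finite_subset by fastforce
next
  case False
  have fin: "finite J" using J finite_subset by blast
  have kn: "k \<le> n" using card_mono[of "{1..n}" J] J by simp
  have card: "card (J - {1..k}) = card ({1..k} - J)"
    by (simp add: card_Diff_subset_Int fin J Int_commute)
  have "sum y (J - {1..k}) \<le> of_nat (card (J - {1..k})) * y k"
    using J False by (intro sum_bounded_above anti) auto
  also have "\<dots> \<le> sum y ({1..k} - J)"
    unfolding card using kn by (intro sum_bounded_below anti) auto
  finally have *: "sum y (J - {1..k}) \<le> sum y ({1..k} - J)" .
  have "sum y J = sum y (J \<inter> {1..k}) + sum y (J - {1..k})"
    by (rule sum.Int_Diff[OF fin])
  also have "\<dots> \<le> sum y ({1..k} \<inter> J) + sum y ({1..k} - J)"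
    using * by (simp add: Int_commute)
  also have "\<dots> = sum y {1..k}" by (rule sum.Int_Diff[symmetric]) simp
  finally show ?thesis .
qed

text \<open>Abel summation with w(n+1) read as 0. For non-increasing non-negative weights all
  coefficients on the right are non-negative, so weighted sums can be compared through their partial
  sums.\<close>

lemma abel_summation_weights:
  fixes w z :: "nat \<Rightarrow> real"
  shows "(\<Sum>i=1..n. w i * z i) =
    (\<Sum>k=1..n. (w k - (if k < n then w (Suc k) else 0)) * sum z {1..k})"
proof (induction n)
  case (Suc n)
  have "(\<Sum>k=1..Suc n. (w k - (if k < Suc n then w (Suc k) else 0)) * sum z {1..k}) =
    (\<Sum>k=1..n. (w k - w (Suc k)) * sum z {1..k}) + w (Suc n) * sum z {1..Suc n}"
    by simp
  also have "(\<Sum>k=1..n. (w k - w (Suc k)) * sum z {1..k}) =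
    (\<Sum>k=1..n. (w k - (if k < n then w (Suc k) else 0)) * sum z {1..k}) - w (Suc n) * sum z {1..n}"
    by (cases n) (simp_all add: algebra_simps)
  finally show ?case using Suc by (simp add: algebra_simps)
qed simp

lemma rearrangement_inequality:
  fixes w y :: "nat \<Rightarrow> real"
  assumes anti_w: "\<And>i j. 1 \<le> i \<Longrightarrow> i \<le> j \<Longrightarrow> j \<le> n \<Longrightarrow> w j \<le> w i"
    and w: "\<And>i. i \<in> {1..n} \<Longrightarrow> 0 \<le> w i"
    and anti_y: "\<And>i j. 1 \<le> i \<Longrightarrow> i \<le> j \<Longrightarrow> j \<le> n \<Longrightarrow> y j \<le> y i"
    and \<sigma>: "bij_betw \<sigma> {1..n} {1..n}"
  shows "(\<Sum>i=1..n. w i * y (\<sigma> i)) \<le> (\<Sum>i=1..n. w i * y i)"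
  unfolding abel_summation_weights[of w "\<lambda>i. y (\<sigma> i)"] abel_summation_weights[of w y]
proof (rule sum_mono)
  fix k assume k: "k \<in> {1..n}"
  have inj: "inj_on \<sigma> {1..k}"
    using \<sigma> k by (auto simp: bij_betw_def intro: inj_on_subset)
  have "(\<Sum>i=1..k. y (\<sigma> i)) = sum y (\<sigma> ` {1..k})"
    using inj by (simp add: sum.reindex)
  also have "\<dots> \<le> sum y {1..k}"
    using \<sigma> k inj by (intro sum_subset_le_sum_initial anti_y) (auto simp: bij_betw_def card_image)
  finally show "(w k - (if k < n then w (Suc k) else 0)) * (\<Sum>i=1..k. y (\<sigma> i))
      \<le> (w k - (if k < n then w (Suc k) else 0)) * sum y {1..k}"
    using k anti_w[of k "Suc k"] w[of k] by (intro mult_left_mono) auto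
qed

text \<open>The permutation \<open>\<tau>\<close> is arbitrary because in the triangle inequality it
  sorts x + y and not x. Composing it with the inverse of a permutation that sorts x reduces the
  claim to the rearrangement inequality.\<close>

lemma sum_permuted_le_sum_rearr:
  fixes f :: "real \<Rightarrow> real"
  assumes anti_w: "\<And>i j. 1 \<le> i \<Longrightarrow> i \<le> j \<Longrightarrow> j \<le> n \<Longrightarrow> w j \<le> w i"
    and w: "\<And>i. i \<in> {1..n} \<Longrightarrow> 0 \<le> w i"
    and f: "\<And>u v. 0 \<le> u \<Longrightarrow> u \<le> v \<Longrightarrow> f u \<le> f v"
    and \<tau>: "bij_betw \<tau> {1..n} {1..n}"
  shows "(\<Sum>i=1..n. w i * f \<bar>x (\<tau> i)\<bar>) \<le> (\<Sum>i=1..n. w i * f (rearr n x i))"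
proof -
  obtain \<sigma> where \<sigma>: "bij_betw \<sigma> {1..n} {1..n}"
    and x: "\<And>i. i \<in> {1..n} \<Longrightarrow> rearr n x i = \<bar>x (\<sigma> i)\<bar>" using rearr_bij by blast
  define \<rho> where "\<rho> = the_inv_into {1..n} \<sigma> \<circ> \<tau>"
  have \<rho>: "bij_betw \<rho> {1..n} {1..n}"
    unfolding \<rho>_def by (rule bij_betw_trans[OF \<tau> bij_betw_the_inv_into[OF \<sigma>]])
  have "\<bar>x (\<tau> i)\<bar> = rearr n x (\<rho> i)" if "i \<in> {1..n}" for i
  proof -
    have "\<rho> i \<in> {1..n}" using \<rho> that bij_betwE by blast
    moreover have "\<sigma> (\<rho> i) = \<tau> i"
      using f_the_inv_into_f_bij_betw[OF \<sigma>, of "\<tau> i"] bij_betwE[OF \<tau>] that by (simp add: \<rho>_def)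
    ultimately show ?thesis using x by simp
  qed
  then have "(\<Sum>i=1..n. w i * f \<bar>x (\<tau> i)\<bar>) = (\<Sum>i=1..n. w i * f (rearr n x (\<rho> i)))"
    by simp
  also have "\<dots> \<le> (\<Sum>i=1..n. w i * f (rearr n x i))"
    by (rule rearrangement_inequality[OF anti_w w _ \<rho>])
       (auto intro!: f rearr_antimono rearr_nonneg)
  finally show ?thesis .
qed

text \<open>A partial sum of ordered values is a sum over one k-element set of coordinates, the form
  to which a union bound over subsets applies. The same \<open>J\<close> serves every
  \<open>f\<close>.\<close>

lemma sum_top_rearr:
  assumes "k \<le> n"
  obtains J where "J \<subseteq> {1..n}" "card J = k" "\<And>f::real \<Rightarrow> real. (\<Sum>i=1..k. f (rearr n x i)) = (\<Sum>j\<in>J. f \<bar>x j\<bar>)"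
proof -
  obtain \<sigma> where \<sigma>: "bij_betw \<sigma> {1..n} {1..n}"
    and x: "\<And>i. i \<in> {1..n} \<Longrightarrow> rearr n x i = \<bar>x (\<sigma> i)\<bar>" using rearr_bij by blast
  have inj: "inj_on \<sigma> {1..k}" using \<sigma> assms by (auto simp: bij_betw_def intro: inj_on_subset)
  show thesis
  proof (rule that[of "\<sigma> ` {1..k}"])
    show "\<sigma> ` {1..k} \<subseteq> {1..n}" using \<sigma> assms by (auto simp: bij_betw_def)
    show "card (\<sigma> ` {1..k}) = k" using inj by (simp add: card_image)
    show "(\<Sum>i=1..k. f (rearr n x i)) = (\<Sum>j\<in>\<sigma> ` {1..k}. f \<bar>x j\<bar>)" for f :: "real \<Rightarrow> real"
      using inj x assms by (simp add: sum.reindex)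
  qed
qed

lemma sum_all_rearr:
  fixes f :: "real \<Rightarrow> real"
  shows "(\<Sum>i=1..n. f (rearr n x i)) = (\<Sum>j=1..n. f \<bar>x j\<bar>)"
proof -
  obtain J where J: "J \<subseteq> {1..n}" "card J = n"
    "\<And>f::real \<Rightarrow> real. (\<Sum>i=1..n. f (rearr n x i)) = (\<Sum>j\<in>J. f \<bar>x j\<bar>)"
    using sum_top_rearr[of n n] by blast
  then have "J = {1..n}" by (intro card_subset_eq) auto
  with J show ?thesis by simp
qed

lemma abs_le_rearr_1:
  assumes "i \<in> {1..n}"
  shows "\<bar>x i\<bar> \<le> rearr n x 1"
proof -
  obtain \<sigma> where \<sigma>: "bij_betw \<sigma> {1..n} {1..n}"
    and x: "\<And>i. i \<in> {1..n} \<Longrightarrow> rearr n x i = \<bar>x (\<sigma> i)\<bar>" using rearr_bij by blast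
  obtain j where "j \<in> {1..n}" "\<sigma> j = i" using \<sigma> assms unfolding bij_betw_def by (metis imageE)
  with x rearr_antimono[of 1 j n x] show ?thesis by auto
qed

lemma rearr_eq_0:
  assumes "\<forall>i\<in>{1..n}. x i = 0" "i \<in> {1..n}"
  shows "rearr n x i = 0"
proof -
  obtain \<sigma> where "bij_betw \<sigma> {1..n} {1..n}"
    and "\<And>i. i \<in> {1..n} \<Longrightarrow> rearr n x i = \<bar>x (\<sigma> i)\<bar>" using rearr_bij by blast
  with assms show ?thesis by (auto simp: bij_betw_def)
qed

text \<open>A set of \<open>i\<close> coordinates cannot fit into the first \<open>i - 1\<close>
  positions of the ordering, so its smallest value is at most the i-th largest. The right-hand side
  combines finitely many events of single coordinates, which gives measurability.\<close>

lemma rearr_greater_iff: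
  assumes i: "i \<in> {1..n}"
  shows "s < rearr n x i \<longleftrightarrow> (\<exists>J\<in>{J. J \<subseteq> {1..n} \<and> card J = i}. \<forall>j\<in>J. s < \<bar>x j\<bar>)"
proof
  obtain \<sigma> where \<sigma>: "bij_betw \<sigma> {1..n} {1..n}"
    and x: "\<And>i. i \<in> {1..n} \<Longrightarrow> rearr n x i = \<bar>x (\<sigma> i)\<bar>" using rearr_bij by blast
  have inj: "inj_on \<sigma> {1..n}" and img: "\<sigma> ` {1..n} = {1..n}" using \<sigma> by (auto simp: bij_betw_def)
  {
    assume s: "s < rearr n x i"
    have "\<forall>j\<in>\<sigma> ` {1..i}. s < \<bar>x j\<bar>"
    proof
      fix j assume "j \<in> \<sigma> ` {1..i}"
      then obtain k where k: "1 \<le> k" "k \<le> i" "j = \<sigma> k" by auto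
      with i s rearr_antimono[of k i n x] x[of k] show "s < \<bar>x j\<bar>" by auto
    qed
    moreover have "\<sigma> ` {1..i} \<subseteq> {1..n}" "card (\<sigma> ` {1..i}) = i"
      using img i inj by (auto simp: card_image inj_on_subset)
    ultimately show "\<exists>J\<in>{J. J \<subseteq> {1..n} \<and> card J = i}. \<forall>j\<in>J. s < \<bar>x j\<bar>" by blast
  }
  assume "\<exists>J\<in>{J. J \<subseteq> {1..n} \<and> card J = i}. \<forall>j\<in>J. s < \<bar>x j\<bar>"
  then obtain J where J: "J \<subseteq> {1..n}" "card J = i" "\<And>j. j \<in> J \<Longrightarrow> s < \<bar>x j\<bar>" by auto
  have "\<not> J \<subseteq> \<sigma> ` {1..<i}"
  proof
    assume "J \<subseteq> \<sigma> ` {1..<i}"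
    then have "card J \<le> card (\<sigma> ` {1..<i})" by (intro card_mono) auto
    also have "\<dots> \<le> card {1..<i}" by (rule card_image_le) simp
    finally show False using J i by auto
  qed
  then obtain j where j: "j \<in> J" "j \<notin> \<sigma> ` {1..<i}" by blast
  then obtain k where k: "k \<in> {1..n}" "j = \<sigma> k" using J img by blast
  with j have "i \<le> k" by force
  then have "rearr n x k \<le> rearr n x i" using i k by (intro rearr_antimono) auto
  then show "s < rearr n x i" using J(3)[OF j(1)] x k by auto
qed

section \<open>Hoelder's and Minkowski's inequalities, and norms built from weighted ordered
  values\<close>

text \<open>Young's inequality is applied to a and b divided by their total sums, and then summed.
  The exponents \<open>1-\<theta>\<close> and \<open>\<theta>\<close> express interpolation between
  two weights, the form in which the weighted sum is later compared with a norm.\<close>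

lemma Holder_sum:
  fixes a b :: "'a \<Rightarrow> real"
  assumes \<theta>: "0 < \<theta>" "\<theta> < 1"
    and a: "\<And>i. i \<in> I \<Longrightarrow> 0 \<le> a i" and b: "\<And>i. i \<in> I \<Longrightarrow> 0 \<le> b i"
  shows "(\<Sum>i\<in>I. a i powr (1-\<theta>) * b i powr \<theta>) \<le> sum a I powr (1-\<theta>) * sum b I powr \<theta>"
proof (cases "finite I \<and> sum a I \<noteq> 0 \<and> sum b I \<noteq> 0")
  case False
  \<comment> \<open>Over an infinite index set both sides are 0, since such sums are 0 by
    convention.\<close>
  then consider "infinite I" | "finite I" "sum a I = 0" | "finite I" "sum b I = 0" by blast
  then show ?thesis
  proof cases
    case 2
    then have "\<forall>i\<in>I. a i = 0" using a sum_nonneg_eq_0_iff[of I a] by auto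
    with 2 show ?thesis by simp
  next
    case 3
    then have "\<forall>i\<in>I. b i = 0" using b sum_nonneg_eq_0_iff[of I b] by auto
    with 3 show ?thesis by simp
  qed simp
next
  case True
  define A B where "A = sum a I" and "B = sum b I"
  have AB: "0 < A" "0 < B"
    using True sum_nonneg[of I a] sum_nonneg[of I b] a b by (auto simp: A_def B_def less_le)
  have pt: "a i powr (1-\<theta>) * b i powr \<theta> \<le>
      A powr (1-\<theta>) * B powr \<theta> * ((1-\<theta>) * (a i / A) + \<theta> * (b i / B))" if i: "i \<in> I" for i
  proof (cases "a i = 0 \<or> b i = 0")
    case True
    then have "a i powr (1-\<theta>) * b i powr \<theta> = 0" by auto
    also have "\<dots> \<le> A powr (1-\<theta>) * B powr \<theta> * ((1-\<theta>) * (a i / A) + \<theta> * (b i / B))"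
      using a[OF i] b[OF i] AB \<theta> by (intro mult_nonneg_nonneg add_nonneg_nonneg divide_nonneg_pos) auto
    finally show ?thesis .
  next
    case False
    then have "0 < a i" "0 < b i" using a[OF i] b[OF i] by auto
    then have "(a i / A) powr (1-\<theta>) * (b i / B) powr \<theta> \<le> (1-\<theta>) * (a i / A) + \<theta> * (b i / B)"
      using \<theta> AB by (intro Youngs_inequality_0) auto
    moreover have "a i powr (1-\<theta>) * b i powr \<theta> =
        A powr (1-\<theta>) * B powr \<theta> * ((a i / A) powr (1-\<theta>) * (b i / B) powr \<theta>)"
      using AB \<open>0 < a i\<close> \<open>0 < b i\<close> by (simp add: powr_divide)
    ultimately show ?thesis using AB by (simp add: mult_left_mono)
  qed
  have "(\<Sum>i\<in>I. a i powr (1-\<theta>) * b i powr \<theta>) \<le>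
      (\<Sum>i\<in>I. A powr (1-\<theta>) * B powr \<theta> * ((1-\<theta>) * (a i / A) + \<theta> * (b i / B)))"
    by (rule sum_mono) (rule pt)
  also have "\<dots> = A powr (1-\<theta>) * B powr \<theta> * ((1-\<theta>) * (A / A) + \<theta> * (B / B))"
    unfolding sum_distrib_left[symmetric] sum.distrib sum_divide_distrib[symmetric] A_def B_def ..
  also have "\<dots> = A powr (1-\<theta>) * B powr \<theta>" using AB by simp
  finally show ?thesis unfolding A_def B_def .
qed

text \<open>One factor a + b is split off from (a+b)^q, Hoelder's inequality is applied to both
  parts against (a+b)^(q-1), and the common power of the left-hand sum is cancelled, which needs
  that sum to be non-zero.\<close>

lemma Minkowski_sum:
  fixes a b w :: "'a \<Rightarrow> real"
  assumes q: "1 \<le> q" and w: "\<And>i. i \<in> I \<Longrightarrow> 0 \<le> w i"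
    and a: "\<And>i. i \<in> I \<Longrightarrow> 0 \<le> a i" and b: "\<And>i. i \<in> I \<Longrightarrow> 0 \<le> b i"
  shows "(\<Sum>i\<in>I. w i * (a i + b i) powr q) powr (1/q) \<le>
    (\<Sum>i\<in>I. w i * a i powr q) powr (1/q) + (\<Sum>i\<in>I. w i * b i powr q) powr (1/q)"
proof (cases "q = 1")
  case True
  have "(\<Sum>i\<in>I. w i * (a i + b i)) = (\<Sum>i\<in>I. w i * a i) + (\<Sum>i\<in>I. w i * b i)"
    by (simp add: sum.distrib distrib_left)
  moreover have "0 \<le> (\<Sum>i\<in>I. w i * a i)" "0 \<le> (\<Sum>i\<in>I. w i * b i)"
    using w a b by (auto intro!: sum_nonneg)
  moreover have "(\<Sum>i\<in>I. w i * (a i + b i) powr 1) = (\<Sum>i\<in>I. w i * (a i + b i))"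
     "(\<Sum>i\<in>I. w i * a i powr 1) = (\<Sum>i\<in>I. w i * a i)"
     "(\<Sum>i\<in>I. w i * b i powr 1) = (\<Sum>i\<in>I. w i * b i)"
    using a b by (auto intro!: sum.cong)
  ultimately show ?thesis using True by simp
next
  case False
  with q have q1: "1 < q" by simp
  define T where "T = (\<Sum>i\<in>I. w i * (a i + b i) powr q)"
  have T0: "0 \<le> T" unfolding T_def using w by (auto intro!: sum_nonneg)
  show ?thesis
  proof (cases "T = 0")
    case False
    with T0 have T: "0 < T" by simp
    have split: "w i * (c i * (a i + b i) powr (q-1)) =
        (w i * (a i + b i) powr q) powr (1 - 1/q) * (w i * c i powr q) powr (1/q)"
      if "i \<in> I" "0 \<le> c i" for c i
    proof (cases "w i = 0 \<or> c i = 0 \<or> a i + b i = 0")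
      case True then show ?thesis using q1 by auto
    next
      case False
      then have pos: "0 < w i" "0 < c i" "0 < a i + b i" using that w[of i] a[of i] b[of i] by auto
      then have "(w i * (a i + b i) powr q) powr (1 - 1/q) * (w i * c i powr q) powr (1/q)
          = (w i powr (1 - 1/q) * w i powr (1/q)) * (c i * (a i + b i) powr (q - 1))"
        using q1 by (simp add: powr_mult powr_powr right_diff_distrib)
      also have "w i powr (1 - 1/q) * w i powr (1/q) = w i"
        using pos by (simp flip: powr_add)
      finally show ?thesis ..
    qed
    have H: "(\<Sum>i\<in>I. w i * (c i * (a i + b i) powr (q-1))) \<le>
        T powr (1 - 1/q) * (\<Sum>i\<in>I. w i * c i powr q) powr (1/q)"
      if c: "\<And>i. i \<in> I \<Longrightarrow> 0 \<le> c i" for c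
    proof -
      have "(\<Sum>i\<in>I. w i * (c i * (a i + b i) powr (q-1))) =
        (\<Sum>i\<in>I. (w i * (a i + b i) powr q) powr (1 - 1/q) * (w i * c i powr q) powr (1/q))"
        using split c by (intro sum.cong) auto
      also have "\<dots> \<le> T powr (1 - 1/q) * (\<Sum>i\<in>I. w i * c i powr q) powr (1/q)"
        unfolding T_def using q1 w by (intro Holder_sum) auto
      finally show ?thesis .
    qed
    have "T = (\<Sum>i\<in>I. w i * ((a i + b i) * (a i + b i) powr (q-1)))"
      unfolding T_def
    proof (intro sum.cong refl)
      fix i assume "i \<in> I"
      then have "0 \<le> a i + b i" using a b by auto
      then show "w i * (a i + b i) powr q = w i * ((a i + b i) * (a i + b i) powr (q-1))"
        using q1 by (cases "a i + b i = 0") (auto simp: powr_diff)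
    qed
    also have "\<dots> = (\<Sum>i\<in>I. w i * (a i * (a i + b i) powr (q-1))) + (\<Sum>i\<in>I. w i * (b i * (a i + b i) powr (q-1)))"
      by (simp add: sum.distrib algebra_simps)
    also have "\<dots> \<le> T powr (1 - 1/q) * ((\<Sum>i\<in>I. w i * a i powr q) powr (1/q) + (\<Sum>i\<in>I. w i * b i powr q) powr (1/q))"
      unfolding distrib_left by (intro add_mono H a b)
    finally have "T powr (1 - 1/q) * T powr (1/q) \<le>
        T powr (1 - 1/q) * ((\<Sum>i\<in>I. w i * a i powr q) powr (1/q) + (\<Sum>i\<in>I. w i * b i powr q) powr (1/q))"
      using T by (simp flip: powr_add)
    then show ?thesis using T unfolding T_def[symmetric] by simp
  qed (simp add: T_def)
qed

text \<open>A permutation sorting x + y, used for x and for y separately, can only lower their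
  weighted sums, by the rearrangement inequality; Minkowski's inequality does the rest. Definiteness
  rests on \<open>w 1\<close>, which multiplies the largest coordinate, so later weights may
  vanish.\<close>

lemma is_norm_weighted_rearr:
  assumes n: "1 \<le> n" and q: "1 \<le> q"
    and anti_w: "\<And>i j. 1 \<le> i \<Longrightarrow> i \<le> j \<Longrightarrow> j \<le> n \<Longrightarrow> w j \<le> w i"
    and w: "\<And>i. i \<in> {1..n} \<Longrightarrow> 0 \<le> w i" and w1: "0 < w 1"
  shows "is_norm n (\<lambda>x. (\<Sum>i=1..n. w i * rearr n x i powr q) powr (1/q))"
proof -
  define V where "V x = (\<Sum>i=1..n. w i * rearr n x i powr q)" for x
  define N where "N x = V x powr (1/q)" for x
  have V0: "0 \<le> V x" for x unfolding V_def using w by (intro sum_nonneg) auto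
  have perm: "(\<Sum>i=1..n. w i * \<bar>x (\<tau> i)\<bar> powr q) \<le> V x" if "bij_betw \<tau> {1..n} {1..n}" for x \<tau>
    unfolding V_def using q that
    by (intro sum_permuted_le_sum_rearr[where f = "\<lambda>u. u powr q"] anti_w w) (auto intro: powr_mono2)
  have scale_le: "N (\<lambda>i. c * x i) \<le> \<bar>c\<bar> * N x" for c x
  proof -
    obtain \<tau> where \<tau>: "bij_betw \<tau> {1..n} {1..n}"
      and r: "\<And>i. i \<in> {1..n} \<Longrightarrow> rearr n (\<lambda>i. c * x i) i = \<bar>c * x (\<tau> i)\<bar>"
      using rearr_bij[of n "\<lambda>i. c * x i"] by blast
    have "V (\<lambda>i. c * x i) = \<bar>c\<bar> powr q * (\<Sum>i=1..n. w i * \<bar>x (\<tau> i)\<bar> powr q)"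
      unfolding V_def sum_distrib_left using r by (intro sum.cong) (auto simp: abs_mult powr_mult)
    also have "\<dots> \<le> \<bar>c\<bar> powr q * V x" by (intro mult_left_mono perm \<tau>) auto
    finally have "N (\<lambda>i. c * x i) \<le> (\<bar>c\<bar> powr q * V x) powr (1/q)"
      unfolding N_def using q V0 by (intro powr_mono2) auto
    also have "\<dots> = \<bar>c\<bar> * N x" using q V0 by (simp add: N_def powr_mult powr_powr)
    finally show ?thesis .
  qed
  have zero: "N x = 0 \<longleftrightarrow> (\<forall>i\<in>{1..n}. x i = 0)" for x
  proof
    assume "N x = 0"
    then have "V x = 0" by (simp add: N_def)
    then have "\<forall>i\<in>{1..n}. w i * rearr n x i powr q = 0"
      unfolding V_def using w by (subst (asm) sum_nonneg_eq_0_iff) auto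
    then have "w 1 * rearr n x 1 powr q = 0" using n by simp
    then have "rearr n x 1 = 0" using w1 by simp
    then show "\<forall>i\<in>{1..n}. x i = 0" using abs_le_rearr_1[of _ n x] by auto
  qed (simp add: N_def V_def rearr_eq_0)
  have scale: "N (\<lambda>i. c * x i) = \<bar>c\<bar> * N x" for c x
  proof (cases "c = 0")
    case True
    then show ?thesis using zero[of "\<lambda>i. c * x i"] by simp
  next
    case False
    \<comment> \<open>The inequality already shown, applied to c x with the factor 1/c, gives the
      reverse one.\<close>
    have "N x \<le> \<bar>1/c\<bar> * N (\<lambda>i. c * x i)"
      using scale_le[of "1/c" "\<lambda>i. c * x i"] False by simp
    then have "\<bar>c\<bar> * N x \<le> N (\<lambda>i. c * x i)" using False by (simp add: abs_divide field_simps)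
    with scale_le[of c x] show ?thesis by simp
  qed
  have triangle: "N (\<lambda>i. x i + y i) \<le> N x + N y" for x y
  proof -
    obtain \<tau> where \<tau>: "bij_betw \<tau> {1..n} {1..n}"
      and r: "\<And>i. i \<in> {1..n} \<Longrightarrow> rearr n (\<lambda>i. x i + y i) i = \<bar>x (\<tau> i) + y (\<tau> i)\<bar>"
      using rearr_bij[of n "\<lambda>i. x i + y i"] by blast
    have "V (\<lambda>i. x i + y i) \<le> (\<Sum>i=1..n. w i * (\<bar>x (\<tau> i)\<bar> + \<bar>y (\<tau> i)\<bar>) powr q)"
      unfolding V_def using r q w by (intro sum_mono mult_left_mono) (auto intro!: powr_mono2)
    then have "N (\<lambda>i. x i + y i) \<le> (\<Sum>i=1..n. w i * (\<bar>x (\<tau> i)\<bar> + \<bar>y (\<tau> i)\<bar>) powr q) powr (1/q)"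
      unfolding N_def using q V0 by (intro powr_mono2) auto
    also have "\<dots> \<le> (\<Sum>i=1..n. w i * \<bar>x (\<tau> i)\<bar> powr q) powr (1/q) + (\<Sum>i=1..n. w i * \<bar>y (\<tau> i)\<bar> powr q) powr (1/q)"
      using q w by (intro Minkowski_sum) auto
    also have "\<dots> \<le> N x + N y"
      unfolding N_def using q w perm[OF \<tau>] by (intro add_mono powr_mono2 sum_nonneg) auto
    finally show ?thesis .
  qed
  have "is_norm n N"
    unfolding is_norm_def using zero scale triangle by (auto simp: N_def)
  then show ?thesis unfolding N_def V_def .
qed

section \<open>Sums of powers and logarithms\<close>

lemma ln_of_nat_ge_1:
  assumes "3 \<le> n"
  shows "1 \<le> ln (real n)"
proof -
  have "exp 1 \<le> (3::real)" by (rule exp_le)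
  also have "\<dots> \<le> real n" using assms by simp
  finally show ?thesis using assms by (simp add: ln_ge_iff)
qed

text \<open>The fractions a/(a+b) and b/(a+b) lie between 0 and 1 and sum to 1; raising them to a
  power q <= 1 does not decrease them.\<close>

lemma powr_add_le:
  fixes a b q :: real
  assumes "0 \<le> a" "0 \<le> b" "0 \<le> q" "q \<le> 1"
  shows "(a + b) powr q \<le> a powr q + b powr q"
proof (cases "a = 0 \<or> b = 0")
  case False
  then have ab: "0 < a" "0 < b" using assms by auto
  have *: "c / (a+b) \<le> (c / (a+b)) powr q" if "0 < c" "c \<le> a + b" for c
    using powr_mono'[of q 1 "c / (a+b)"] assms that by simp
  have "1 = a/(a+b) + b/(a+b)" using ab by (simp flip: add_divide_distrib)
  also have "\<dots> \<le> (a/(a+b)) powr q + (b/(a+b)) powr q"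
    using ab by (intro add_mono *) auto
  also have "\<dots> = (a powr q + b powr q) / (a+b) powr q"
    using ab by (simp add: powr_divide add_divide_distrib)
  finally show ?thesis using ab by (simp add: field_simps)
qed (use assms in auto)

text \<open>Comparison with an integral, done as an induction step: v^(d-1) <= (v^d - (v-1)^d) / d
  follows from Young's inequality for (v-1)^d v^(1-d).\<close>

lemma sum_powr_le_pos:
  fixes d :: real
  assumes "0 < d" "d \<le> 1"
  shows "(\<Sum>i=1..n. real i powr (d-1)) \<le> real n powr d / d"
proof (induction n)
  case (Suc n)
  define v where "v = real (Suc n)"
  have v: "0 < v" "real n = v - 1" "1 \<le> v" by (auto simp: v_def)
  have "real n powr d \<le> v powr d - d * v powr (d-1)"
  proof (cases "n = 0")
    case True
    then show ?thesis using assms by (simp add: v_def)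
  next
    case False
    then have "real n powr d * v powr (1-d) \<le> d * real n + (1-d) * v"
      using assms v by (intro Youngs_inequality_0) auto
    also have "\<dots> = v - d" by (simp add: v algebra_simps)
    finally have "real n powr d * (v powr (1-d) * v powr (d-1)) \<le> (v - d) * v powr (d-1)"
      unfolding mult.assoc[symmetric] by (intro mult_right_mono) auto
    moreover have "v powr (1-d) * v powr (d-1) = 1" using v by (simp flip: powr_add)
    moreover have "v * v powr (d-1) = v powr d" using v by (simp add: powr_diff)
    ultimately show ?thesis by (simp add: algebra_simps)
  qed
  then have "v powr (d-1) \<le> (v powr d - real n powr d) / d"
    using assms by (simp add: field_simps)
  then have "(\<Sum>i=1..n. real i powr (d-1)) + v powr (d-1) \<le> v powr d / d"
    using Suc by (simp add: diff_divide_distrib)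
  then show ?case by (simp add: v_def)
qed simp

text \<open>The separate 1 is the term i = 1. The step is the tangent inequality for the convex
  function v^d, obtained from ln u <= u - 1 and 1 + u <= exp u.\<close>

lemma sum_powr_le_neg:
  fixes d :: real
  assumes "d < 0" "1 \<le> n"
  shows "(\<Sum>i=1..n. real i powr (d-1)) \<le> 1 + (1 - real n powr d) / (-d)"
  using assms(2)
proof (induction n rule: dec_induct)
  case (step n)
  define v where "v = real (Suc n)"
  have v: "0 < v" "real n = v - 1" "0 < real n" using step by (auto simp: v_def)
  have "ln (real n / v) \<le> real n / v - 1" using v by (intro ln_le_minus_one) auto
  then have "d * ln (real n / v) \<ge> d * (real n / v - 1)"
    using assms by (intro mult_left_mono_neg) auto
  moreover have "real n / v - 1 = - 1 / v" using v(1) unfolding v(2) by (simp add: field_simps)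
  ultimately have "1 - d / v \<le> 1 + d * ln (real n / v)" by simp
  also have "\<dots> \<le> (real n / v) powr d"
    using v exp_ge_add_one_self[of "d * ln (real n / v)"] by (simp add: powr_def)
  finally have "v powr d * (1 - d / v) \<le> v powr d * (real n / v) powr d"
    by (intro mult_left_mono) auto
  also have "\<dots> = real n powr d" using v by (simp add: powr_divide)
  finally have "v powr d - d * v powr (d-1) \<le> real n powr d"
    using v(1) by (simp add: powr_diff right_diff_distrib mult.commute)
  then have "v powr (d-1) \<le> (real n powr d - v powr d) / (-d)"
    using assms by (simp add: field_simps)
  moreover have "(real n powr d - v powr d) / (-d) = (1 - v powr d) / (-d) - (1 - real n powr d) / (-d)"
    using assms by (simp add: field_simps)
  ultimately have "(\<Sum>i=1..n. real i powr (d-1)) + v powr (d-1) \<le> 1 + (1 - v powr d) / (-d)"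
    using step.IH by linarith
  then show ?case by (simp add: v_def)
qed simp

lemma sum_inverse_le:
  assumes "1 \<le> n"
  shows "(\<Sum>i=1..n. 1 / real i) \<le> 1 + ln (real n)"
  using assms
proof (induction n rule: dec_induct)
  case (step n)
  have "ln (real n / real (Suc n)) \<le> real n / real (Suc n) - 1" using step by (intro ln_le_minus_one) auto
  also have "\<dots> = - 1 / real (Suc n)" by (simp add: field_simps)
  finally have "1 / real (Suc n) \<le> ln (real (Suc n)) - ln (real n)"
    using step by (simp add: ln_div)
  then show ?case using step.IH by simp
qed simp

lemma sum_powr_le_ln:
  fixes d :: real
  assumes "1 \<le> n" "0 \<le> d"
  shows "(\<Sum>i=1..n. real i powr (d-1)) \<le> real n powr d * (1 + ln (real n))"
proof -
  have "(\<Sum>i=1..n. real i powr (d-1)) \<le> (\<Sum>i=1..n. real n powr d * (1 / real i))"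
    using assms by (intro sum_mono) (auto simp: powr_diff intro!: divide_right_mono powr_mono2)
  also have "\<dots> \<le> real n powr d * (1 + ln (real n))"
    unfolding sum_distrib_left[symmetric] using assms by (intro mult_left_mono sum_inverse_le) auto
  finally show ?thesis .
qed

text \<open>The quotient l / (1 + d l) is comparable to the smaller of l and 1/d, uniformly down to
  d = 0; which of the two bounds is used depends on whether d l <= 1.\<close>

lemma min_le_quotient:
  fixes d l :: real
  assumes "1 \<le> l" "0 \<le> d" "b \<le> l" "0 < d \<Longrightarrow> b \<le> 1 / d"
  shows "b \<le> 2 * (l / (1 + d * l))"
proof (cases "d * l \<le> 1")
  case True
  then have "l * (1 + d * l) \<le> l * 2" using assms by (intro mult_left_mono) auto
  then have "l \<le> 2 * (l / (1 + d * l))" using assms by (simp add: pos_le_divide_eq add_pos_nonneg)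
  then show ?thesis using assms by simp
next
  case False
  then have d: "0 < d" using assms by (cases "d = 0") auto
  then have "1 / d \<le> 2 * (l / (1 + d * l))"
    using False assms by (simp add: divide_simps add_pos_pos)
  then show ?thesis using assms d by simp
qed

lemma sum_powr_le_nonneg_quotient:
  fixes d :: real
  assumes "3 \<le> n" "0 \<le> d" "d \<le> 1"
  shows "(\<Sum>i=1..n. real i powr (d-1)) \<le> 4 * (real n powr d * (ln (real n) / (1 + d * ln (real n))))"
proof -
  have l: "1 \<le> ln (real n)" using assms(1) by (rule ln_of_nat_ge_1)
  define b where "b = (\<Sum>i=1..n. real i powr (d-1)) / real n powr d"
  have n: "0 < real n powr d" using assms by auto
  \<comment> \<open>Halving brings the logarithmic bound 1 + ln n <= 2 ln n into the form required
    by \<open>min_le_quotient\<close>; this 2 and the 2 of that lemma make up the 4.\<close>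
  have "b / 2 \<le> 2 * (ln (real n) / (1 + d * ln (real n)))"
  proof (rule min_le_quotient[OF l assms(2)])
    have "b \<le> 1 + ln (real n)" using sum_powr_le_ln[of n d] n assms by (simp add: b_def field_simps)
    then show "b / 2 \<le> ln (real n)" using l by simp
    assume d: "0 < d"
    then have "b \<le> 1 / d" using sum_powr_le_pos[of d n] n assms by (simp add: b_def field_simps)
    moreover have "0 < 1 / d" using d by simp
    ultimately show "b / 2 \<le> 1 / d" by linarith
  qed
  then show ?thesis using n by (simp add: b_def field_simps)
qed

lemma sum_powr_le_nonpos_quotient:
  fixes d :: real
  assumes "3 \<le> n" "d \<le> 0"
  shows "(\<Sum>i=1..n. real i powr (d-1)) \<le> 1 + 2 * (ln (real n) / (1 + \<bar>d\<bar> * ln (real n)))"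
proof -
  have l: "1 \<le> ln (real n)" using assms(1) by (rule ln_of_nat_ge_1)
  \<comment> \<open>The term i = 1, which does not decay, is set apart; the remainder is at most ln
    n and, for d < 0, at most 1/|d|.\<close>
  define b where "b = (\<Sum>i=1..n. real i powr (d-1)) - 1"
  have "b \<le> 2 * (ln (real n) / (1 + \<bar>d\<bar> * ln (real n)))"
  proof (rule min_le_quotient[OF l])
    have "(\<Sum>i=1..n. real i powr (d-1)) \<le> (\<Sum>i=1..n. 1 / real i)"
    proof (rule sum_mono)
      fix i assume "i \<in> {1..n}"
      then show "real i powr (d-1) \<le> 1 / real i"
        using assms powr_mono[of "d-1" "-1" "real i"] by (simp add: powr_minus_divide)
    qed
    also have "\<dots> \<le> 1 + ln (real n)" using assms by (intro sum_inverse_le) auto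
    finally show "b \<le> ln (real n)" by (simp add: b_def)
    assume "0 < \<bar>d\<bar>"
    then have d: "d < 0" using assms by auto
    have "b \<le> (1 - real n powr d) / (-d)" using sum_powr_le_neg[of d n] d assms by (simp add: b_def)
    also have "\<dots> \<le> 1 / (-d)" using d by (intro divide_right_mono) auto
    finally show "b \<le> 1 / \<bar>d\<bar>" using d by simp
  qed simp
  then show ?thesis by (simp add: b_def)
qed

section \<open>Sums weighted by powers of ln (en/i)\<close>

lemma ln_exp_div_bounds:
  assumes "1 \<le> i" "i \<le> n" "3 \<le> n"
  shows "1 \<le> ln (exp 1 * real n / real i)" "ln (exp 1 * real n / real i) \<le> 2 * ln (real n)"
proof -
  have eq: "ln (exp 1 * real n / real i) = 1 + ln (real n) - ln (real i)"
    using assms by (simp add: ln_div ln_mult)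
  have "ln (real i) \<le> ln (real n)" "0 \<le> ln (real i)" using assms by auto
  with eq ln_of_nat_ge_1[OF assms(3)]
  show "1 \<le> ln (exp 1 * real n / real i)" "ln (exp 1 * real n / real i) \<le> 2 * ln (real n)" by auto
qed

lemma sum_ln_powr_le_crude:
  assumes n: "3 \<le> n" and p: "1 \<le> p"
  shows "(\<Sum>i=1..n. real i powr (-2*r) * ln (exp 1 * real n / real i) powr (p-1)) \<le>
    (2 * ln (real n)) powr (p-1) * (\<Sum>i=1..n. real i powr (-2*r))"
proof -
  have "(\<Sum>i=1..n. real i powr (-2*r) * ln (exp 1 * real n / real i) powr (p-1)) \<le>
     (\<Sum>i=1..n. real i powr (-2*r) * (2 * ln (real n)) powr (p-1))"
  proof (intro sum_mono mult_left_mono powr_mono2)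
    fix i assume "i \<in> {1..n}"
    then have "1 \<le> ln (exp 1 * real n / real i)"
      and le: "ln (exp 1 * real n / real i) \<le> 2 * ln (real n)"
      using ln_exp_div_bounds[of i n] n by auto
    then show "0 \<le> ln (exp 1 * real n / real i)" by linarith
    show "ln (exp 1 * real n / real i) \<le> 2 * ln (real n)" by (rule le)
  qed (use p in auto)
  also have "\<dots> = (2 * ln (real n)) powr (p-1) * (\<Sum>i=1..n. real i powr (-2*r))"
    by (simp add: sum_distrib_left mult.commute)
  finally show ?thesis .
qed

text \<open>Half of the exponent d = 1 - 2r is spent on the logarithm: with y = ln (en/i), the power
  y^(p-1) is at most a multiple of (n/i)^(d/2), and the sum of i^(d/2-1) is still at most n^(d/2) /
  (d/2). This puts d^p into the denominator and keeps the dependence on p at C^p p^p.\<close>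

lemma sum_ln_powr_le_div:
  assumes n: "3 \<le> n" and r: "0 \<le> r" "r < 1/2" and p: "1 \<le> p"
  shows "(\<Sum>i=1..n. real i powr (-2*r) * ln (exp 1 * real n / real i) powr (p-1)) \<le>
    4 powr p * p powr p * real n powr (1-2*r) / (1-2*r) powr p"
proof -
  define d where "d = 1 - 2*r"
  have d: "0 < d" "d \<le> 1" using r by (auto simp: d_def)
  have pt: "real i powr (-2*r) * ln (exp 1 * real n / real i) powr (p-1) \<le>
      (2*p/d) powr (p-1) * (2 * real n powr (d/2)) * real i powr (d/2-1)" if i: "i \<in> {1..n}" for i
  proof -
    define y where "y = ln (exp 1 * real n / real i)"
    have y: "1 \<le> y" using ln_exp_div_bounds[of i n] i n by (simp add: y_def)
    \<comment> \<open>The rate d/(2p) is chosen so that the power p - 1 leaves at most exp (d y /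
      2).\<close>
    have "d * y / (2*p) \<le> exp (d * y / (2*p))" using exp_ge_add_one_self[of "d * y / (2*p)"] by linarith
    then have "y \<le> (2*p/d) * exp (d * y / (2*p))" using d p by (simp add: field_simps)
    then have "y powr (p-1) \<le> ((2*p/d) * exp (d * y / (2*p))) powr (p-1)"
      using y p by (intro powr_mono2) auto
    also have "\<dots> = (2*p/d) powr (p-1) * exp (d * y / (2*p) * (p-1))"
      by (simp only: powr_mult exp_powr_real)
    also have "\<dots> \<le> (2*p/d) powr (p-1) * exp (d * y / 2)"
    proof -
      have "d * y / (2*p) * (p-1) = d * y / 2 * ((p-1)/p)" by simp
      also have "\<dots> \<le> d * y / 2 * 1" using d y p by (intro mult_left_mono) auto
      finally show ?thesis by (intro mult_left_mono) auto
    qed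
    also have "exp (d * y / 2) = exp (d/2) * (real n powr (d/2) * real i powr (-d/2))"
    proof -
      have "y = 1 + ln (real n) - ln (real i)" using i by (simp add: y_def ln_div ln_mult)
      then have "d * y / 2 = d/2 + (d/2 * ln (real n) + (-d/2) * ln (real i))" by (simp only:) (simp add: field_simps)
      then show ?thesis using i by (simp add: powr_def mult_exp_exp)
    qed
    also have "(2*p/d) powr (p-1) * (exp (d/2) * (real n powr (d/2) * real i powr (-d/2))) \<le>
       (2*p/d) powr (p-1) * (2 * (real n powr (d/2) * real i powr (-d/2)))"
    proof -
      have "exp (d/2) \<le> exp (1/2)" using d by simp
      also have "\<dots> \<le> (2::real)"
      proof -
        have "exp (1/2::real) ^ 2 \<le> 2 ^ 2" using exp_le by (simp flip: exp_of_nat_mult)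
        then show ?thesis by (rule power2_le_imp_le) simp
      qed
      finally show ?thesis by (intro mult_left_mono mult_right_mono) auto
    qed
    finally have "real i powr (-2*r) * y powr (p-1) \<le>
      real i powr (-2*r) * ((2*p/d) powr (p-1) * (2 * (real n powr (d/2) * real i powr (-d/2))))"
      by (intro mult_left_mono) auto
    also have "\<dots> = (2*p/d) powr (p-1) * (2 * real n powr (d/2)) * (real i powr (-2*r) * real i powr (-d/2))"
      by simp
    also have "real i powr (-2*r) * real i powr (-d/2) = real i powr (d/2-1)"
      by (simp add: d_def field_simps flip: powr_add)
    finally show ?thesis unfolding y_def .
  qed
  have "(\<Sum>i=1..n. real i powr (-2*r) * ln (exp 1 * real n / real i) powr (p-1)) \<le>
      (\<Sum>i=1..n. (2*p/d) powr (p-1) * (2 * real n powr (d/2)) * real i powr (d/2-1))"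
    by (rule sum_mono) (rule pt)
  also have "\<dots> = (2*p/d) powr (p-1) * (2 * real n powr (d/2)) * (\<Sum>i=1..n. real i powr (d/2-1))"
    by (rule sum_distrib_left[symmetric])
  also have "\<dots> \<le> (2*p/d) powr (p-1) * (2 * real n powr (d/2)) * (real n powr (d/2) / (d/2))"
    using d by (intro mult_left_mono sum_powr_le_pos) auto
  also have "\<dots> = (2*p/d) powr (p-1) * (4/d) * (real n powr (d/2) * real n powr (d/2))"
    by (simp add: field_simps)
  also have "real n powr (d/2) * real n powr (d/2) = real n powr d"
    by (simp flip: powr_add)
  \<comment> \<open>Since p >= 1, 4/d is at most 2 (2p/d), which completes the power p.\<close>
  also have "(2*p/d) powr (p-1) * (4/d) * real n powr d \<le> (2*p/d) powr (p-1) * (2*(2*p/d)) * real n powr d"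
    using d p by (intro mult_left_mono mult_right_mono) (auto simp: field_simps)
  also have "\<dots> = 2 * (2*p/d) powr p * real n powr d"
    using d p by (simp add: powr_diff)
  also have "\<dots> \<le> 2 powr p * (2*p/d) powr p * real n powr d"
    using p powr_mono[of 1 p 2] by (intro mult_right_mono) auto
  also have "\<dots> = (2 * 2) powr p * p powr p * real n powr d / d powr p"
    using d p powr_mult[of 2 2 p] by (simp add: powr_divide powr_mult)
  finally show ?thesis by (simp add: d_def)
qed

text \<open>If (1-2r) ln n <= p, every logarithm is replaced by 2 ln n, and p + (1-2r) ln n <= 2p.
  Otherwise \<open>sum_ln_powr_le_div\<close> applies, and p + (1-2r) ln n <= 2 (1-2r) ln n. Either
  way the new denominator costs 2^p, which turns 4^p into 8^p.\<close>

lemma sum_ln_powr_le: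
  assumes n: "3 \<le> n" and r: "0 \<le> r" "r \<le> 1/2" and p: "1 \<le> p"
  shows "(\<Sum>i=1..n. real i powr (-2*r) * ln (exp 1 * real n / real i) powr (p-1)) \<le>
    8 powr p * p powr p * real n powr (1-2*r) * ln (real n) powr p / (p + (1-2*r) * ln (real n)) powr p"
proof (cases "(1-2*r) * ln (real n) \<le> p")
  case True
  have l: "1 \<le> ln (real n)" using n by (rule ln_of_nat_ge_1)
  define a where "a = ln (real n)"
  have "(\<Sum>i=1..n. real i powr (-2*r) * ln (exp 1 * real n / real i) powr (p-1)) \<le>
    (2 * a) powr (p-1) * (\<Sum>i=1..n. real i powr (-2*r))"
    unfolding a_def using n p by (rule sum_ln_powr_le_crude)
  also have "\<dots> \<le> (2 * a) powr (p-1) * (real n powr (1-2*r) * (2 * a))"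
    using sum_powr_le_ln[of n "1-2*r"] n r l
    by (intro mult_left_mono) (auto simp: a_def intro: order_trans[OF _ mult_left_mono])
  also have "\<dots> = (2 * a) powr p * real n powr (1-2*r)"
    using l by (simp add: powr_diff a_def)
  also have "\<dots> = 4 powr p * (real n powr (1-2*r) * a powr p) * (p powr p / (2*p) powr p)"
    using l p powr_mult[of 2 2 p] by (simp add: a_def powr_mult)
  also have "\<dots> \<le> 8 powr p * (real n powr (1-2*r) * a powr p) * (p powr p / (p + (1-2*r) * a) powr p)"
  proof -
    have "0 < p + (1-2*r) * a" using p r l by (intro add_pos_nonneg) (auto simp: a_def)
    then show ?thesis
      using True p r l unfolding a_def[symmetric]
      by (intro mult_mono mult_right_mono divide_left_mono powr_mono2 mult_pos_pos) auto
  qed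
  finally show ?thesis by (simp add: a_def mult_ac)
next
  case False
  define a where "a = ln (real n)"
  define d where "d = 1 - 2*r"
  have l: "1 \<le> a" using n unfolding a_def by (rule ln_of_nat_ge_1)
  have d: "0 < d" "d \<le> 1" using False p r by (auto simp: d_def less_le)
  have "(\<Sum>i=1..n. real i powr (-2*r) * ln (exp 1 * real n / real i) powr (p-1)) \<le>
     4 powr p * p powr p * real n powr d / d powr p"
    unfolding d_def using n r p d by (intro sum_ln_powr_le_div) (auto simp: d_def)
  also have "\<dots> = 8 powr p * p powr p * real n powr d * (a powr p / (2 * (d * a)) powr p)"
    using l d powr_mult[of 4 2 p] by (simp add: powr_mult)
  also have "\<dots> \<le> 8 powr p * p powr p * real n powr d * (a powr p / (p + d * a) powr p)"
  proof -
    have "0 < p + d * a" using p d l by (intro add_pos_nonneg) auto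
    moreover have "p + d * a \<le> 2 * (d * a)" using False unfolding a_def d_def by linarith
    moreover from calculation have "p + d * a \<noteq> 0" by linarith
    ultimately show ?thesis
      using p d l
      by (intro mult_left_mono divide_left_mono powr_mono2 mult_pos_pos) auto
  qed
  finally show ?thesis by (simp add: a_def d_def)
qed

lemma sum_ln_powr_le_half_less:
  assumes n: "3 \<le> n" and r: "1/2 < r" and p: "1 \<le> p"
  shows "(\<Sum>i=1..n. real i powr (-2*r) * ln (exp 1 * real n / real i) powr (p-1)) \<le>
    2 powr p * (ln (real n) powr p / (1 + (2*r-1) * ln (real n)) + ln (real n) powr (p-1))"
proof -
  define a where "a = ln (real n)"
  have l: "1 \<le> a" using n unfolding a_def by (rule ln_of_nat_ge_1)
  have "(\<Sum>i=1..n. real i powr (-2*r) * ln (exp 1 * real n / real i) powr (p-1)) \<le>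
    (2 * a) powr (p-1) * (\<Sum>i=1..n. real i powr (-2*r))"
    unfolding a_def using n p by (rule sum_ln_powr_le_crude)
  also have "\<dots> \<le> (2 * a) powr (p-1) * (1 + 2 * (a / (1 + (2*r-1) * a)))"
    using sum_powr_le_nonpos_quotient[of n "1-2*r"] n r by (intro mult_left_mono) (auto simp: a_def)
  also have "\<dots> \<le> (2 * a) powr (p-1) * (2 * (1 + a / (1 + (2*r-1) * a)))"
    using l r by (intro mult_left_mono) auto
  also have "\<dots> = 2 powr p * (a powr p / (1 + (2*r-1) * a) + a powr (p-1))"
    using l by (simp add: powr_mult powr_diff field_simps)
  finally show ?thesis unfolding a_def .
qed

section \<open>The indices up to n/e\<close>

lemma idx_e_subset: "idx_e n \<subseteq> {1..n}"
proof -
  have "i \<le> n" if "real i \<le> real n / exp 1" for i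
  proof -
    have "real n / exp 1 \<le> real n" by (simp add: divide_le_eq mult_left_mono[of 1 "exp 1" "real n", simplified])
    with that show ?thesis by linarith
  qed
  then show "idx_e n \<subseteq> {1..n}" by (auto simp: idx_e_def)
qed

text \<open>The cut-off n/e makes ln (n/i) at least 1, so that ln (n/i) and ln (en/i) agree up to a
  factor 2.\<close>

lemma idx_e_bounds:
  assumes "i \<in> idx_e n"
  shows "1 \<le> i" "i \<le> n" "1 \<le> ln (real n / real i)"
    "ln (exp 1 * real n / real i) \<le> 2 * ln (real n / real i)"
proof -
  show i: "1 \<le> i" "i \<le> n" using assms idx_e_subset[of n] by auto
  have "exp 1 \<le> real n / real i" using assms i by (auto simp: idx_e_def field_simps)
  then show l: "1 \<le> ln (real n / real i)" using i by (simp add: ln_ge_iff)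
  have "ln (exp 1 * real n / real i) = 1 + ln (real n / real i)"
    using i by (simp add: ln_div ln_mult)
  with l show "ln (exp 1 * real n / real i) \<le> 2 * ln (real n / real i)" by simp
qed

lemma one_in_idx_e: "3 \<le> n \<Longrightarrow> 1 \<in> idx_e n"
  using exp_le by (simp add: idx_e_def le_divide_eq)

text \<open>The function u ln (n/u) has derivative ln (n/u) - 1, non-negative up to n/e; in discrete
  form, i ln (j/i) <= j - i <= (j - i) ln (n/j). The monotonicity of the weights in Cases II and IVa
  rests on this.\<close>

lemma mult_ln_div_mono:
  assumes "i \<in> idx_e n" "j \<in> idx_e n" "i \<le> j"
  shows "real i * ln (real n / real i) \<le> real j * ln (real n / real j)"
proof -
  have i: "0 < real i" "0 < real j" "0 < real n" using idx_e_bounds(1,2)[OF assms(1)] assms(3) by auto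
  have eq: "ln (real n / real i) = ln (real n / real j) + ln (real j / real i)"
    using i by (simp add: ln_div)
  have "real i * ln (real j / real i) \<le> real i * (real j / real i - 1)"
    using i by (intro mult_left_mono ln_le_minus_one) auto
  also have "\<dots> = real j - real i" using i by (simp add: field_simps)
  also have "\<dots> \<le> (real j - real i) * ln (real n / real j)"
    using idx_e_bounds(3)[OF assms(2)] assms(3) mult_left_mono[of 1 "ln (real n / real j)" "real j - real i"] by simp
  finally show ?thesis by (simp add: eq algebra_simps)
qed

text \<open>With k the integer part of n/e, n < e (k+1) <= 3 (k+1) <= 6k. Six blocks of length k
  therefore cover {1..n}, and a non-increasing f sums over each block to at most its sum over the
  first.\<close>

lemma sum_le_sum_idx_e:
  fixes f :: "nat \<Rightarrow> real"
  assumes n: "3 \<le> n"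
    and anti: "\<And>i j. 1 \<le> i \<Longrightarrow> i \<le> j \<Longrightarrow> j \<le> n \<Longrightarrow> f j \<le> f i"
    and f: "\<And>i. i \<in> {1..n} \<Longrightarrow> 0 \<le> f i"
  shows "(\<Sum>i=1..n. f i) \<le> 6 * (\<Sum>i\<in>idx_e n. f i)"
proof -
  define k where "k = nat \<lfloor>real n / exp 1\<rfloor>"
  have "1 \<le> real n / exp 1" using one_in_idx_e[OF n] by (simp add: idx_e_def)
  then have k1: "1 \<le> k" by (simp add: k_def le_nat_iff)
  have idx: "idx_e n = {1..k}" by (auto simp: idx_e_def k_def le_nat_iff le_floor_iff)
  have kn: "k \<le> n" using idx idx_e_subset[of n] k1 by auto
  have "real n / exp 1 < real k + 1" unfolding k_def by linarith
  then have "real n < (real k + 1) * exp 1" by (simp add: field_simps)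
  also have "\<dots> \<le> (real k + 1) * 3" using exp_le by (intro mult_left_mono) auto
  finally have "real n \<le> real (6 * k)" using k1 by simp
  then have n6: "n \<le> 6 * k" by linarith
  \<comment> \<open>Indices are shifted to start at 0 and f is continued by 0 beyond n, so that the
    range can be lengthened to 6k and cut into equal blocks.\<close>
  define F where "F i = (if i < n then f (Suc i) else 0)" for i
  have "(\<Sum>i=1..n. f i) = (\<Sum>i<n. F i)"
    by (simp add: F_def sum.atLeast1_atMost_eq)
  also have "\<dots> \<le> (\<Sum>i<6*k. F i)"
    using n6 f by (intro sum_mono2) (auto simp: F_def)
  also have "\<dots> = (\<Sum>m<6. sum F {m*k..<m*k+k})" by (rule sum.nat_group[symmetric])
  also have "\<dots> \<le> (\<Sum>m<6::nat. \<Sum>i<k. F i)"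
  proof (rule sum_mono)
    fix m :: nat
    have "sum F {m*k..<m*k+k} = (\<Sum>i<k. F (i + m*k))"
      using sum.shift_bounds_nat_ivl[of F 0 "m*k" k] by (simp add: lessThan_atLeast0 add.commute)
    also have "\<dots> \<le> (\<Sum>i<k. F i)"
      using anti f kn by (intro sum_mono) (auto simp: F_def)
    finally show "sum F {m*k..<m*k+k} \<le> (\<Sum>i<k. F i)" .
  qed
  also have "\<dots> = 6 * (\<Sum>i<k. F i)" by simp
  also have "(\<Sum>i<k. F i) = (\<Sum>i\<in>idx_e n. f i)"
    unfolding idx using kn by (simp add: F_def sum.atLeast1_atMost_eq)
  finally show ?thesis .
qed

section \<open>Gaussian order statistics\<close>

text \<open>Multiplying the density by exp (l x^2) gives \<open>\<sigma>\<close> times the density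
  of a centred normal variable of variance 1/(1-2l).\<close>

lemma std_normal_square_mgf:
  fixes l :: real
  assumes "l < 1/2"
  shows "(\<integral>\<^sup>+x. ennreal (std_normal_density x) * ennreal (exp (l * x\<^sup>2)) \<partial>lborel) = ennreal ((1-2*l) powr (-1/2))"
proof -
  define \<sigma> where "\<sigma> = 1 / sqrt (1-2*l)"
  have \<sigma>: "0 < \<sigma>" "\<sigma>\<^sup>2 = 1/(1-2*l)" using assms by (auto simp: \<sigma>_def power_divide)
  have sq: "(1-2*l) powr (-1/2) = \<sigma>"
    using assms by (simp add: \<sigma>_def powr_minus_divide powr_half_sqrt)
  have "std_normal_density x * exp (l * x\<^sup>2) = \<sigma> * normal_density 0 \<sigma> x" for x
  proof -
    have "sqrt (2 * pi * \<sigma>\<^sup>2) = sqrt (2*pi) * \<sigma>" using \<sigma>(1) by (simp add: real_sqrt_mult)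
    moreover have "- x\<^sup>2 / (2 * \<sigma>\<^sup>2) = - x\<^sup>2 / 2 + l * x\<^sup>2"
      using assms by (simp add: \<sigma>(2) field_simps)
    ultimately show ?thesis
      using \<sigma>(1) by (simp add: normal_density_def mult_exp_exp)
  qed
  then have "(\<integral>\<^sup>+x. ennreal (std_normal_density x) * ennreal (exp (l * x\<^sup>2)) \<partial>lborel) =
      (\<integral>\<^sup>+x. ennreal (\<sigma> * normal_density 0 \<sigma> x) \<partial>lborel)"
    by (simp flip: ennreal_mult')
  also have "\<dots> = ennreal (\<integral>x. \<sigma> * normal_density 0 \<sigma> x \<partial>lborel)"
    using \<sigma>(1) by (intro nn_integral_eq_integral) auto
  also have "\<dots> = ennreal \<sigma>" using \<sigma>(1) by simp
  finally show ?thesis using sq by simp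
qed

lemma std_normal_vector_measurable:
  assumes "std_normal_vector M n X" "j \<in> {1..n}"
  shows "(\<lambda>\<omega>. X \<omega> j) \<in> borel_measurable M"
  using assms by (auto simp: std_normal_vector_def distributed_def)

lemma sum_squares_mgf:
  fixes l :: real
  assumes X: "std_normal_vector M n X" and J: "J \<subseteq> {1..n}" and l: "l < 1/2"
  shows "(\<integral>\<^sup>+\<omega>. ennreal (exp (l * (\<Sum>j\<in>J. (X \<omega> j)\<^sup>2))) \<partial>M) = ennreal ((1-2*l) powr (- real (card J) / 2))"
proof -
  interpret prob_space M using X by (simp add: std_normal_vector_def)
  have fin: "finite J" using J finite_subset by blast
  have "indep_vars (\<lambda>_. borel) (\<lambda>j \<omega>. X \<omega> j) J"
    using X J by (auto simp: std_normal_vector_def intro: indep_vars_subset)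
  then have ind: "indep_vars (\<lambda>_. borel) (\<lambda>j \<omega>. ennreal (exp (l * (X \<omega> j)\<^sup>2))) J"
    by (rule indep_vars_compose2[where Y = "\<lambda>_ x. ennreal (exp (l * x\<^sup>2))"]) auto
  have one: "(\<integral>\<^sup>+\<omega>. ennreal (exp (l * (X \<omega> j)\<^sup>2)) \<partial>M) = ennreal ((1-2*l) powr (-1/2))" if "j \<in> J" for j
  proof -
    have "distributed M lborel (\<lambda>\<omega>. X \<omega> j) std_normal_density"
      using X J that by (auto simp: std_normal_vector_def)
    from distributed_nn_integral[OF this, of "\<lambda>x. ennreal (exp (l * x\<^sup>2))"] std_normal_square_mgf[OF l]
    show ?thesis by simp
  qed
  have "(\<integral>\<^sup>+\<omega>. ennreal (exp (l * (\<Sum>j\<in>J. (X \<omega> j)\<^sup>2))) \<partial>M) =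
      (\<integral>\<^sup>+\<omega>. (\<Prod>j\<in>J. ennreal (exp (l * (X \<omega> j)\<^sup>2))) \<partial>M)"
    by (simp add: sum_distrib_left exp_sum[OF fin] prod_ennreal)
  also have "\<dots> = (\<Prod>j\<in>J. ennreal ((1-2*l) powr (-1/2)))"
    by (subst indep_vars_nn_integral[OF fin ind]) (auto simp: one)
  also have "\<dots> = ennreal (((1-2*l) powr (-1/2)) ^ card J)"
    by (simp add: ennreal_power)
  also have "((1-2*l) powr (-1/2)) ^ card J = (1-2*l) powr (- real (card J) / 2)"
    using l by (simp add: powr_powr flip: powr_realpow)
  finally show ?thesis .
qed

text \<open>The Chernoff parameter \<open>l\<close> is left free: the union bound takes 1/4, while
  Case IVb takes the optimal value.\<close>

lemma sum_squares_tail: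
  fixes l s :: real
  assumes X: "std_normal_vector M n X" and J: "J \<subseteq> {1..n}" and l: "0 \<le> l" "l < 1/2"
  shows "measure M {\<omega> \<in> space M. s \<le> (\<Sum>j\<in>J. (X \<omega> j)\<^sup>2)} \<le> (1-2*l) powr (- real (card J) / 2) * exp (- l * s)"
proof -
  interpret prob_space M using X by (simp add: std_normal_vector_def)
  have [measurable]: "(\<lambda>\<omega>. \<Sum>j\<in>J. (X \<omega> j)\<^sup>2) \<in> borel_measurable M"
    using std_normal_vector_measurable[OF X] J by (intro borel_measurable_sum borel_measurable_power) auto
  have "emeasure M {\<omega> \<in> space M. s \<le> (\<Sum>j\<in>J. (X \<omega> j)\<^sup>2)} \<le>
      emeasure M {\<omega> \<in> space M. 1 \<le> ennreal (exp (- l * s)) * ennreal (exp (l * (\<Sum>j\<in>J. (X \<omega> j)\<^sup>2)))}"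
  proof (rule emeasure_mono)
    show "{\<omega> \<in> space M. s \<le> (\<Sum>j\<in>J. (X \<omega> j)\<^sup>2)} \<subseteq>
        {\<omega> \<in> space M. 1 \<le> ennreal (exp (- l * s)) * ennreal (exp (l * (\<Sum>j\<in>J. (X \<omega> j)\<^sup>2)))}"
      using l by (auto simp: mult_left_mono simp flip: ennreal_mult' exp_add)
  qed measurable
  also have "\<dots> \<le> ennreal (exp (- l * s)) * (\<integral>\<^sup>+\<omega>. ennreal (exp (l * (\<Sum>j\<in>J. (X \<omega> j)\<^sup>2))) * indicator (space M) \<omega> \<partial>M)"
    by (rule nn_integral_Markov_inequality) measurable
  also have "(\<integral>\<^sup>+\<omega>. ennreal (exp (l * (\<Sum>j\<in>J. (X \<omega> j)\<^sup>2))) * indicator (space M) \<omega> \<partial>M) =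
      (\<integral>\<^sup>+\<omega>. ennreal (exp (l * (\<Sum>j\<in>J. (X \<omega> j)\<^sup>2))) \<partial>M)"
    by (intro nn_integral_cong) auto
  also have "\<dots> = ennreal ((1-2*l) powr (- real (card J) / 2))"
    by (rule sum_squares_mgf[OF X J l(2)])
  finally show ?thesis
    by (simp add: emeasure_eq_measure mult.commute flip: ennreal_mult')
qed

text \<open>The number k^k / k! is one term of the series of exp k, and the binomial coefficient is
  at most n^k / k!; together they give (en/k)^k, written here as an exponential.\<close>

lemma choose_le_exp:
  assumes "1 \<le> k" "k \<le> n"
  shows "real (n choose k) \<le> exp (real k * ln (exp 1 * real n / real k))"
proof -
  have "real k ^ k / fact k \<le> (\<Sum>i\<le>k. real k ^ i / fact i)"
    by (rule member_le_sum) auto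
  also have "\<dots> \<le> exp (real k)"
  proof -
    have "(\<Sum>i\<in>{..k}. real k ^ i /\<^sub>R fact i) \<le> (\<Sum>i. real k ^ i /\<^sub>R fact i)"
      using summable_exp_generic[of "real k"] by (intro sum_le_suminf) auto
    then show ?thesis by (simp add: exp_def divide_inverse mult.commute)
  qed
  finally have k: "real k ^ k \<le> exp (real k) * fact k" by (simp add: field_simps)
  have "real (n choose k) * fact k \<le> real n ^ k"
    using binomial_fact_pow[of n k] by (metis of_nat_fact of_nat_le_iff of_nat_mult of_nat_power)
  then have "real (n choose k) * real k ^ k * fact k \<le> real n ^ k * (exp (real k) * fact k)"
    using k by (smt (verit) ab_semigroup_mult_class.mult_ac(1) exp_gt_zero fact_gt_zero mult.commute mult_mono of_nat_0_le_iff zero_le_mult_iff zero_le_power)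
  then have "real (n choose k) * real k ^ k \<le> real n ^ k * exp 1 ^ k"
    by (simp flip: exp_of_nat_mult)
  also have "\<dots> = exp (real k * ln (exp 1 * real n / real k)) * real k ^ k"
    using assms by (simp add: exp_of_nat_mult power_divide power_mult_distrib)
  finally show ?thesis using assms by simp
qed

lemma rearr_measurable:
  assumes X: "std_normal_vector M n X" and i: "i \<in> {1..n}"
  shows "(\<lambda>\<omega>. rearr n (X \<omega>) i) \<in> borel_measurable M"
proof (rule borel_measurableI_greater)
  fix s
  have fin: "finite {J. J \<subseteq> {1..n} \<and> card J = i}" by simp
  have "{\<omega> \<in> space M. s < rearr n (X \<omega>) i} =
     {\<omega> \<in> space M. \<exists>J\<in>{J. J \<subseteq> {1..n} \<and> card J = i}. \<forall>j\<in>J. s < \<bar>X \<omega> j\<bar>}"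
    unfolding rearr_greater_iff[OF i] ..
  also have "\<dots> \<in> sets M"
  proof (rule sets.sets_Collect_finite_Ex[OF _ fin])
    fix J assume "J \<in> {J. J \<subseteq> {1..n} \<and> card J = i}"
    then have J: "J \<subseteq> {1..n}" by simp
    then have "finite J" using finite_subset by blast
    moreover have "{\<omega> \<in> space M. s < \<bar>X \<omega> j\<bar>} \<in> sets M" if "j \<in> J" for j
    proof -
      have [measurable]: "(\<lambda>\<omega>. X \<omega> j) \<in> borel_measurable M"
        using std_normal_vector_measurable[OF X] J that by auto
      show ?thesis by measurable
    qed
    ultimately show "{\<omega> \<in> space M. \<forall>j\<in>J. s < \<bar>X \<omega> j\<bar>} \<in> sets M"
      by (intro sets.sets_Collect_finite_All) auto
  qed
  finally show "{\<omega> \<in> space M. s < rearr n (X \<omega>) i} \<in> sets M" .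
qed

section \<open>The typical event and its probability\<close>

definition typical :: "nat \<Rightarrow> real \<Rightarrow> (nat \<Rightarrow> real) \<Rightarrow> bool" where
  "typical n t x \<longleftrightarrow>
     (\<forall>k\<in>{1..n}. (\<Sum>i=1..k. (rearr n x i)\<^sup>2) \<le> 12 * (real k * ln (exp 1 * real n / real k) + t\<^sup>2))"

lemma ln_exp_div_ge_1:
  assumes "1 \<le> i" "i \<le> n"
  shows "1 \<le> ln (exp 1 * real n / real i)"
proof -
  have "exp 1 \<le> exp 1 * real n / real i" using assms by (simp add: field_simps)
  then show ?thesis using assms by (simp add: ln_ge_iff)
qed

lemma sum_exp_neg_le_1: "(\<Sum>k=1..n. exp (- real k)) \<le> 1"
proof -
  have e: "exp (-1) \<le> (1/2 :: real)"
    using exp_ge_add_one_self[of "1::real"] by (simp add: exp_minus field_simps)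
  have "(\<Sum>k=1..n. exp (- real k)) \<le> 1 - (1/2)^n"
  proof (induction n)
    case (Suc n)
    have "exp (- real (Suc n)) = exp (-1) ^ Suc n"
      using exp_of_nat_mult[of "Suc n" "-1::real"] by (simp del: of_nat_Suc power_Suc)
    also have "\<dots> \<le> (1/2) ^ Suc n" using e by (intro power_mono) auto
    finally show ?case using Suc by (simp add: field_simps)
  qed simp
  also have "\<dots> \<le> 1" by simp
  finally show ?thesis .
qed

text \<open>With y = k ln (en/k) there are at most exp y sets of size k, and the Chernoff bound with
  parameter 1/4 contributes exp (k/2 - s/4). The constant 12 makes s/4 equal to 3y + 3t^2; since y
  >= k, at most exp (-k - t^2/2) remains for each k, and the factors exp (-k) sum to at most
  1.\<close>

lemma prob_typical:
  assumes X: "std_normal_vector M n X"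
  shows "{\<omega> \<in> space M. typical n t (X \<omega>)} \<in> sets M"
    and "1 - exp (- t\<^sup>2 / 2) \<le> measure M {\<omega> \<in> space M. typical n t (X \<omega>)}"
proof -
  interpret prob_space M using X by (simp add: std_normal_vector_def)
  define s where "s k = 12 * (real k * ln (exp 1 * real n / real k) + t\<^sup>2)" for k
  define \<J> where "\<J> k = {J. J \<subseteq> {1..n} \<and> card J = k}" for k
  define T where "T J = {\<omega> \<in> space M. s (card J) \<le> (\<Sum>j\<in>J. (X \<omega> j)\<^sup>2)}" for J
  show meas: "{\<omega> \<in> space M. typical n t (X \<omega>)} \<in> sets M"
    unfolding typical_def
  proof (intro sets.sets_Collect_finite_All)
    fix k assume k: "k \<in> {1..n}"
    have [measurable]: "(\<lambda>\<omega>. \<Sum>i=1..k. (rearr n (X \<omega>) i)\<^sup>2) \<in> borel_measurable M"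
      using k by (intro borel_measurable_sum borel_measurable_power rearr_measurable[OF X]) auto
    show "{\<omega> \<in> space M. (\<Sum>i=1..k. (rearr n (X \<omega>) i)\<^sup>2)
        \<le> 12 * (real k * ln (exp 1 * real n / real k) + t\<^sup>2)} \<in> sets M" by measurable
  qed simp
  have T_meas: "T J \<in> sets M" if "J \<in> \<J> k" for J k
  proof -
    have [measurable]: "(\<lambda>\<omega>. \<Sum>j\<in>J. (X \<omega> j)\<^sup>2) \<in> borel_measurable M"
      using std_normal_vector_measurable[OF X] that
      by (intro borel_measurable_sum borel_measurable_power) (auto simp: \<J>_def)
    show ?thesis unfolding T_def by measurable
  qed
  have fin: "finite (\<J> k)" for k unfolding \<J>_def by simp
  have T_prob: "prob (\<Union>J\<in>\<J> k. T J) \<le> exp (- real k) * exp (- t\<^sup>2 / 2)" if k: "k \<in> {1..n}" for k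
  proof -
    define y where "y = real k * ln (exp 1 * real n / real k)"
    have sk: "s k = 12 * (y + t\<^sup>2)" by (simp add: s_def y_def)
    have ky: "real k \<le> y" using ln_exp_div_ge_1[of k n] k by (simp add: y_def mult_left_mono[of 1])
    have half: "(1/2) powr (- real k / 2) \<le> exp (real k / 2)"
    proof -
      have "(1/2) powr (- real k / 2) = exp (real k / 2 * ln 2)"
        by (simp add: powr_def ln_div)
      also have "\<dots> \<le> exp (real k / 2 * 1)"
        using ln_le_minus_one[of "2::real"] unfolding exp_le_cancel_iff by (intro mult_left_mono) auto
      finally show ?thesis by simp
    qed
    have "prob (\<Union>J\<in>\<J> k. T J) \<le> (\<Sum>J\<in>\<J> k. prob (T J))"
      using T_meas fin by (intro finite_measure_subadditive_finite) auto
    also have "\<dots> \<le> (\<Sum>J\<in>\<J> k. exp (real k / 2) * exp (- (1/4) * s k))"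
    proof (rule sum_mono)
      fix J assume "J \<in> \<J> k"
      then have J: "J \<subseteq> {1..n}" "card J = k" by (auto simp: \<J>_def)
      from sum_squares_tail[OF X J(1), of "1/4" "s k"]
      have "prob (T J) \<le> (1/2) powr (- real k / 2) * exp (- (1/4) * s k)" by (simp add: T_def J)
      also have "\<dots> \<le> exp (real k / 2) * exp (- (1/4) * s k)"
        using half by (intro mult_right_mono) auto
      finally show "prob (T J) \<le> exp (real k / 2) * exp (- (1/4) * s k)" .
    qed
    also have "\<dots> = real (n choose k) * (exp (real k / 2) * exp (- (1/4) * s k))"
      by (simp add: \<J>_def n_subsets)
    also have "\<dots> \<le> exp y * (exp (real k / 2) * exp (- (1/4) * s k))"
      using choose_le_exp[of k n] k by (intro mult_right_mono) (auto simp: y_def)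
    also have "\<dots> = exp (y + real k / 2 - 3 * y - 3 * t\<^sup>2)"
      by (simp add: sk algebra_simps flip: exp_add)
    also have "\<dots> \<le> exp (- real k + - t\<^sup>2 / 2)"
      using ky zero_le_power2[of t] by (subst exp_le_cancel_iff) linarith
    finally show ?thesis by (simp only: exp_add)
  qed
  have sub: "space M - {\<omega> \<in> space M. typical n t (X \<omega>)} \<subseteq> (\<Union>k\<in>{1..n}. \<Union>J\<in>\<J> k. T J)"
  proof
    fix \<omega> assume "\<omega> \<in> space M - {\<omega> \<in> space M. typical n t (X \<omega>)}"
    then have \<omega>: "\<omega> \<in> space M" "\<not> typical n t (X \<omega>)" by auto
    then obtain k where k: "k \<in> {1..n}" "s k < (\<Sum>i=1..k. (rearr n (X \<omega>) i)\<^sup>2)"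
      by (auto simp: typical_def s_def not_le)
    obtain J where J: "J \<subseteq> {1..n}" "card J = k"
      "\<And>f::real \<Rightarrow> real. (\<Sum>i=1..k. f (rearr n (X \<omega>) i)) = (\<Sum>j\<in>J. f \<bar>X \<omega> j\<bar>)"
      using sum_top_rearr[of k n "X \<omega>"] k by auto
    have "s k < (\<Sum>j\<in>J. (X \<omega> j)\<^sup>2)" using k J(3)[of "\<lambda>u. u\<^sup>2"] by simp
    then have "\<omega> \<in> T J" using \<omega> J by (simp add: T_def)
    moreover have "J \<in> \<J> k" using J by (simp add: \<J>_def)
    ultimately show "\<omega> \<in> (\<Union>k\<in>{1..n}. \<Union>J\<in>\<J> k. T J)" using k by blast
  qed
  have "1 - prob {\<omega> \<in> space M. typical n t (X \<omega>)} = prob (space M - {\<omega> \<in> space M. typical n t (X \<omega>)})"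
    using prob_compl[OF meas] by simp
  also have "\<dots> \<le> prob (\<Union>k\<in>{1..n}. \<Union>J\<in>\<J> k. T J)"
    using sub T_meas fin by (intro finite_measure_mono sets.finite_UN) auto
  also have "\<dots> \<le> (\<Sum>k=1..n. prob (\<Union>J\<in>\<J> k. T J))"
    using T_meas fin by (intro finite_measure_subadditive_finite) (auto intro!: sets.finite_UN)
  also have "\<dots> \<le> (\<Sum>k=1..n. exp (- real k) * exp (- t\<^sup>2 / 2))"
    by (intro sum_mono T_prob)
  also have "\<dots> \<le> 1 * exp (- t\<^sup>2 / 2)"
    unfolding sum_distrib_right[symmetric] by (intro mult_right_mono sum_exp_neg_le_1) simp
  finally show "1 - exp (- t\<^sup>2 / 2) \<le> prob {\<omega> \<in> space M. typical n t (X \<omega>)}" by simp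
qed

text \<open>This removes probability from Cases I to IVa: N <= S has to follow from typicality, and
  the weighted sum has to be bounded wherever N <= S. The constant in front of the exponential is
  1.\<close>

lemma concentrates_if_typical:
  assumes X: "std_normal_vector M n X"
    and meas: "(\<lambda>\<omega>. N (X \<omega>)) \<in> borel_measurable M"
    and good: "\<And>x. typical n t x \<Longrightarrow> N x \<le> S"
    and R: "\<And>x. N x \<le> S \<Longrightarrow> wsum n r p x \<le> R"
  shows "concentrates M n r p t X N S R 1"
proof -
  interpret prob_space M using X by (simp add: std_normal_vector_def)
  have "1 - exp (- t\<^sup>2 / 2) \<le> prob {\<omega> \<in> space M. typical n t (X \<omega>)}"
    by (rule prob_typical[OF X])
  also have "\<dots> \<le> prob {\<omega> \<in> space M. N (X \<omega>) \<le> S}"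
    using good meas by (intro finite_measure_mono) auto
  finally show ?thesis using R by (simp add: concentrates_def)
qed

section \<open>Deterministic consequences and the four cases\<close>

lemma pow0_nonneg: "0 \<le> pow0 x a"
  by (simp add: pow0_def)

lemma pow0_mono: "0 \<le> x \<Longrightarrow> x \<le> y \<Longrightarrow> 0 \<le> a \<Longrightarrow> pow0 x a \<le> pow0 y a"
  by (auto simp: pow0_def intro: powr_mono2)

lemma pow0_mult: "0 \<le> x \<Longrightarrow> 0 \<le> y \<Longrightarrow> pow0 (x * y) a = pow0 x a * pow0 y a"
  by (simp add: pow0_def powr_mult)

lemma pow0_pos: "0 < x \<Longrightarrow> pow0 x a = x powr a"
  by (simp add: pow0_def)

lemma pow0_double: "0 \<le> x \<Longrightarrow> pow0 x (2 * a) = pow0 (x\<^sup>2) a"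
  by (cases "x = 0") (auto simp: pow0_def powr_powr simp flip: powr_numeral)

text \<open>At q = 0, which arises from p = 1, both sides reduce to the sum of a, because
  \<open>pow0\<close> is then 1 even at 0.\<close>

lemma Holder_pow0:
  fixes a b :: "'a \<Rightarrow> real"
  assumes q: "0 \<le> q" "q < 1"
    and a: "\<And>i. i \<in> I \<Longrightarrow> 0 \<le> a i" and b: "\<And>i. i \<in> I \<Longrightarrow> 0 \<le> b i"
  shows "(\<Sum>i\<in>I. a i powr (1-q) * pow0 (b i) q) \<le> sum a I powr (1-q) * pow0 (sum b I) q"
proof (cases "q = 0")
  case True
  then show ?thesis using a sum_nonneg[of I a] by (simp add: pow0_def)
next
  case False
  then show ?thesis using Holder_sum[of q I a b] assms by (simp add: pow0_def)
qed

lemma typical_pointwise: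
  assumes "typical n t x" and i: "i \<in> {1..n}"
  shows "(rearr n x i)\<^sup>2 \<le> 12 * (ln (exp 1 * real n / real i) + t\<^sup>2 / real i)"
proof -
  have "real i * (rearr n x i)\<^sup>2 = (\<Sum>j=1..i. (rearr n x i)\<^sup>2)" by simp
  also have "\<dots> \<le> (\<Sum>j=1..i. (rearr n x j)\<^sup>2)"
    using i by (intro sum_mono power_mono rearr_antimono rearr_nonneg) auto
  also have "\<dots> \<le> 12 * (real i * ln (exp 1 * real n / real i) + t\<^sup>2)"
    using assms by (auto simp: typical_def)
  finally show ?thesis using i by (simp add: field_simps)
qed

text \<open>Let \<open>m\<close> be the last index with \<open>x\<^sub>[\<^sub>m\<^sub>]\<^sup>2 > 24 ln (en/m)\<close>. Then the logarithmic part of the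
  bound on the partial sum up to \<open>m\<close> is at most half of that sum, so it is absorbed.\<close>

lemma typical_split:
  assumes tx: "typical n t x"
  obtains b where "\<And>i. i \<in> {1..n} \<Longrightarrow> 0 \<le> b i" "sum b {1..n} \<le> 24 * t\<^sup>2"
    "\<And>i. i \<in> {1..n} \<Longrightarrow> (rearr n x i)\<^sup>2 \<le> 24 * ln (exp 1 * real n / real i) \<or> (rearr n x i)\<^sup>2 \<le> b i"
proof (cases "\<exists>i\<in>{1..n}. 24 * ln (exp 1 * real n / real i) < (rearr n x i)\<^sup>2")
  case False
  then show thesis by (intro that[of "\<lambda>_. 0"]) (auto simp: not_less)
next
  case True
  define A where "A = {i \<in> {1..n}. 24 * ln (exp 1 * real n / real i) < (rearr n x i)\<^sup>2}"
  define m where "m = Max A"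
  have A: "finite A" "A \<noteq> {}" using True by (auto simp: A_def)
  then have mA: "m \<in> A" unfolding m_def by (rule Max_in)
  then have m: "m \<in> {1..n}" and big: "24 * ln (exp 1 * real n / real m) < (rearr n x m)\<^sup>2"
    by (auto simp: A_def)
  define b where "b i = (if i \<le> m then (rearr n x i)\<^sup>2 else 0)" for i
  have part: "sum b {1..n} = (\<Sum>i=1..m. (rearr n x i)\<^sup>2)"
    using m by (intro sum.mono_neutral_cong_right) (auto simp: b_def)
  have "real m * (24 * ln (exp 1 * real n / real m)) \<le> real m * (rearr n x m)\<^sup>2"
    using big by (intro mult_left_mono) auto
  also have "\<dots> = (\<Sum>i=1..m. (rearr n x m)\<^sup>2)" by simp
  also have "\<dots> \<le> (\<Sum>i=1..m. (rearr n x i)\<^sup>2)"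
    using m by (intro sum_mono power_mono rearr_antimono rearr_nonneg) auto
  finally have "real m * (24 * ln (exp 1 * real n / real m)) \<le> (\<Sum>i=1..m. (rearr n x i)\<^sup>2)" .
  moreover have "(\<Sum>i=1..m. (rearr n x i)\<^sup>2) \<le> 12 * (real m * ln (exp 1 * real n / real m) + t\<^sup>2)"
    using tx m by (simp add: typical_def)
  ultimately have "sum b {1..n} \<le> 24 * t\<^sup>2" unfolding part by (simp add: algebra_simps)
  moreover have "(rearr n x i)\<^sup>2 \<le> 24 * ln (exp 1 * real n / real i) \<or> (rearr n x i)\<^sup>2 \<le> b i"
    if i: "i \<in> {1..n}" for i
  proof (cases "i \<le> m")
    case False
    then have "i \<notin> A" using Max_ge[OF A(1), of i] by (auto simp: m_def)
    then show ?thesis using i by (auto simp: A_def)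
  qed (simp add: b_def)
  ultimately show thesis by (intro that[of b]) (auto simp: b_def)
qed

section \<open>Weighted power sums of a typical vector\<close>

lemma powr_double_rearr:
  assumes "i \<in> {1..n}" "0 < \<theta>"
  shows "rearr n x i powr (2*\<theta>) = ((rearr n x i)\<^sup>2) powr \<theta>"
  using rearr_nonneg[OF assms(1), of x] assms(2)
  by (cases "rearr n x i = 0") (auto simp: powr_powr simp flip: powr_numeral)

text \<open>Each square lies below one of two bounds, so its power \<open>\<theta>\<close> is at
  most the sum of their powers for every \<open>\<theta>\<close> > 0; no constant arises from taking
  a power of a sum.\<close>

lemma typical_weighted_sum_split:
  assumes tx: "typical n t x" and \<theta>: "0 < \<theta>"
    and c: "\<And>i. i \<in> {1..n} \<Longrightarrow> 0 \<le> c i"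
  obtains b where "\<forall>i\<in>{1..n}. 0 \<le> b i" "sum b {1..n} \<le> 24 * t\<^sup>2"
    "(\<Sum>i=1..n. c i * rearr n x i powr (2*\<theta>)) \<le>
      24 powr \<theta> * (\<Sum>i=1..n. c i * ln (exp 1 * real n / real i) powr \<theta>) + (\<Sum>i=1..n. c i * b i powr \<theta>)"
proof -
  obtain b where b: "\<And>i. i \<in> {1..n} \<Longrightarrow> 0 \<le> b i" "sum b {1..n} \<le> 24 * t\<^sup>2"
    and ub: "\<And>i. i \<in> {1..n} \<Longrightarrow> (rearr n x i)\<^sup>2 \<le> 24 * ln (exp 1 * real n / real i) \<or> (rearr n x i)\<^sup>2 \<le> b i"
    using typical_split[OF tx] by blast
  have "(\<Sum>i=1..n. c i * rearr n x i powr (2*\<theta>)) \<le>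
     (\<Sum>i=1..n. 24 powr \<theta> * (c i * ln (exp 1 * real n / real i) powr \<theta>) + c i * b i powr \<theta>)"
  proof (rule sum_mono)
    fix i assume i: "i \<in> {1..n}"
    have "((rearr n x i)\<^sup>2) powr \<theta> \<le> (24 * ln (exp 1 * real n / real i)) powr \<theta> + b i powr \<theta>"
      using ub[OF i]
    proof
      assume "(rearr n x i)\<^sup>2 \<le> 24 * ln (exp 1 * real n / real i)"
      then have "((rearr n x i)\<^sup>2) powr \<theta> \<le> (24 * ln (exp 1 * real n / real i)) powr \<theta>"
        using \<theta> by (intro powr_mono2) auto
      then show ?thesis by (simp add: add_increasing2)
    next
      assume "(rearr n x i)\<^sup>2 \<le> b i"
      then have "((rearr n x i)\<^sup>2) powr \<theta> \<le> b i powr \<theta>"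
        using \<theta> by (intro powr_mono2) auto
      then show ?thesis by (simp add: add_increasing)
    qed
    then have "((rearr n x i)\<^sup>2) powr \<theta> \<le> 24 powr \<theta> * ln (exp 1 * real n / real i) powr \<theta> + b i powr \<theta>"
      by (simp only: powr_mult)
    then have "c i * ((rearr n x i)\<^sup>2) powr \<theta> \<le>
        c i * (24 powr \<theta> * ln (exp 1 * real n / real i) powr \<theta> + b i powr \<theta>)"
      using c[OF i] by (rule mult_left_mono)
    then show "c i * rearr n x i powr (2*\<theta>) \<le>
        24 powr \<theta> * (c i * ln (exp 1 * real n / real i) powr \<theta>) + c i * b i powr \<theta>"
      unfolding powr_double_rearr[OF i \<theta>] by (simp only: distrib_left mult.left_commute)
  qed
  also have "\<dots> = 24 powr \<theta> * (\<Sum>i=1..n. c i * ln (exp 1 * real n / real i) powr \<theta>) + (\<Sum>i=1..n. c i * b i powr \<theta>)"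
    by (simp add: sum.distrib sum_distrib_left)
  finally show thesis using that b by blast
qed

lemma powr_double_pos: "0 < t \<Longrightarrow> (t\<^sup>2) powr \<theta> = t powr (2*\<theta>)" for t :: real
  by (simp add: powr_powr flip: powr_numeral)

text \<open>Of the excess b only the total mass, at most 24 t^2, is known. Hoelder's inequality then
  gives the mass to the power \<open>\<theta>\<close> times the conjugate norm of c, of exponent
  1/(1-\<theta>).\<close>

lemma typical_weighted_sum_lt_1:
  assumes tx: "typical n t x" and \<theta>: "0 < \<theta>" "\<theta> < 1" and t: "0 < t"
    and c: "\<And>i. i \<in> {1..n} \<Longrightarrow> 0 \<le> c i"
  shows "(\<Sum>i=1..n. c i * rearr n x i powr (2*\<theta>)) \<le>
      24 powr \<theta> * ((\<Sum>i=1..n. c i * ln (exp 1 * real n / real i) powr \<theta>)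
        + (\<Sum>i=1..n. c i powr (1/(1-\<theta>))) powr (1-\<theta>) * t powr (2*\<theta>))"
proof -
  obtain b where b: "\<forall>i\<in>{1..n}. 0 \<le> b i" "sum b {1..n} \<le> 24 * t\<^sup>2"
    and ub: "(\<Sum>i=1..n. c i * rearr n x i powr (2*\<theta>)) \<le>
      24 powr \<theta> * (\<Sum>i=1..n. c i * ln (exp 1 * real n / real i) powr \<theta>) + (\<Sum>i=1..n. c i * b i powr \<theta>)"
    by (rule typical_weighted_sum_split[OF tx \<theta>(1) c])
  have "(\<Sum>i=1..n. c i * b i powr \<theta>) = (\<Sum>i=1..n. (c i powr (1/(1-\<theta>))) powr (1-\<theta>) * b i powr \<theta>)"
    using c \<theta> by (intro sum.cong) (auto simp: powr_powr)
  also have "\<dots> \<le> (\<Sum>i=1..n. c i powr (1/(1-\<theta>))) powr (1-\<theta>) * sum b {1..n} powr \<theta>"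
    using \<theta> b by (intro Holder_sum) auto
  also have "\<dots> \<le> (\<Sum>i=1..n. c i powr (1/(1-\<theta>))) powr (1-\<theta>) * (24 * t\<^sup>2) powr \<theta>"
    using \<theta> b by (intro mult_left_mono powr_mono2 sum_nonneg) auto
  also have "(24 * t\<^sup>2) powr \<theta> = 24 powr \<theta> * t powr (2*\<theta>)"
    unfolding powr_mult powr_double_pos[OF t] ..
  also have "(\<Sum>i=1..n. c i powr (1/(1-\<theta>))) powr (1-\<theta>) * (24 powr \<theta> * t powr (2*\<theta>)) =
      24 powr \<theta> * ((\<Sum>i=1..n. c i powr (1/(1-\<theta>))) powr (1-\<theta>) * t powr (2*\<theta>))"
    by (rule mult.left_commute)
  finally show ?thesis using ub unfolding distrib_left by linarith
qed

text \<open>For \<open>\<theta>\<close> >= 1 the total mass B alone suffices: since b <= B, the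
  power b^\<theta> is at most b B^(\<theta>-1), which sums to B^\<theta>.\<close>

lemma typical_weighted_sum_ge_1:
  assumes tx: "typical n t x" and \<theta>: "1 \<le> \<theta>" and t: "0 < t"
    and c: "\<And>i. i \<in> {1..n} \<Longrightarrow> 0 \<le> c i" "\<And>i. i \<in> {1..n} \<Longrightarrow> c i \<le> 1"
  shows "(\<Sum>i=1..n. c i * rearr n x i powr (2*\<theta>)) \<le>
      24 powr \<theta> * ((\<Sum>i=1..n. c i * ln (exp 1 * real n / real i) powr \<theta>) + t powr (2*\<theta>))"
proof -
  have \<theta>0: "0 < \<theta>" using \<theta> by simp
  obtain b where b: "\<forall>i\<in>{1..n}. 0 \<le> b i" "sum b {1..n} \<le> 24 * t\<^sup>2"
    and ub: "(\<Sum>i=1..n. c i * rearr n x i powr (2*\<theta>)) \<le>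
      24 powr \<theta> * (\<Sum>i=1..n. c i * ln (exp 1 * real n / real i) powr \<theta>) + (\<Sum>i=1..n. c i * b i powr \<theta>)"
    by (rule typical_weighted_sum_split[OF tx \<theta>0 c(1)])
  define B where "B = sum b {1..n}"
  have B: "0 \<le> B" unfolding B_def using b by (intro sum_nonneg) auto
  have "(\<Sum>i=1..n. c i * b i powr \<theta>) \<le> (\<Sum>i=1..n. b i * B powr (\<theta>-1))"
  proof (rule sum_mono)
    fix i assume i: "i \<in> {1..n}"
    then have iB: "b i \<le> B" unfolding B_def using b by (intro member_le_sum) auto
    have "c i * b i powr \<theta> \<le> 1 * b i powr \<theta>" using c i by (intro mult_right_mono) auto
    also have "\<dots> = b i * b i powr (\<theta>-1)"
      using bspec[OF b(1) i] by (cases "b i = 0") (auto simp: powr_diff)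
    also have "\<dots> \<le> b i * B powr (\<theta>-1)"
      using bspec[OF b(1) i] iB \<theta> by (intro mult_left_mono powr_mono2) auto
    finally show "c i * b i powr \<theta> \<le> b i * B powr (\<theta>-1)" .
  qed
  also have "\<dots> = B * B powr (\<theta>-1)" by (simp add: B_def sum_distrib_right)
  also have "\<dots> = B powr \<theta>" using B by (cases "B = 0") (auto simp: powr_diff)
  also have "\<dots> \<le> (24 * t\<^sup>2) powr \<theta>" using b B \<theta> unfolding B_def by (intro powr_mono2) auto
  also have "(24 * t\<^sup>2) powr \<theta> = 24 powr \<theta> * t powr (2*\<theta>)"
    unfolding powr_mult powr_double_pos[OF t] ..
  finally show ?thesis using ub unfolding distrib_left by linarith
qed

lemma wsum_nonneg: "0 \<le> wsum n r p x"
  unfolding wsum_def by (intro sum_nonneg mult_nonneg_nonneg pow0_nonneg) auto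

lemma wsum_measurable:
  assumes "std_normal_vector M n X"
  shows "(\<lambda>\<omega>. wsum n r p (X \<omega>)) \<in> borel_measurable M"
proof -
  have "(\<lambda>\<omega>. pow0 (rearr n (X \<omega>) i) a) \<in> borel_measurable M" if "i \<in> {1..n}" for i a
    using rearr_measurable[OF assms that]
    by (cases "a = 0") (auto simp: pow0_def intro!: powr_real_measurable)
  then show ?thesis unfolding wsum_def by (intro borel_measurable_sum borel_measurable_times) auto
qed

lemma weighted_rearr_measurable:
  assumes "std_normal_vector M n X" "I \<subseteq> {1..n}"
  shows "(\<lambda>\<omega>. \<Sum>i\<in>I. c i * rearr n (X \<omega>) i) \<in> borel_measurable M"
  using rearr_measurable[OF assms(1)] assms(2)
  by (intro borel_measurable_sum borel_measurable_times) auto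

text \<open>The coefficients are continued by 0 to {1..n}; they stay non-increasing because the
  indices up to n/e form an initial segment.\<close>

lemma is_norm_idx_e:
  assumes n: "3 \<le> n" and c: "\<And>i. i \<in> idx_e n \<Longrightarrow> 0 \<le> c i" and c1: "0 < c 1"
    and anti: "\<And>i j. i \<in> idx_e n \<Longrightarrow> j \<in> idx_e n \<Longrightarrow> i \<le> j \<Longrightarrow> c j \<le> c i"
  shows "is_norm n (\<lambda>x. \<Sum>i\<in>idx_e n. c i * rearr n x i)"
proof -
  define w where "w i = (if i \<in> idx_e n then c i else 0)" for i
  have "(\<Sum>i\<in>idx_e n. c i * rearr n x i) = (\<Sum>i=1..n. w i * rearr n x i powr 1) powr (1/1)" for x
  proof -
    have "(\<Sum>i=1..n. w i * rearr n x i powr 1) = (\<Sum>i\<in>idx_e n. c i * rearr n x i)"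
      using idx_e_subset[of n] rearr_nonneg[of _ n x]
      by (intro sum.mono_neutral_cong_right) (auto simp: w_def)
    moreover have "0 \<le> (\<Sum>i\<in>idx_e n. c i * rearr n x i)"
      using c idx_e_subset[of n] rearr_nonneg[of _ n x] by (intro sum_nonneg mult_nonneg_nonneg) auto
    ultimately show ?thesis by simp
  qed
  moreover have "is_norm n (\<lambda>x. (\<Sum>i=1..n. w i * rearr n x i powr 1) powr (1/1))"
  proof (rule is_norm_weighted_rearr)
    fix i j :: nat assume ij: "1 \<le> i" "i \<le> j" "j \<le> n"
    show "w j \<le> w i"
    proof (cases "j \<in> idx_e n")
      case True
      then have "real j \<le> real n / exp 1" by (simp add: idx_e_def)
      then have "real i \<le> real n / exp 1" using ij(2) by linarith
      then have "i \<in> idx_e n" using ij by (simp add: idx_e_def)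
      then show ?thesis using True anti ij by (simp add: w_def)
    qed (simp add: w_def c)
  qed (use n c c1 one_in_idx_e[OF n] in \<open>auto simp: w_def\<close>)
  ultimately show ?thesis by simp
qed

subsection \<open>Case I\<close>

text \<open>For \<open>\<kappa>\<close> = 2 - p this is the conjugate norm of the weights. The power
  sum has the parameter D = 1 - 2r/\<kappa>, and \<kappa> D = \<kappa> - 2r; as \<kappa> <= 1,
  |\<kappa> - 2r| <= |D|, so the denominator may be written with 2 - 2r - p.\<close>

lemma sum_powr_Holder_le:
  assumes n: "3 \<le> n" and r: "0 \<le> r" and k: "0 < \<kappa>" "\<kappa> \<le> 1"
  shows "(\<Sum>i=1..n. (real i powr (-2*r)) powr (1/\<kappa>)) powr \<kappa> \<le>
    4 * (1 + (ln (real n) / (1 + \<bar>\<kappa> - 2*r\<bar> * ln (real n))) powr \<kappa> * (1 + real n powr (\<kappa> - 2*r)))"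
proof -
  define D where "D = 1 - 2*r/\<kappa>"
  define a where "a = ln (real n)"
  have l: "1 \<le> a" using n unfolding a_def by (rule ln_of_nat_ge_1)
  have kD: "\<kappa> * D = \<kappa> - 2*r" using k by (simp add: D_def field_simps)
  have D1: "D \<le> 1" using r k by (simp add: D_def)
  have absD: "\<bar>\<kappa> - 2*r\<bar> \<le> \<bar>D\<bar>"
    unfolding kD[symmetric] abs_mult using k by (simp add: mult_left_le_one_le)
  define g where "g = (a / (1 + \<bar>\<kappa> - 2*r\<bar> * a)) powr \<kappa>"
  have gD: "(a / (1 + \<bar>D\<bar> * a)) powr \<kappa> \<le> g"
    unfolding g_def using l k absD
    by (intro powr_mono2 divide_left_mono add_left_mono mult_right_mono mult_pos_pos)
       (auto intro!: add_pos_nonneg divide_nonneg_pos)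
  have g0: "0 \<le> g" by (simp add: g_def)
  have "(\<Sum>i=1..n. (real i powr (-2*r)) powr (1/\<kappa>)) = (\<Sum>i=1..n. real i powr (D-1))"
    by (intro sum.cong) (auto simp: powr_powr D_def)
  also have "\<dots> powr \<kappa> \<le> 4 * (1 + g * (1 + real n powr (\<kappa> - 2*r)))"
  proof (cases "0 \<le> D")
    case True
    have "(\<Sum>i=1..n. real i powr (D-1)) powr \<kappa> \<le> (4 * (real n powr D * (a / (1 + \<bar>D\<bar> * a)))) powr \<kappa>"
      using sum_powr_le_nonneg_quotient[OF n True D1] k True
      by (intro powr_mono2 sum_nonneg) (auto simp: a_def)
    also have "\<dots> = 4 powr \<kappa> * (real n powr (\<kappa> - 2*r) * (a / (1 + \<bar>D\<bar> * a)) powr \<kappa>)"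
      unfolding powr_mult powr_powr kD[symmetric] by (simp add: mult.commute)
    also have "\<dots> \<le> 4 * (real n powr (\<kappa> - 2*r) * g)"
      using k powr_mono[of \<kappa> 1 4] gD by (intro mult_mono) auto
    also have "\<dots> \<le> 4 * (1 + g * (1 + real n powr (\<kappa> - 2*r)))"
      using g0 by (simp add: algebra_simps)
    finally show ?thesis .
  next
    case False
    have "(\<Sum>i=1..n. real i powr (D-1)) powr \<kappa> \<le> (1 + 2 * (a / (1 + \<bar>D\<bar> * a))) powr \<kappa>"
      using sum_powr_le_nonpos_quotient[OF n, of D] k False
      by (intro powr_mono2 sum_nonneg) (auto simp: a_def)
    also have "\<dots> \<le> 1 powr \<kappa> + (2 * (a / (1 + \<bar>D\<bar> * a))) powr \<kappa>"
      using k l by (intro powr_add_le) (auto intro!: divide_nonneg_pos add_pos_nonneg)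
    also have "\<dots> = 1 + 2 powr \<kappa> * (a / (1 + \<bar>D\<bar> * a)) powr \<kappa>"
      unfolding powr_mult by simp
    also have "\<dots> \<le> 1 + 2 * g"
      using k powr_mono[of \<kappa> 1 2] gD by (intro add_left_mono mult_mono) auto
    also have "\<dots> \<le> 4 * (1 + g * (1 + real n powr (\<kappa> - 2*r)))"
      using g0 by (simp add: algebra_simps)
    finally show ?thesis .
  qed
  finally show ?thesis by (simp only: a_def g_def)
qed

text \<open>The constants are 24 times 8 and 24 times 2: the 24 of the typical bound, and the bases
  8 and 2 of the logarithmic sums for r <= 1/2 and r > 1/2.\<close>

lemma sum_ln_le_A_I:
  assumes n: "3 \<le> n" and r: "0 \<le> r" and p: "1 \<le> p"
  shows "24 powr (p-1) * (\<Sum>i=1..n. real i powr (-2*r) * ln (exp 1 * real n / real i) powr (p-1))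
    \<le> A_I 192 48 48 n r p"
proof -
  have "24 powr (p-1) \<le> 24 powr p" by (rule powr_mono) auto
  then have "24 powr (p-1) * (\<Sum>i=1..n. real i powr (-2*r) * ln (exp 1 * real n / real i) powr (p-1)) \<le>
    24 powr p * (\<Sum>i=1..n. real i powr (-2*r) * ln (exp 1 * real n / real i) powr (p-1))"
    by (rule mult_right_mono) (intro sum_nonneg mult_nonneg_nonneg powr_ge_zero)
  also have "\<dots> \<le> A_I 192 48 48 n r p"
  proof (cases "r \<le> 1/2")
    case True
    have "24 powr p * (\<Sum>i=1..n. real i powr (-2*r) * ln (exp 1 * real n / real i) powr (p-1)) \<le>
      24 powr p * (8 powr p * p powr p * real n powr (1-2*r) * ln (real n) powr p / (p + (1-2*r) * ln (real n)) powr p)"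
      by (intro mult_left_mono sum_ln_powr_le n r True p) simp
    also have "\<dots> = A_I 192 48 48 n r p"
      using True r powr_mult[of 24 8 p] by (simp add: A_I_def)
    finally show ?thesis .
  next
    case False
    have "24 powr p * (\<Sum>i=1..n. real i powr (-2*r) * ln (exp 1 * real n / real i) powr (p-1)) \<le>
      24 powr p * (2 powr p * (ln (real n) powr p / (1 + (2*r-1) * ln (real n)) + ln (real n) powr (p-1)))"
      using False by (intro mult_left_mono sum_ln_powr_le_half_less n p) auto
    also have "\<dots> = A_I 192 48 48 n r p"
      using False r powr_mult[of 24 2 p] by (simp add: A_I_def algebra_simps)
    finally show ?thesis .
  qed
  finally show ?thesis .
qed

text \<open>The power is \<open>\<theta>\<close> = p - 1. For p < 2 the conjugate norm of the
  weights enters and 96 is 24 times 4; for p >= 2 the weights are at most 1 and only the total mass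
  of the excess counts.\<close>

lemma typical_wsum_le_I:
  assumes n: "3 \<le> n" and r: "0 \<le> r" and p: "3/2 \<le> p" and t: "0 < t" and tx: "typical n t x"
  shows "wsum n r p x \<le> A_I 192 48 48 n r p + B_I 96 24 n r p * t powr (2*(p-1))"
proof -
  have w: "wsum n r p x = (\<Sum>i=1..n. real i powr (-2*r) * rearr n x i powr (2*(p-1)))"
    using p by (simp add: wsum_def pow0_def)
  have A: "24 powr (p-1) * (\<Sum>i=1..n. real i powr (-2*r) * ln (exp 1 * real n / real i) powr (p-1))
    \<le> A_I 192 48 48 n r p" using n r p by (intro sum_ln_le_A_I) auto
  show ?thesis
  proof (cases "p < 2")
    case True
    have p': "1 - (p - 1) = 2 - p" "2 - p - 2*r = 2 - 2*r - p" by simp_all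
    have "wsum n r p x \<le> 24 powr (p-1) * ((\<Sum>i=1..n. real i powr (-2*r) * ln (exp 1 * real n / real i) powr (p-1))
        + (\<Sum>i=1..n. (real i powr (-2*r)) powr (1/(2-p))) powr (2-p) * t powr (2*(p-1)))"
      unfolding w using typical_weighted_sum_lt_1[OF tx, of "p-1" "\<lambda>i. real i powr (-2*r)"] p True t
      by (simp add: p')
    also have "\<dots> \<le> A_I 192 48 48 n r p +
        24 powr (p-1) * (\<Sum>i=1..n. (real i powr (-2*r)) powr (1/(2-p))) powr (2-p) * t powr (2*(p-1))"
      using A by (simp add: algebra_simps)
    also have "24 powr (p-1) * (\<Sum>i=1..n. (real i powr (-2*r)) powr (1/(2-p))) powr (2-p) \<le>
        24 * (4 * (1 + (ln (real n) / (1 + \<bar>2 - 2*r - p\<bar> * ln (real n))) powr (2-p) * (1 + real n powr (2 - 2*r - p))))"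
      using powr_mono[of "p-1" 1 24] True p sum_powr_Holder_le[OF n r, of "2-p"]
      by (intro mult_mono) (auto simp: p')
    also have "\<dots> = B_I 96 24 n r p" using True p by (simp add: B_I_def)
    finally show ?thesis by (simp add: mult_right_mono)
  next
    case False
    have "wsum n r p x \<le> 24 powr (p-1) * ((\<Sum>i=1..n. real i powr (-2*r) * ln (exp 1 * real n / real i) powr (p-1))
        + t powr (2*(p-1)))"
      unfolding w using typical_weighted_sum_ge_1[OF tx, of "p-1" "\<lambda>i. real i powr (-2*r)"] p False t r
         powr_mono[of "-2*r" 0]
      by simp
    also have "\<dots> \<le> A_I 192 48 48 n r p + 24 powr (p-1) * t powr (2*(p-1))"
      using A by (simp add: algebra_simps)
    also have "24 powr (p-1) \<le> B_I 96 24 n r p" using False by (simp add: B_I_def)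
    finally show ?thesis by (simp add: mult_right_mono)
  qed
qed

text \<open>As \<open>S\<close> is the root of \<open>R\<close>, the conditions on the norm and on
  the weighted sum are the same. Minkowski's inequality applies because the exponent 2(p-1) is at
  least 1 for p >= 3/2.\<close>

lemma case_I:
  fixes M :: "'a measure"
  assumes n: "3 \<le> n" and r: "0 \<le> r" and p: "3/2 \<le> p" and t: "0 < t"
  defines "R \<equiv> A_I 192 48 48 n r p + B_I 96 24 n r p * t powr (2*(p-1))"
  defines "S \<equiv> R powr (1 / (2*(p-1)))"
  shows "R = S powr (2*(p-1))"
    and "std_normal_vector M n X \<Longrightarrow> concentrates M n r p t X (norm_I n r p) S R 1"
    and "is_norm n (norm_I n r p)"
proof -
  \<comment> \<open>Non-negativity of \<open>A_I\<close> is read off from the sum that it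
    dominates.\<close>
  have "0 \<le> 24 powr (p-1) * (\<Sum>i=1..n. real i powr (-2*r) * ln (exp 1 * real n / real i) powr (p-1))"
    by (intro sum_nonneg mult_nonneg_nonneg powr_ge_zero)
  also have "\<dots> \<le> A_I 192 48 48 n r p" using n r p by (intro sum_ln_le_A_I) auto
  finally have "0 \<le> A_I 192 48 48 n r p" .
  moreover have "0 \<le> B_I 96 24 n r p"
    unfolding B_I_def by (intro add_nonneg_nonneg mult_nonneg_nonneg) auto
  ultimately have R: "0 \<le> R" unfolding R_def by auto
  then show RS: "R = S powr (2*(p-1))" using p by (simp add: S_def powr_powr)
  have mono: "norm_I n r p x \<le> S \<longleftrightarrow> wsum n r p x \<le> R" for x
  proof
    assume "norm_I n r p x \<le> S"
    then have "norm_I n r p x powr (2*(p-1)) \<le> S powr (2*(p-1))"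
      using p by (intro powr_mono2) (auto simp: norm_I_def)
    then show "wsum n r p x \<le> R" using p wsum_nonneg[of n r p x] unfolding RS[symmetric]
      by (simp add: norm_I_def powr_powr)
  next
    assume "wsum n r p x \<le> R"
    then show "norm_I n r p x \<le> S" unfolding norm_I_def S_def
      using p wsum_nonneg by (intro powr_mono2) auto
  qed
  show "concentrates M n r p t X (norm_I n r p) S R 1" if X: "std_normal_vector M n X"
  proof (rule concentrates_if_typical[OF X])
    show "(\<lambda>\<omega>. norm_I n r p (X \<omega>)) \<in> borel_measurable M"
      unfolding norm_I_def by (intro powr_real_measurable wsum_measurable[OF X]) auto
  qed (use mono typical_wsum_le_I[OF n r p t] in \<open>auto simp: R_def\<close>)
  have "is_norm n (\<lambda>x. (\<Sum>i=1..n. real i powr (-2*r) * rearr n x i powr (2*(p-1))) powr (1/(2*(p-1))))"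
    using n p r by (intro is_norm_weighted_rearr) (auto intro: powr_mono2')
  then show "is_norm n (norm_I n r p)"
    unfolding norm_I_def wsum_def using p by (simp add: pow0_def)
qed

subsection \<open>Case II\<close>

lemma divide_powr: "x / y powr e = x * y powr (- e)" for x y e :: real
  by (simp only: powr_minus divide_inverse)

lemma weighted_pow0_antimono:
  assumes "0 \<le> r" "0 \<le> q" "1 \<le> i" "i \<le> j" "j \<le> n"
  shows "real j powr (-2*r) * pow0 (rearr n x j) q \<le> real i powr (-2*r) * pow0 (rearr n x i) q"
  using assms by (intro mult_mono powr_mono2' pow0_mono rearr_antimono rearr_nonneg pow0_nonneg) auto

lemma wsum_le_sum_idx_e:
  assumes "3 \<le> n" "0 \<le> r" "1 \<le> p"
  shows "wsum n r p x \<le> 6 * (\<Sum>i\<in>idx_e n. real i powr (-2*r) * pow0 (rearr n x i) (2*(p-1)))"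
  unfolding wsum_def using assms
  by (intro sum_le_sum_idx_e weighted_pow0_antimono mult_nonneg_nonneg pow0_nonneg) auto

lemma L_II_ge:
  assumes "i \<in> idx_e n"
  shows "1 \<le> L_II n t i" "ln (exp 1 * real n / real i) + t\<^sup>2 / real i \<le> 2 * L_II n t i"
proof -
  define w where "w = t\<^sup>2 / real i"
  have "0 \<le> w" by (simp add: w_def)
  then have "1 \<le> ln (real n / real i) + w" "ln (exp 1 * real n / real i) + w \<le> 2 * (ln (real n / real i) + w)"
    using idx_e_bounds(3,4)[OF assms] by auto
  then show "1 \<le> L_II n t i" "ln (exp 1 * real n / real i) + t\<^sup>2 / real i \<le> 2 * L_II n t i"
    unfolding L_II_def w_def .
qed

lemma sum_II_nonneg: "0 \<le> sum_II n r p t"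
  unfolding sum_II_def by (intro sum_nonneg mult_nonneg_nonneg) auto

text \<open>With q = 2(p-1) each term is a^(1-q) b^q, where a and b are the summands of
  \<open>sum_II\<close> and \<open>norm_II\<close>: the powers of \<open>L_II\<close> cancel because
  1 - q = 3 - 2p and q/2 = p - 1. The 6 is the price of restricting to i <= n/e.\<close>

lemma wsum_le_II:
  assumes n: "3 \<le> n" and r: "0 \<le> r" and p: "1 \<le> p" "p < 3/2"
  shows "wsum n r p x \<le> 6 * sum_II n r p t powr (3-2*p) * pow0 (norm_II n r p t x) (2*(p-1))"
proof -
  define q where "q = 2*(p-1)"
  have q: "0 \<le> q" "q < 1" "1 - q = 3 - 2*p" using p by (auto simp: q_def)
  define a where "a i = real i powr (-2*r) * L_II n t i powr (p-1)" for i
  define b where "b i = real i powr (-2*r) * rearr n x i / L_II n t i powr ((3-2*p)/2)" for i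
  have y: "0 \<le> rearr n x i" if "i \<in> idx_e n" for i
    using that idx_e_subset[of n] by (intro rearr_nonneg) auto
  have "real i powr (-2*r) * pow0 (rearr n x i) q = a i powr (1-q) * pow0 (b i) q" if i: "i \<in> idx_e n" for i
  proof -
    have i0: "0 < real i" and L: "0 < L_II n t i" using idx_e_bounds(1)[OF i] L_II_ge(1)[OF i, of t] by auto
    have b: "b i = real i powr (-2*r) * L_II n t i powr (-((3-2*p)/2)) * rearr n x i"
      unfolding b_def divide_powr by (simp only: mult_ac)
    have "pow0 (b i) q = (real i powr (-2*r) * L_II n t i powr (-((3-2*p)/2))) powr q * pow0 (rearr n x i) q"
      unfolding b using i0 L y[OF i] by (subst pow0_mult) (auto simp: pow0_pos)
    then have "a i powr (1-q) * pow0 (b i) q =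
       (real i powr (-2*r*(1-q)) * real i powr (-2*r*q)) *
       (L_II n t i powr ((p-1)*(1-q)) * L_II n t i powr (-((3-2*p)/2)*q)) * pow0 (rearr n x i) q"
      unfolding a_def by (simp add: powr_mult powr_powr mult_ac)
    also have "real i powr (-2*r*(1-q)) * real i powr (-2*r*q) = real i powr (-2*r)"
      by (simp add: algebra_simps flip: powr_add)
    also have "L_II n t i powr ((p-1)*(1-q)) * L_II n t i powr (-((3-2*p)/2)*q) = 1"
    proof -
      have "(p-1)*(1-q) + (-((3-2*p)/2)*q) = 0" by (simp add: q_def field_simps)
      then show ?thesis using L unfolding powr_add[symmetric] by (simp only:) simp
    qed
    finally show ?thesis by simp
  qed
  then have "(\<Sum>i\<in>idx_e n. real i powr (-2*r) * pow0 (rearr n x i) q) = (\<Sum>i\<in>idx_e n. a i powr (1-q) * pow0 (b i) q)"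
    by (intro sum.cong) auto
  also have "\<dots> \<le> sum a (idx_e n) powr (1-q) * pow0 (sum b (idx_e n)) q"
    using q y by (intro Holder_pow0) (auto simp: a_def b_def)
  finally have "(\<Sum>i\<in>idx_e n. real i powr (-2*r) * pow0 (rearr n x i) q) \<le>
      sum_II n r p t powr (3-2*p) * pow0 (norm_II n r p t x) q"
    unfolding sum_II_def norm_II_def a_def b_def q(3) .
  then show ?thesis using wsum_le_sum_idx_e[OF n r p(1), of x] unfolding q_def by linarith
qed

text \<open>Up to n/e the squares are at most 24 \<open>L_II\<close>, and 24 <= 5^2. The identity
  1/2 - (3-2p)/2 = p - 1 then turns the summand of the norm into that of
  \<open>sum_II\<close>.\<close>

lemma norm_II_typical_le:
  assumes tx: "typical n t x"
  shows "norm_II n r p t x \<le> 5 * sum_II n r p t"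
  unfolding norm_II_def sum_II_def sum_distrib_left
proof (rule sum_mono)
  fix i assume i: "i \<in> idx_e n"
  have L: "1 \<le> L_II n t i" using L_II_ge(1)[OF i] .
  have "(rearr n x i)\<^sup>2 \<le> 12 * (ln (exp 1 * real n / real i) + t\<^sup>2 / real i)"
    using i idx_e_subset[of n] by (intro typical_pointwise[OF tx]) auto
  also have "\<dots> \<le> 12 * (2 * L_II n t i)" by (intro mult_left_mono L_II_ge(2)[OF i]) simp
  also have "\<dots> \<le> 25 * L_II n t i" using L by simp
  also have "\<dots> = (5 * L_II n t i powr (1/2))\<^sup>2"
    using L by (simp add: power_mult_distrib powr_half_sqrt)
  finally have "rearr n x i \<le> 5 * L_II n t i powr (1/2)" by (rule power2_le_imp_le) simp
  then have "real i powr (-2*r) * rearr n x i / L_II n t i powr ((3-2*p)/2) \<le>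
     real i powr (-2*r) * (5 * L_II n t i powr (1/2)) / L_II n t i powr ((3-2*p)/2)"
    by (intro divide_right_mono mult_left_mono) auto
  also have "\<dots> = 5 * (real i powr (-2*r) * (L_II n t i powr (1/2) / L_II n t i powr ((3-2*p)/2)))"
    by simp
  also have "L_II n t i powr (1/2) / L_II n t i powr ((3-2*p)/2) = L_II n t i powr (1/2 - (3-2*p)/2)"
    by (rule powr_diff[symmetric])
  also have "1/2 - (3-2*p)/2 = p - 1" by (simp add: field_simps)
  finally show "real i powr (-2*r) * rearr n x i / L_II n t i powr ((3-2*p)/2) \<le>
     5 * (real i powr (-2*r) * L_II n t i powr (p-1))" .
qed

lemma sum_powr_le_both:
  assumes n: "3 \<le> n" and d: "d \<le> 1"
  shows "(\<Sum>i=1..n. real i powr (d-1)) \<le>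
    4 * (1 + (1 + real n powr d) / (1 + \<bar>d\<bar> * ln (real n)) * ln (real n))"
proof -
  have l: "1 \<le> ln (real n)" using n by (rule ln_of_nat_ge_1)
  define g where "g = ln (real n) / (1 + \<bar>d\<bar> * ln (real n))"
  have g: "0 \<le> g" unfolding g_def using l by (intro divide_nonneg_nonneg add_nonneg_nonneg) auto
  have "(\<Sum>i=1..n. real i powr (d-1)) \<le> 4 * (1 + (1 + real n powr d) * g)"
  proof (cases "0 \<le> d")
    case True
    then have "(\<Sum>i=1..n. real i powr (d-1)) \<le> 4 * (real n powr d * g)"
      using sum_powr_le_nonneg_quotient[OF n True d] by (simp add: g_def)
    then show ?thesis using g by (simp add: distrib_right)
  next
    case False
    then have "(\<Sum>i=1..n. real i powr (d-1)) \<le> 1 + 2 * g"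
      using sum_powr_le_nonpos_quotient[OF n, of d] by (simp add: g_def)
    also have "\<dots> \<le> 4 * (1 + (1 + 0) * g)" using g by simp
    also have "\<dots> \<le> 4 * (1 + (1 + real n powr d) * g)"
      using g by (intro mult_left_mono add_left_mono mult_right_mono) auto
    finally show ?thesis .
  qed
  then show ?thesis by (simp add: g_def)
qed

text \<open>The function u^(p-1) is subadditive because p - 1 < 1; this separates ln (n/i) from
  t^2/i.\<close>

lemma sum_II_le:
  assumes n: "3 \<le> n" and r: "0 \<le> r" and p: "1 \<le> p" "p < 3/2" and t: "0 < t"
  shows "sum_II n r p t \<le> (\<Sum>i=1..n. real i powr (-2*r) * ln (exp 1 * real n / real i) powr (p-1))
      + (\<Sum>i=1..n. real i powr ((2-2*r-p) - 1)) * t powr (2*(p-1))"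
proof -
  have "sum_II n r p t \<le> (\<Sum>i\<in>idx_e n. real i powr (-2*r) * ln (exp 1 * real n / real i) powr (p-1)
      + real i powr ((2-2*r-p) - 1) * t powr (2*(p-1)))"
    unfolding sum_II_def
  proof (rule sum_mono)
    fix i assume i: "i \<in> idx_e n"
    note b = idx_e_bounds[OF i]
    have eq: "ln (exp 1 * real n / real i) = 1 + ln (real n / real i)"
      using b(1,2) by (simp add: ln_div ln_mult)
    have "L_II n t i powr (p-1) \<le> ln (real n / real i) powr (p-1) + (t\<^sup>2 / real i) powr (p-1)"
      unfolding L_II_def using b p by (intro powr_add_le) auto
    also have "ln (real n / real i) powr (p-1) \<le> ln (exp 1 * real n / real i) powr (p-1)"
      unfolding eq using b p by (intro powr_mono2) auto
    also have "(t\<^sup>2 / real i) powr (p-1) = t powr (2*(p-1)) * real i powr (-(p-1))"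
      unfolding powr_divide powr_double_pos[OF t] divide_powr ..
    finally have "real i powr (-2*r) * L_II n t i powr (p-1) \<le>
      real i powr (-2*r) * (ln (exp 1 * real n / real i) powr (p-1) + t powr (2*(p-1)) * real i powr (-(p-1)))"
      by (intro mult_left_mono) auto
    also have "\<dots> = real i powr (-2*r) * ln (exp 1 * real n / real i) powr (p-1) +
      (real i powr (-2*r) * real i powr (-(p-1))) * t powr (2*(p-1))"
      by (simp only: distrib_left mult_ac)
    also have "real i powr (-2*r) * real i powr (-(p-1)) = real i powr ((2-2*r-p) - 1)"
      by (simp add: algebra_simps flip: powr_add)
    finally show "real i powr (-2*r) * L_II n t i powr (p-1) \<le>
      real i powr (-2*r) * ln (exp 1 * real n / real i) powr (p-1) + real i powr ((2-2*r-p) - 1) * t powr (2*(p-1))" .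
  qed
  also have "\<dots> \<le> (\<Sum>i=1..n. real i powr (-2*r) * ln (exp 1 * real n / real i) powr (p-1)
      + real i powr ((2-2*r-p) - 1) * t powr (2*(p-1)))"
    using idx_e_subset[of n] by (intro sum_mono2) auto
  also have "\<dots> = (\<Sum>i=1..n. real i powr (-2*r) * ln (exp 1 * real n / real i) powr (p-1))
      + (\<Sum>i=1..n. real i powr ((2-2*r-p) - 1)) * t powr (2*(p-1))"
    by (simp only: sum.distrib sum_distrib_right)
  finally show ?thesis .
qed

text \<open>The constants are 30 times 144 and 30 times 4. For p < 3/2 the factor 8^p p^p is at most
  12^2 = 144 and 2^p is at most 4; \<open>sum_powr_le_both\<close> also has the constant 4. The
  denominator may be lowered from p to 1 since p >= 1.\<close>

lemma sum_II_le_bound_II: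
  assumes n: "3 \<le> n" and r: "0 \<le> r" and p: "1 \<le> p" "p < 3/2" and t: "0 < t"
  shows "30 * sum_II n r p t \<le> bound_II 4320 120 120 n r p t"
proof -
  define a where "a = ln (real n)"
  have a: "1 \<le> a" using n unfolding a_def by (rule ln_of_nat_ge_1)
  define F where "F = 1 + (1 + real n powr (2-2*r-p)) / (1 + \<bar>2-2*r-p\<bar> * a) * a"
  define E where "E = F * t powr (2*(p-1))"
  have "(\<Sum>i=1..n. real i powr ((2-2*r-p) - 1)) * t powr (2*(p-1)) \<le>
    4 * (1 + (1 + real n powr (2-2*r-p)) / (1 + \<bar>2-2*r-p\<bar> * a) * a) * t powr (2*(p-1))"
    unfolding a_def using n r p by (intro mult_right_mono sum_powr_le_both) auto
  then have 2: "(\<Sum>i=1..n. real i powr ((2-2*r-p) - 1)) * t powr (2*(p-1)) \<le> 4 * E"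
    by (simp only: E_def F_def mult.assoc)
  have 1: "30 * (\<Sum>i=1..n. real i powr (-2*r) * ln (exp 1 * real n / real i) powr (p-1)) + 120 * E \<le>
      bound_II 4320 120 120 n r p t"
  proof (cases "r \<le> 1/2")
    case True
    define G where "G = real n powr (1-2*r) * a powr p"
    have pos: "0 < 1 + (1-2*r) * a" using True a by (intro add_pos_nonneg) auto
    have "8 powr p * p powr p * G / (p + (1-2*r) * a) powr p \<le> 144 * G / (1 + (1-2*r) * a) powr p"
    proof (intro frac_le mult_right_mono)
      have "8 powr p * p powr p = (8 * p) powr p" using p by (simp add: powr_mult)
      also have "\<dots> \<le> 12 powr p" using p by (intro powr_mono2) auto
      also have "\<dots> \<le> 12 powr 2" using p by (intro powr_mono) auto
      finally show "8 powr p * p powr p \<le> 144" by (simp add: powr_numeral)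
    qed (use pos p in \<open>auto simp: G_def intro!: powr_mono2\<close>)
    then have "(\<Sum>i=1..n. real i powr (-2*r) * ln (exp 1 * real n / real i) powr (p-1)) \<le>
        144 * (G / (1 + (1-2*r) * a) powr p)"
      using sum_ln_powr_le[OF n r True p(1)] by (simp add: G_def a_def mult.assoc)
    moreover have "bound_II 4320 120 120 n r p t = 4320 * (G / (1 + (1-2*r) * a) powr p) + 120 * E"
      unfolding bound_II_def a_def[symmetric] F_def[symmetric] E_def G_def using True r by simp
    ultimately show ?thesis by simp
  next
    case False
    define G where "G = a powr p / (1 + (2*r-1) * a) + a powr (p-1)"
    have "0 \<le> G" unfolding G_def using a False by (intro add_nonneg_nonneg divide_nonneg_nonneg) auto
    moreover have "2 powr p \<le> (2::real) powr 2" using p by (intro powr_mono) auto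
    ultimately have "2 powr p * G \<le> 4 * G" by (intro mult_right_mono) (auto simp: powr_numeral)
    then have "(\<Sum>i=1..n. real i powr (-2*r) * ln (exp 1 * real n / real i) powr (p-1)) \<le> 4 * G"
      using sum_ln_powr_le_half_less[OF n _ p(1), of r] False by (simp add: G_def a_def)
    moreover have "bound_II 4320 120 120 n r p t = 120 * G + 120 * E"
      unfolding bound_II_def a_def[symmetric] F_def[symmetric] E_def G_def using False by simp
    ultimately show ?thesis by simp
  qed
  show ?thesis using sum_II_le[OF n r p t] 1 2 by linarith
qed

text \<open>The coefficient is i^((3-2p)/2 - 2r) times (i \<open>L_II\<close>)^(-(3-2p)/2). The
  first factor is non-increasing because p >= 3/2 - 2r, the second because i \<open>L_II\<close> = i
  ln (n/i) + t^2 increases up to n/e.\<close>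

lemma is_norm_norm_II:
  assumes n: "3 \<le> n" and p: "p < 3/2" and rp: "3/2 - 2*r \<le> p"
  shows "is_norm n (norm_II n r p t)"
proof -
  define c where "c i = real i powr (-2*r) / L_II n t i powr ((3-2*p)/2)" for i
  have "is_norm n (\<lambda>x. \<Sum>i\<in>idx_e n. c i * rearr n x i)"
  proof (rule is_norm_idx_e[OF n])
    show "0 < c 1" using L_II_ge(1)[OF one_in_idx_e[OF n], of t] by (simp add: c_def)
    fix i j assume ij: "i \<in> idx_e n" "j \<in> idx_e n" "i \<le> j"
    define h where "h i = real i powr ((3-2*p)/2 - 2*r) * (real i * L_II n t i) powr (-((3-2*p)/2))" for i
    have ch: "c k = h k" if k: "k \<in> idx_e n" for k
    proof -
      have k0: "0 < real k" using idx_e_bounds(1)[OF k] by simp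
      have "h k = (real k powr ((3-2*p)/2 - 2*r) * real k powr (-((3-2*p)/2))) * L_II n t k powr (-((3-2*p)/2))"
        unfolding h_def powr_mult by simp
      also have "real k powr ((3-2*p)/2 - 2*r) * real k powr (-((3-2*p)/2)) = real k powr (-2*r)"
        by (simp add: field_simps flip: powr_add)
      finally show ?thesis unfolding c_def divide_powr by (simp only:)
    qed
    have iL: "real k * L_II n t k = real k * ln (real n / real k) + t\<^sup>2" if "k \<in> idx_e n" for k
      using idx_e_bounds(1)[OF that] by (simp add: L_II_def distrib_left)
    have "real i * L_II n t i \<le> real j * L_II n t j"
      using mult_ln_div_mono[OF ij] by (simp add: iL ij)
    moreover have "0 < real i * L_II n t i"
      using idx_e_bounds(1)[OF ij(1)] L_II_ge(1)[OF ij(1), of t] by simp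
    ultimately have "(real j * L_II n t j) powr (-((3-2*p)/2)) \<le> (real i * L_II n t i) powr (-((3-2*p)/2))"
      using p by (intro powr_mono2') auto
    moreover have "real j powr ((3-2*p)/2 - 2*r) \<le> real i powr ((3-2*p)/2 - 2*r)"
      using ij rp idx_e_bounds(1)[OF ij(1)] by (intro powr_mono2') auto
    ultimately have "h j \<le> h i" unfolding h_def by (intro mult_mono) auto
    then show "c j \<le> c i" by (simp add: ch ij)
  qed (simp add: c_def)
  then show ?thesis unfolding norm_II_def c_def by simp
qed

lemma pow0_scaled_le:
  assumes "1 \<le> c" "0 \<le> y" "0 \<le> q" "q \<le> 1"
  shows "pow0 (c * y) q \<le> c * pow0 y q"
proof -
  have "pow0 c q = c powr q" using assms by (simp add: pow0_pos)
  also have "\<dots> \<le> c powr 1" using assms by (intro powr_mono) auto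
  finally have "pow0 c q \<le> c" using assms by simp
  then show ?thesis using assms by (simp add: pow0_mult mult_right_mono pow0_nonneg)
qed

lemma powr_pow0_mult: "0 \<le> y \<Longrightarrow> y powr (1-q) * pow0 y q = y" for y :: real
  by (cases "y = 0") (auto simp: pow0_pos simp flip: powr_add)

text \<open>With s = \<open>sum_II\<close> and q = 2(p-1), inserting N <= 5s into the comparison
  gives 6 s^(1-q) (5s)^q <= 30 s, because 5^q <= 5.\<close>

lemma case_II_concentrates:
  fixes M :: "'a measure"
  assumes n: "3 \<le> n" and r: "0 \<le> r" and p: "1 \<le> p" "p < 3/2" and X: "std_normal_vector M n X"
  shows "concentrates M n r p t X (norm_II n r p t) (5 * sum_II n r p t) (30 * sum_II n r p t) 1"
proof (rule concentrates_if_typical[OF X])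
  have "(\<lambda>\<omega>. \<Sum>i\<in>idx_e n. (real i powr (-2*r) / L_II n t i powr ((3-2*p)/2)) * rearr n (X \<omega>) i) \<in> borel_measurable M"
    by (rule weighted_rearr_measurable[OF X idx_e_subset])
  then show "(\<lambda>\<omega>. norm_II n r p t (X \<omega>)) \<in> borel_measurable M"
    by (simp only: norm_II_def times_divide_eq_left)
  show "norm_II n r p t x \<le> 5 * sum_II n r p t" if "typical n t x" for x
    using that by (rule norm_II_typical_le)
  fix x assume N: "norm_II n r p t x \<le> 5 * sum_II n r p t"
  define s where "s = sum_II n r p t"
  have s: "0 \<le> s" unfolding s_def by (rule sum_II_nonneg)
  have N0: "0 \<le> norm_II n r p t x"
    unfolding norm_II_def using idx_e_subset[of n] rearr_nonneg[of _ n x] by (intro sum_nonneg) auto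
  have "pow0 (norm_II n r p t x) (2*(p-1)) \<le> pow0 (5 * s) (2*(p-1))"
    using N N0 p unfolding s_def by (intro pow0_mono) auto
  also have "\<dots> \<le> 5 * pow0 s (2*(p-1))" using s p by (intro pow0_scaled_le) auto
  finally have "6 * s powr (3-2*p) * pow0 (norm_II n r p t x) (2*(p-1)) \<le>
      6 * s powr (3-2*p) * (5 * pow0 s (2*(p-1)))"
    by (intro mult_left_mono) auto
  also have "\<dots> = 30 * (s powr (1-2*(p-1)) * pow0 s (2*(p-1)))" by (simp add: algebra_simps)
  also have "\<dots> = 30 * s" by (simp only: powr_pow0_mult[OF s])
  finally show "wsum n r p x \<le> 30 * sum_II n r p t"
    using wsum_le_II[OF n r p, of x t] by (simp add: s_def)
qed

subsection \<open>Case III\<close>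

text \<open>Each term is split as (i^(-2r))^(1-q) (i^(-2r) x_[i])^q with q = 2(p-1). As r < 1/4, the
  weights i^(-2r) sum to at most 2 n^(1-2r).\<close>

lemma wsum_le_III:
  assumes n: "3 \<le> n" and r: "0 \<le> r" and p: "1 \<le> p" "p < 3/2 - 2*r"
  shows "wsum n r p x \<le> 2 * real n powr ((1-2*r)*(3-2*p)) * pow0 (norm_III n r x) (2*(p-1))"
proof -
  define q where "q = 2*(p-1)"
  have q: "0 \<le> q" "q < 1" "1 - q = 3 - 2*p" using p r by (auto simp: q_def)
  have r4: "r < 1/4" using p by simp
  have y: "0 \<le> rearr n x i" if "i \<in> {1..n}" for i
    using that by (rule rearr_nonneg)
  have "wsum n r p x = (\<Sum>i=1..n. (real i powr (-2*r)) powr (1-q) * pow0 (real i powr (-2*r) * rearr n x i) q)"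
    unfolding wsum_def q_def[symmetric]
  proof (intro sum.cong refl)
    fix i assume i: "i \<in> {1..n}"
    have "(real i powr (-2*r)) powr (1-q) * pow0 (real i powr (-2*r) * rearr n x i) q =
      ((real i powr (-2*r)) powr (1-q) * pow0 (real i powr (-2*r)) q) * pow0 (rearr n x i) q"
      using y[OF i] by (simp add: pow0_mult)
    then show "real i powr (-2*r) * pow0 (rearr n x i) q =
       (real i powr (-2*r)) powr (1-q) * pow0 (real i powr (-2*r) * rearr n x i) q"
      by (simp only: powr_pow0_mult[OF powr_ge_zero])
  qed
  also have "\<dots> \<le> (\<Sum>i=1..n. real i powr (-2*r)) powr (1-q) * pow0 (norm_III n r x) q"
    unfolding norm_III_def using q y by (intro Holder_pow0) auto
  also have "\<dots> \<le> (2 * real n powr (1-2*r)) powr (1-q) * pow0 (norm_III n r x) q"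
  proof (intro mult_right_mono powr_mono2 pow0_nonneg)
    have "(\<Sum>i=1..n. real i powr (-2*r)) \<le> real n powr (1-2*r) / (1-2*r)"
      using sum_powr_le_pos[of "1-2*r" n] r r4 by simp
    also have "\<dots> \<le> real n powr (1-2*r) / (1/2)" using r4 r by (intro divide_left_mono) auto
    finally show "(\<Sum>i=1..n. real i powr (-2*r)) \<le> 2 * real n powr (1-2*r)" by simp
  qed (use q in \<open>auto intro: sum_nonneg\<close>)
  also have "(2 * real n powr (1-2*r)) powr (1-q) = 2 powr (1-q) * real n powr ((1-2*r)*(3-2*p))"
    by (simp only: powr_mult powr_powr q(3))
  also have "\<dots> \<le> 2 * real n powr ((1-2*r)*(3-2*p))"
    using q powr_mono[of "1-q" 1 2] by (intro mult_right_mono) auto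
  finally show ?thesis by (simp add: q_def mult_right_mono pow0_nonneg)
qed

text \<open>The norm is linear in x_[i], so \<open>\<theta>\<close> = 1/2 and the conjugate norm is
  Euclidean; the squared weights i^(-4r) form a power sum with d = 1 - 4r. The constants are 144 and
  2, each times 5 >= sqrt 24.\<close>

lemma norm_III_typical_le:
  assumes n: "3 \<le> n" and r: "0 \<le> r" "r < 1/4" and t: "0 < t" and tx: "typical n t x"
  shows "norm_III n r x \<le> S_III 720 10 n r t"
proof -
  define a where "a = ln (real n)"
  have l: "1 \<le> a" using n unfolding a_def by (rule ln_of_nat_ge_1)
  define g where "g = a / (1 + (1-4*r) * a)"
  have pos: "0 < 1 + (1-4*r) * a" using l r by (intro add_pos_nonneg) auto
  have g: "0 \<le> g" using l pos by (simp add: g_def)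
  define I1 where "I1 = (\<Sum>i=1..n. real i powr (-2*r) * ln (exp 1 * real n / real i) powr (1/2))"
  define I2 where "I2 = (\<Sum>i=1..n. (real i powr (-2*r)) powr 2) powr (1/2)"
  have "norm_III n r x = (\<Sum>i=1..n. real i powr (-2*r) * rearr n x i powr (2*(1/2)))"
    unfolding norm_III_def using rearr_nonneg[of _ n x] by (intro sum.cong) auto
  also have "\<dots> \<le> 24 powr (1/2) * (I1 + I2 * t powr (2*(1/2)))"
    using typical_weighted_sum_lt_1[OF tx, of "1/2" "\<lambda>i. real i powr (-2*r)"] t
    unfolding I1_def I2_def by simp
  also have "\<dots> \<le> 5 * (I1 + I2 * t powr (2*(1/2)))"
  proof (rule mult_right_mono)
    show "24 powr (1/2) \<le> (5::real)" by (simp add: powr_half_sqrt real_le_lsqrt)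
    show "0 \<le> I1 + I2 * t powr (2*(1/2))" unfolding I1_def I2_def
      by (intro add_nonneg_nonneg mult_nonneg_nonneg sum_nonneg powr_ge_zero)
  qed
  also have "I1 \<le> 144 * real n powr (1-2*r)"
  proof -
    have "I1 \<le> 4 powr (3/2) * (3/2) powr (3/2) * real n powr (1-2*r) / (1-2*r) powr (3/2)"
      using sum_ln_powr_le_div[OF n r(1), of "3/2"] r by (simp add: I1_def)
    also have "\<dots> = (4 * (3/2) / (1-2*r)) powr (3/2) * real n powr (1-2*r)"
      unfolding powr_mult powr_divide by simp
    also have "(4 * (3/2) / (1-2*r)) powr (3/2) \<le> 144"
    proof -
      have "(4 * (3/2) / (1-2*r)) powr (3/2) \<le> 12 powr (3/2)"
        using r by (intro powr_mono2) (auto simp: field_simps)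
      also have "\<dots> \<le> 12 powr 2" by (intro powr_mono) auto
      finally show ?thesis by (simp add: powr_numeral)
    qed
    finally show ?thesis by (simp add: mult_right_mono)
  qed
  also have "I2 \<le> 2 * (real n powr ((1-4*r)/2) * g powr (1/2))"
  proof -
    have "(\<Sum>i=1..n. (real i powr (-2*r)) powr 2) = (\<Sum>i=1..n. real i powr ((1-4*r)-1))"
      by (simp add: powr_powr)
    also have "\<dots> \<le> 4 * (real n powr (1-4*r) * g)"
      unfolding g_def a_def using n r by (intro sum_powr_le_nonneg_quotient) auto
    finally have "I2 \<le> (4 * (real n powr (1-4*r) * g)) powr (1/2)"
      unfolding I2_def by (intro powr_mono2 sum_nonneg) auto
    also have "\<dots> = 4 powr (1/2) * (real n powr ((1-4*r)/2) * g powr (1/2))"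
      unfolding powr_mult powr_powr by simp
    also have "4 powr (1/2) = (2::real)" by (simp add: powr_half_sqrt)
    finally show ?thesis .
  qed
  finally show ?thesis using t by (simp add: S_III_def g_def a_def mult_right_mono algebra_simps)
qed

text \<open>The exponents of n add up as (1-2r)(3-2p) + 2(1-2r)(p-1) = 1 - 2r and (1-2r)(3-2p) +
  (1-4r)(p-1) = 2 - 2r - p.\<close>

lemma R_III_le:
  assumes n: "3 \<le> n" and r: "0 \<le> r" and p: "1 \<le> p" "p < 3/2 - 2*r" and t: "0 < t"
  shows "2 * real n powr ((1-2*r)*(3-2*p)) * S_III 720 10 n r t powr (2*(p-1)) \<le>
    1440 * real n powr (1-2*r) + 20 * real n powr (2-2*r-p)
      * (ln (real n) / (1 + (1-4*r) * ln (real n))) powr (p-1) * t powr (2*(p-1))"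
proof -
  define q where "q = 2*(p-1)"
  have q: "0 \<le> q" "q \<le> 1" using p r by (auto simp: q_def)
  have r4: "r < 1/4" using p by simp
  define a where "a = ln (real n)"
  have l: "1 \<le> a" using n unfolding a_def by (rule ln_of_nat_ge_1)
  define g where "g = a / (1 + (1-4*r) * a)"
  define N where "N = real n powr ((1-2*r)*(3-2*p))"
  have "S_III 720 10 n r t powr q \<le> (720 * real n powr (1-2*r)) powr q +
      (10 * real n powr ((1-4*r)/2) * g powr (1/2) * t) powr q"
    unfolding S_III_def g_def a_def using q t by (intro powr_add_le) auto
  also have "\<dots> = 720 powr q * real n powr ((1-2*r)*q) +
      10 powr q * (real n powr ((1-4*r)/2*q) * g powr (1/2*q) * t powr q)"
    unfolding powr_mult powr_powr by simp
  also have "\<dots> \<le> 720 * real n powr ((1-2*r)*q) +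
      10 * (real n powr ((1-4*r)/2*q) * g powr (1/2*q) * t powr q)"
    using q powr_mono[of q 1 720] powr_mono[of q 1 10] by (intro add_mono mult_right_mono) auto
  finally have "2 * N * S_III 720 10 n r t powr q \<le> 2 * N * (720 * real n powr ((1-2*r)*q) +
      10 * (real n powr ((1-4*r)/2*q) * g powr (1/2*q) * t powr q))"
    by (intro mult_left_mono) (auto simp: N_def)
  also have "\<dots> = 1440 * (N * real n powr ((1-2*r)*q)) +
      20 * (N * real n powr ((1-4*r)/2*q)) * g powr (1/2*q) * t powr q"
    by (simp add: algebra_simps)
  also have "N * real n powr ((1-2*r)*q) = real n powr (1-2*r)"
    unfolding N_def q_def by (simp add: algebra_simps flip: powr_add)
  also have "N * real n powr ((1-4*r)/2*q) = real n powr (2-2*r-p)"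
  proof -
    have "(1-2*r)*(3-2*p) + (1-4*r)/2*q = 2-2*r-p" by (simp add: q_def field_simps)
    then show ?thesis unfolding N_def by (simp only: flip: powr_add)
  qed
  also have "1/2*q = p - 1" by (simp add: q_def)
  finally show ?thesis unfolding N_def q_def g_def a_def .
qed

lemma case_III_concentrates:
  fixes M :: "'a measure"
  assumes n: "3 \<le> n" and r: "0 \<le> r" and p: "1 \<le> p" "p < 3/2 - 2*r" and t: "0 < t"
    and X: "std_normal_vector M n X"
  shows "concentrates M n r p t X (norm_III n r) (S_III 720 10 n r t)
    (2 * real n powr ((1-2*r)*(3-2*p)) * S_III 720 10 n r t powr (2*(p-1))) 1"
proof (rule concentrates_if_typical[OF X])
  show "(\<lambda>\<omega>. norm_III n r (X \<omega>)) \<in> borel_measurable M"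
    unfolding norm_III_def by (rule weighted_rearr_measurable[OF X]) simp
  show "norm_III n r x \<le> S_III 720 10 n r t" if "typical n t x" for x
    using norm_III_typical_le[OF n r _ t that] p by simp
  fix x assume N: "norm_III n r x \<le> S_III 720 10 n r t"
  \<comment> \<open>Positivity makes \<open>pow0\<close> and \<open>powr\<close> agree at this value
    also when p = 1.\<close>
  have S: "0 < S_III 720 10 n r t"
    unfolding S_III_def using n t by (intro add_pos_nonneg mult_nonneg_nonneg mult_pos_pos) auto
  have "0 \<le> norm_III n r x"
    unfolding norm_III_def using rearr_nonneg[of _ n x] by (intro sum_nonneg) auto
  then have "pow0 (norm_III n r x) (2*(p-1)) \<le> S_III 720 10 n r t powr (2*(p-1))"
    unfolding pow0_pos[OF S, symmetric] using N p by (intro pow0_mono) auto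
  then have "2 * real n powr ((1-2*r)*(3-2*p)) * pow0 (norm_III n r x) (2*(p-1)) \<le>
      2 * real n powr ((1-2*r)*(3-2*p)) * S_III 720 10 n r t powr (2*(p-1))"
    by (intro mult_left_mono) auto
  then show "wsum n r p x \<le> 2 * real n powr ((1-2*r)*(3-2*p)) * S_III 720 10 n r t powr (2*(p-1))"
    using wsum_le_III[OF n r p, of x] by linarith
qed

subsection \<open>Case IV\<close>

lemma fraction_cancel:
  fixes d x :: real
  assumes "d \<noteq> 0"
  shows "x / d * (2 * d) = 2 * x" "x / (2 * d) * (2 * d) = x" "d * (x / (2 * d)) = x / 2"
    "1 / 2 * (2 * d) = d"
  using assms by simp_all

section \<open>Case IVa: the line p = 2(1-r) with p > 1\<close>

context
  fixes n :: nat and r p :: real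
  assumes n: "3 \<le> n" and p: "1 < p" "p < 3/2" and rp: "p = 2*(1-r)"
begin

private definition "D = (p-1) powr p * ln (real n) / real n powr (p-1)"

private definition "e = -(3-2*p) / (2*(p-1))"

private lemma r_eqs: "1 - 2*r = p - 1" "-2*r = p - 2" "-r/(p-1) = -(2-p)/(2*(p-1))"
proof -
  have r: "r = (2 - p) / 2" using rp by simp
  show "1 - 2*r = p - 1" "-2*r = p - 2" using rp by simp_all
  show "-r/(p-1) = -(2-p)/(2*(p-1))" unfolding r by (simp add: divide_simps)
qed

private lemma p_minus_1: "p - 1 \<noteq> 0"
  using p by simp

private lemma p_minus_1_e: "(p-1) * e = -(3-2*p) / 2"
  unfolding e_def by (rule fraction_cancel(3)[OF p_minus_1])

private lemma ln_n: "1 \<le> ln (real n)"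
  using n by (rule ln_of_nat_ge_1)

private lemma D_pos: "0 < D"
  using p ln_n n unfolding D_def by (intro divide_pos_pos mult_pos_pos) auto

private lemma beta_IV_eq:
  "beta_IV n r p i = D * (real i powr (p-2) * ln (real n / real i) powr (p-1)) + 1 / real i"
  unfolding beta_IV_def r_eqs D_def by (simp only: mult.assoc)

text \<open>After multiplication by i, the index enters only through i ln (n/i), which is
  non-decreasing up to n/e.\<close>

private lemma i_beta_IV:
  assumes "i \<in> idx_e n"
  shows "real i * beta_IV n r p i = D * (real i * ln (real n / real i)) powr (p-1) + 1"
proof -
  have i: "0 < real i" using idx_e_bounds(1)[OF assms] by simp
  have "real i * real i powr (p-2) = real i powr (p-1)"
    using i powr_add[of "real i" 1 "p-2"] by simp
  moreover have "real i * beta_IV n r p i =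
      D * ((real i * real i powr (p-2)) * ln (real n / real i) powr (p-1)) + 1"
    unfolding beta_IV_eq using i by (simp add: distrib_left mult_ac)
  ultimately show ?thesis by (simp only: powr_mult)
qed

private lemma beta_IV_pos: "i \<in> idx_e n \<Longrightarrow> 0 < beta_IV n r p i"
  unfolding beta_IV_eq using D_pos idx_e_bounds[of i n] by (intro add_nonneg_pos mult_nonneg_nonneg) auto

text \<open>In this form the monotonicity of the coefficient is visible: both inner factors are
  non-decreasing in i, and the outer exponent is negative.\<close>

private lemma coef_IV_eq:
  assumes "i \<in> idx_e n"
  shows "coef_IV n r p i = ((real i * beta_IV n r p i) powr (3-2*p) * real i powr (p-1)) powr (-1/(2*(p-1)))"
proof -
  have i: "0 < real i" using idx_e_bounds(1)[OF assms] by simp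
  have "((real i * beta_IV n r p i) powr (3-2*p) * real i powr (p-1)) =
     beta_IV n r p i powr (3-2*p) * (real i powr (3-2*p) * real i powr (p-1))"
    by (simp only: powr_mult mult_ac)
  also have "real i powr (3-2*p) * real i powr (p-1) = real i powr (2-p)"
    by (simp flip: powr_add)
  moreover have "a * (-1/b) = -a/b" for a b :: real by simp
  ultimately show ?thesis
    unfolding coef_IV_def r_eqs by (simp only: powr_mult powr_powr)
qed

lemma coef_IV_antimono:
  assumes i: "i \<in> idx_e n" and j: "j \<in> idx_e n" and ij: "i \<le> j"
  shows "coef_IV n r p j \<le> coef_IV n r p i"
proof -
  have i0: "1 \<le> real i" using idx_e_bounds(1)[OF i] by simp
  have l: "1 \<le> ln (real n / real i)" by (rule idx_e_bounds(3)[OF i])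
  have "real i * ln (real n / real i) \<le> real j * ln (real n / real j)"
    by (rule mult_ln_div_mono[OF i j ij])
  then have b: "real i * beta_IV n r p i \<le> real j * beta_IV n r p j"
    unfolding i_beta_IV[OF i] i_beta_IV[OF j] using i0 l p D_pos
    by (intro add_right_mono mult_left_mono powr_mono2) auto
  have b0: "0 < real i * beta_IV n r p i" using i0 beta_IV_pos[OF i] by simp
  show ?thesis unfolding coef_IV_eq[OF i] coef_IV_eq[OF j]
  proof (rule powr_mono2')
    show "(real i * beta_IV n r p i) powr (3-2*p) * real i powr (p-1) \<le>
        (real j * beta_IV n r p j) powr (3-2*p) * real j powr (p-1)"
    proof (rule mult_mono)
      show "(real i * beta_IV n r p i) powr (3-2*p) \<le> (real j * beta_IV n r p j) powr (3-2*p)"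
        using b b0 p by (intro powr_mono2) linarith+
      show "real i powr (p-1) \<le> real j powr (p-1)" using ij p by (intro powr_mono2) auto
    qed auto
    show "0 < (real i * beta_IV n r p i) powr (3-2*p) * real i powr (p-1)"
      using b0 i0 by (intro mult_pos_pos) (auto simp del: mult_pos_pos)
  qed (use p in auto)
qed

lemma coef_IV_pos: "i \<in> idx_e n \<Longrightarrow> 0 < coef_IV n r p i"
  unfolding coef_IV_def using beta_IV_pos[of i] idx_e_bounds(1)[of i n] by (intro mult_pos_pos) auto

lemma is_norm_norm_IVa: "is_norm n (norm_IVa n r p)"
proof -
  have "is_norm n (\<lambda>x. \<Sum>i\<in>idx_e n. coef_IV n r p i * rearr n x i)"
    using coef_IV_pos one_in_idx_e[OF n] coef_IV_antimono
    by (intro is_norm_idx_e[OF n]) (auto intro: less_imp_le)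
  then show ?thesis unfolding norm_IVa_def .
qed

private lemma sum_ln_idx_e_le:
  "(\<Sum>i\<in>idx_e n. real i powr (p-2) * ln (real n / real i) powr (p-1)) \<le>
    36 * real n powr (p-1) / (p-1) powr p"
proof -
  have "(\<Sum>i\<in>idx_e n. real i powr (p-2) * ln (real n / real i) powr (p-1)) \<le>
     (\<Sum>i\<in>idx_e n. real i powr (p-2) * ln (exp 1 * real n / real i) powr (p-1))"
  proof (intro sum_mono mult_left_mono powr_mono2)
    fix i assume i: "i \<in> idx_e n"
    note b = idx_e_bounds[OF i]
    show "0 \<le> ln (real n / real i)" using b(3) by linarith
    have "ln (exp 1 * real n / real i) = 1 + ln (real n / real i)"
      using b(1,2) by (simp add: ln_div ln_mult)
    then show "ln (real n / real i) \<le> ln (exp 1 * real n / real i)" by simp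
  qed (use p in auto)
  also have "\<dots> \<le> (\<Sum>i=1..n. real i powr (p-2) * ln (exp 1 * real n / real i) powr (p-1))"
    using idx_e_subset[of n] by (intro sum_mono2) auto
  also have "\<dots> \<le> 4 powr p * p powr p * real n powr (p-1) / (p-1) powr p"
    using sum_ln_powr_le_div[OF n, of r p] p rp unfolding r_eqs by auto
  also have "4 powr p * p powr p = (4 * p) powr p" by (simp only: powr_mult)
  also have "(4 * p) powr p * real n powr (p-1) / (p-1) powr p \<le> 36 * real n powr (p-1) / (p-1) powr p"
  proof (intro divide_right_mono mult_right_mono)
    have "(4 * p) powr p \<le> 6 powr p" using p by (intro powr_mono2) auto
    also have "\<dots> \<le> 6 powr 2" using p by (intro powr_mono) auto
    finally show "(4 * p) powr p \<le> 36" by (simp add: powr_numeral)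
  qed auto
  finally show ?thesis .
qed

text \<open>The powers of p - 1 and n in \<open>D\<close> cancel those of
  \<open>sum_ln_idx_e_le\<close>, leaving 36 ln n; the harmonic part adds at most 2 ln n.\<close>

private lemma sum_beta_IV_le: "(\<Sum>i\<in>idx_e n. beta_IV n r p i) \<le> 38 * ln (real n)"
proof -
  have "(\<Sum>i\<in>idx_e n. beta_IV n r p i) =
     D * (\<Sum>i\<in>idx_e n. real i powr (p-2) * ln (real n / real i) powr (p-1)) + (\<Sum>i\<in>idx_e n. 1 / real i)"
    unfolding beta_IV_eq sum.distrib sum_distrib_left ..
  also have "\<dots> \<le> D * (36 * real n powr (p-1) / (p-1) powr p) + 2 * ln (real n)"
  proof (rule add_mono)
    show "D * (\<Sum>i\<in>idx_e n. real i powr (p-2) * ln (real n / real i) powr (p-1)) \<le>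
       D * (36 * real n powr (p-1) / (p-1) powr p)"
      using D_pos by (intro mult_left_mono sum_ln_idx_e_le) auto
    have "(\<Sum>i\<in>idx_e n. 1 / real i) \<le> (\<Sum>i=1..n. 1 / real i)"
      using idx_e_subset[of n] by (intro sum_mono2) auto
    also have "\<dots> \<le> 1 + ln (real n)" using n by (intro sum_inverse_le) auto
    finally show "(\<Sum>i\<in>idx_e n. 1 / real i) \<le> 2 * ln (real n)" using ln_n by linarith
  qed
  also have "D * (36 * real n powr (p-1) / (p-1) powr p) = 36 * ln (real n)"
    using p n by (simp add: D_def)
  finally show ?thesis by simp
qed

text \<open>The coefficient is made so that, with q = 2(p-1), i^(-2r) x_[i]^q is the product of
  \<open>beta_IV\<close> to the power 1 - q and of (\<open>coef_IV\<close> times x_[i]) to the power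
  q. Hoelder's inequality then leaves the sum of \<open>beta_IV\<close> to the power 3 - 2p; 228 is
  6 times 38.\<close>

lemma wsum_le_IVa:
  "wsum n r p x \<le> 228 * ln (real n) powr (3-2*p) * pow0 (norm_IVa n r p x) (2*(p-1))"
proof -
  define q where "q = 2*(p-1)"
  have q: "0 < q" "q < 1" "1 - q = 3 - 2*p" using p by (auto simp: q_def)
  have y: "0 \<le> rearr n x i" if "i \<in> idx_e n" for i
    using that idx_e_subset[of n] by (intro rearr_nonneg) auto
  have "real i powr (-2*r) * pow0 (rearr n x i) q =
      beta_IV n r p i powr (1-q) * (coef_IV n r p i * rearr n x i) powr q" if i: "i \<in> idx_e n" for i
  proof -
    have b: "0 < beta_IV n r p i" by (rule beta_IV_pos[OF i])
    have "coef_IV n r p i powr q = beta_IV n r p i powr (-(1-q)) * real i powr (-2*r)"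
      unfolding coef_IV_def powr_mult powr_powr q(3) unfolding q_def fraction_cancel[OF p_minus_1] by simp
    then have "beta_IV n r p i powr (1-q) * (coef_IV n r p i * rearr n x i) powr q =
      (beta_IV n r p i powr (1-q) * beta_IV n r p i powr (-(1-q))) * (real i powr (-2*r) * rearr n x i powr q)"
      by (simp only: powr_mult mult_ac)
    also have "beta_IV n r p i powr (1-q) * beta_IV n r p i powr (-(1-q)) = 1"
      using b by (simp flip: powr_add)
    finally show ?thesis using q(1) by (simp add: pow0_def)
  qed
  then have "(\<Sum>i\<in>idx_e n. real i powr (-2*r) * pow0 (rearr n x i) q) =
      (\<Sum>i\<in>idx_e n. beta_IV n r p i powr (1-q) * (coef_IV n r p i * rearr n x i) powr q)"
    by (intro sum.cong) auto
  also have "\<dots> \<le> (\<Sum>i\<in>idx_e n. beta_IV n r p i) powr (1-q) * norm_IVa n r p x powr q"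
    unfolding norm_IVa_def using q y beta_IV_pos coef_IV_pos
    by (intro Holder_sum mult_nonneg_nonneg) (auto intro: less_imp_le)
  also have "\<dots> \<le> (38 * ln (real n)) powr (1-q) * norm_IVa n r p x powr q"
    using q beta_IV_pos sum_beta_IV_le
    by (intro mult_right_mono powr_mono2 sum_nonneg) (auto intro: less_imp_le)
  also have "(38 * ln (real n)) powr (1-q) \<le> 38 * ln (real n) powr (1-q)"
    unfolding powr_mult using q powr_mono[of "1-q" 1 38] by (intro mult_right_mono) auto
  finally have "(\<Sum>i\<in>idx_e n. real i powr (-2*r) * pow0 (rearr n x i) q) \<le>
      38 * ln (real n) powr (1-q) * pow0 (norm_IVa n r p x) q"
    using q(1) by (simp add: pow0_def mult_right_mono)
  then show ?thesis
    using wsum_le_sum_idx_e[OF n, of r p x] p rp unfolding q(3) by (simp add: q_def)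
qed

text \<open>Only the part 1/i of \<open>beta_IV\<close> is kept. The squared coefficients then sum
  to at most a harmonic sum, which produces (ln n)^(1/2) in front of t.\<close>

private lemma coef_IV_le_sqrt:
  assumes "i \<in> idx_e n"
  shows "coef_IV n r p i \<le> real i powr (-1/2)"
proof -
  have i: "1 \<le> real i" using idx_e_bounds(1)[OF assms] by simp
  have "1 \<le> real i * beta_IV n r p i"
    unfolding i_beta_IV[OF assms] using D_pos by simp
  then have "1 powr (3-2*p) \<le> (real i * beta_IV n r p i) powr (3-2*p)"
    using p by (intro powr_mono2) auto
  then have "1 * real i powr (p-1) \<le> (real i * beta_IV n r p i) powr (3-2*p) * real i powr (p-1)"
    by (intro mult_right_mono) auto
  then have "coef_IV n r p i \<le> (real i powr (p-1)) powr (-1/(2*(p-1)))"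
    unfolding coef_IV_eq[OF assms] using i p by (intro powr_mono2') auto
  also have "\<dots> = real i powr (-1/2)"
    unfolding powr_powr fraction_cancel[OF p_minus_1] ..
  finally show ?thesis .
qed

text \<open>Only the logarithmic part of \<open>beta_IV\<close> is kept, under the negative exponent
  \<open>e\<close>. The exponents of i and ln (n/i) collapse to p - 2 and p - 1, the summand of
  \<open>sum_ln_idx_e_le\<close>; this yields the term of \<open>S_IVa\<close> without t.\<close>

private lemma coef_IV_le_ln:
  assumes "i \<in> idx_e n"
  shows "coef_IV n r p i * ln (real n / real i) powr (1/2) \<le>
    D powr e * (real i powr (p-2) * ln (real n / real i) powr (p-1))"
proof -
  have i: "0 < real i" using idx_e_bounds(1)[OF assms] by simp
  define l where "l = ln (real n / real i)"
  have l: "1 \<le> l" unfolding l_def by (rule idx_e_bounds(3)[OF assms])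
  have e: "e \<le> 0" unfolding e_def using p by (intro divide_nonpos_pos) auto
  have "beta_IV n r p i powr e \<le> (D * (real i powr (p-2) * l powr (p-1))) powr e"
    using e D_pos i l by (intro powr_mono2') (auto simp: beta_IV_eq l_def)
  also have "\<dots> = D powr e * (real i powr ((p-2)*e) * l powr ((p-1)*e))"
    by (simp only: powr_mult powr_powr)
  finally have "coef_IV n r p i * l powr (1/2) \<le>
      (D powr e * (real i powr ((p-2)*e) * l powr ((p-1)*e))) * real i powr (-(2-p)/(2*(p-1))) * l powr (1/2)"
    unfolding coef_IV_def r_eqs e_def[symmetric] by (intro mult_right_mono) auto
  also have "\<dots> = D powr e * (real i powr ((p-2)*e + -(2-p)/(2*(p-1))) * l powr ((p-1)*e + 1/2))"
    by (simp only: powr_add mult_ac)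
  also have "(p-2)*e + -(2-p)/(2*(p-1)) = p - 2"
    using p by (simp add: e_def divide_simps) (simp add: algebra_simps)
  also have "(p-1)*e + 1/2 = p - 1"
    unfolding p_minus_1_e by (simp add: field_simps)
  finally show ?thesis unfolding l_def .
qed

private lemma D_powr:
  "D powr e * (real n powr (p-1) / (p-1) powr p) =
    (1-2*r) powr (-p/(2*(p-1))) * ln (real n) powr (-(3-2*p)/(2*(p-1))) * real n powr (1/2)"
proof -
  have "D powr e * (real n powr (p-1) / (p-1) powr p) =
    (p-1) powr (p*e + -p) * ln (real n) powr e * real n powr (-(p-1)*e + (p-1))"
    unfolding D_def powr_mult powr_powr divide_powr powr_add by (simp only: mult_ac)
  also have "p*e + -p = -p/(2*(p-1))"
    using p by (simp add: e_def divide_simps) (simp add: algebra_simps)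
  also have "-(p-1)*e + (p-1) = 1/2"
    unfolding mult_minus_left p_minus_1_e by (simp add: field_simps)
  finally show ?thesis unfolding r_eqs e_def .
qed

text \<open>Again \<open>\<theta>\<close> = 1/2. The logarithmic bound on the coefficients controls
  the part without t and the bound by i^(-1/2) the Euclidean norm of the weights; 360 is 5 times 72
  and 10 is 5 times 2.\<close>

lemma norm_IVa_typical_le:
  assumes t: "0 < t" and tx: "typical n t x"
  shows "norm_IVa n r p x \<le> S_IVa 360 10 n r p t"
proof -
  define c where "c i = (if i \<in> idx_e n then coef_IV n r p i else 0)" for i
  have c0: "0 \<le> c i" for i using coef_IV_pos[of i] by (auto simp: c_def)
  define T1 where "T1 = (1-2*r) powr (-p/(2*(p-1))) * ln (real n) powr (-(3-2*p)/(2*(p-1))) * real n powr (1/2)"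
  define I1 where "I1 = (\<Sum>i=1..n. c i * ln (exp 1 * real n / real i) powr (1/2))"
  define I2 where "I2 = (\<Sum>i=1..n. c i powr 2) powr (1/2)"
  have "norm_IVa n r p x = (\<Sum>i=1..n. c i * rearr n x i powr (2*(1/2)))"
    unfolding norm_IVa_def using idx_e_subset[of n] rearr_nonneg[of _ n x]
    by (intro sum.mono_neutral_cong_left) (auto simp: c_def)
  also have "\<dots> \<le> 24 powr (1/2) * (I1 + I2 * t powr (2*(1/2)))"
    using typical_weighted_sum_lt_1[OF tx, of "1/2" c] t c0 unfolding I1_def I2_def by simp
  also have "\<dots> \<le> 5 * (I1 + I2 * t powr (2*(1/2)))"
  proof (rule mult_right_mono)
    show "24 powr (1/2) \<le> (5::real)" by (simp add: powr_half_sqrt real_le_lsqrt)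
    show "0 \<le> I1 + I2 * t powr (2*(1/2))" unfolding I1_def I2_def
      by (intro add_nonneg_nonneg mult_nonneg_nonneg sum_nonneg powr_ge_zero c0)
  qed
  also have "t powr (2*(1/2)) = t" using t by simp
  also have "I1 \<le> 72 * T1"
  proof -
    have "I1 = (\<Sum>i\<in>idx_e n. coef_IV n r p i * ln (exp 1 * real n / real i) powr (1/2))"
      unfolding I1_def using idx_e_subset[of n] by (intro sum.mono_neutral_cong_right) (auto simp: c_def)
    also have "\<dots> \<le> (\<Sum>i\<in>idx_e n. 2 * (D powr e * (real i powr (p-2) * ln (real n / real i) powr (p-1))))"
    proof (rule sum_mono)
      fix i assume i: "i \<in> idx_e n"
      note b = idx_e_bounds[OF i]
      have "ln (exp 1 * real n / real i) = 1 + ln (real n / real i)"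
        using b(1,2) by (simp add: ln_div ln_mult)
      then have "ln (exp 1 * real n / real i) powr (1/2) \<le> (4 * ln (real n / real i)) powr (1/2)"
        using b(3) by (intro powr_mono2) linarith+
      also have "\<dots> = 2 * ln (real n / real i) powr (1/2)"
        unfolding powr_mult by (simp add: powr_half_sqrt)
      finally have "coef_IV n r p i * ln (exp 1 * real n / real i) powr (1/2) \<le>
          coef_IV n r p i * (2 * ln (real n / real i) powr (1/2))"
        using coef_IV_pos[OF i] by (intro mult_left_mono) auto
      then show "coef_IV n r p i * ln (exp 1 * real n / real i) powr (1/2) \<le>
          2 * (D powr e * (real i powr (p-2) * ln (real n / real i) powr (p-1)))"
        using coef_IV_le_ln[OF i] by linarith
    qed
    also have "\<dots> = 2 * D powr e * (\<Sum>i\<in>idx_e n. real i powr (p-2) * ln (real n / real i) powr (p-1))"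
      unfolding sum_distrib_left mult.assoc ..
    also have "\<dots> \<le> 2 * D powr e * (36 * real n powr (p-1) / (p-1) powr p)"
      by (intro mult_left_mono sum_ln_idx_e_le) auto
    also have "\<dots> = 72 * (D powr e * (real n powr (p-1) / (p-1) powr p))" by simp
    finally show ?thesis unfolding D_powr T1_def .
  qed
  also have "I2 \<le> 2 * ln (real n) powr (1/2)"
  proof -
    have "(\<Sum>i=1..n. c i powr 2) \<le> (\<Sum>i=1..n. 1 / real i)"
    proof (rule sum_mono)
      fix i assume "i \<in> {1..n}"
      then have i: "0 < real i" by simp
      have "c i \<le> real i powr (-1/2)" using coef_IV_le_sqrt[of i] by (simp add: c_def)
      then have "c i powr 2 \<le> (real i powr (-1/2)) powr 2" by (intro powr_mono2 c0) auto
      also have "\<dots> = real i powr (-1)" by (simp only: powr_powr) simp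
      also have "\<dots> = 1 / real i" using i by (simp add: powr_minus_divide)
      finally show "c i powr 2 \<le> 1 / real i" .
    qed
    also have "\<dots> \<le> 4 * ln (real n)" using n ln_n sum_inverse_le[of n] by simp
    finally have "I2 \<le> (4 * ln (real n)) powr (1/2)"
      unfolding I2_def by (intro powr_mono2 sum_nonneg) auto
    also have "\<dots> = 2 * ln (real n) powr (1/2)"
      unfolding powr_mult by (simp add: powr_half_sqrt)
    finally show ?thesis .
  qed
  finally have "norm_IVa n r p x \<le> 360 * T1 + 10 * (ln (real n) powr (1/2) * t)"
    using t by (simp add: mult_right_mono)
  \<comment> \<open>\<open>S_IVa\<close> carries its constants to the power 1/(p-1), which is at
    least 1 here, so they only grow.\<close>
  also have "\<dots> \<le> 360 powr (1/(p-1)) * T1 + 10 powr (1/(p-1)) * (ln (real n) powr (1/2) * t)"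
  proof (intro add_mono mult_right_mono)
    have "1 \<le> 1/(p-1)" using p by simp
    then show "360 \<le> (360::real) powr (1/(p-1))" "10 \<le> (10::real) powr (1/(p-1))"
      using powr_mono[of 1 "1/(p-1)" "360::real"] powr_mono[of 1 "1/(p-1)" "10::real"] by auto
  qed (use t in \<open>auto simp: T1_def\<close>)
  finally show ?thesis by (simp add: S_IVa_def T1_def mult.assoc)
qed

text \<open>The power 2(p-1) turns constants raised to 1/(p-1) into squares: 88646400 is 228 times
  360^2 times 3, and 22800 is 228 times 10^2.\<close>

lemma R_IVa_le:
  assumes t: "0 < t"
  shows "228 * ln (real n) powr (3-2*p) * S_IVa 360 10 n r p t powr (2*(p-1)) \<le>
    88646400 * (1-2*r) powr (-1) * real n powr (1-2*r) + 22800 * ln (real n) powr (2-p) * t powr (2*(p-1))"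
proof -
  define q where "q = 2*(p-1)"
  have q: "0 \<le> q" "q \<le> 1" using p by (auto simp: q_def)
  define l where "l = ln (real n)"
  have l: "1 \<le> l" unfolding l_def by (rule ln_n)
  have "S_IVa 360 10 n r p t powr q \<le>
    (360 powr (1/(p-1)) * (p-1) powr (-p/(2*(p-1))) * l powr (-(3-2*p)/(2*(p-1))) * real n powr (1/2)) powr q
     + (10 powr (1/(p-1)) * l powr (1/2) * t) powr q"
    unfolding S_IVa_def r_eqs l_def using q t by (intro powr_add_le) auto
  also have "(360 powr (1/(p-1)) * (p-1) powr (-p/(2*(p-1))) * l powr (-(3-2*p)/(2*(p-1))) * real n powr (1/2)) powr q
     = 360 powr 2 * (p-1) powr (-p) * l powr (-(3-2*p)) * real n powr (p-1)"
    unfolding powr_mult powr_powr q_def fraction_cancel[OF p_minus_1] by simp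
  also have "(10 powr (1/(p-1)) * l powr (1/2) * t) powr q = 10 powr 2 * l powr (p-1) * t powr q"
    unfolding powr_mult powr_powr q_def fraction_cancel[OF p_minus_1] by simp
  \<comment> \<open>With d = p - 1 the left side is d^(-d) d^(-1), and d^(-d) <= e because d ln
    (1/d) <= 1; this gives the factor 3.\<close>
  also have "(p-1) powr (-p) \<le> 3 * (p-1) powr (-1)"
  proof -
    define d where "d = p - 1"
    have d: "0 < d" using p by (simp add: d_def)
    have "ln (1/d) \<le> 1/d - 1" using d by (intro ln_le_minus_one) auto
    then have "d * ln (1/d) \<le> d * (1/d - 1)" using d by (intro mult_left_mono) auto
    also have "\<dots> \<le> 1" using d by (simp add: right_diff_distrib)
    finally have "-d * ln d \<le> 1" using d by (simp add: ln_div)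
    then have "d powr (-d) \<le> exp 1" using d by (simp add: powr_def)
    also have "\<dots> \<le> 3" by (rule exp_le)
    finally have "d powr (-d) * d powr (-1) \<le> 3 * d powr (-1)" by (intro mult_right_mono) auto
    moreover have "d powr (-d) * d powr (-1) = d powr (-p)"
      unfolding powr_add[symmetric] by (simp add: d_def)
    ultimately show ?thesis by (simp add: d_def)
  qed
  finally have "228 * l powr (3-2*p) * S_IVa 360 10 n r p t powr q \<le> 228 * l powr (3-2*p) *
     (360 powr 2 * (3 * (p-1) powr (-1)) * l powr (-(3-2*p)) * real n powr (p-1) + 10 powr 2 * l powr (p-1) * t powr q)"
    by (intro mult_left_mono) (auto simp: mult_right_mono)
  also have "\<dots> = 88646400 * (p-1) powr (-1) * real n powr (p-1) * (l powr (3-2*p) * l powr (-(3-2*p)))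
     + 22800 * (l powr (3-2*p) * l powr (p-1)) * t powr q"
    by (simp add: powr_numeral distrib_left mult_ac)
  also have "l powr (3-2*p) * l powr (-(3-2*p)) = 1" using l by (simp flip: powr_add)
  also have "l powr (3-2*p) * l powr (p-1) = l powr (2-p)" by (simp flip: powr_add)
  finally show ?thesis unfolding r_eqs q_def l_def by simp
qed

lemma case_IVa_concentrates:
  fixes M :: "'a measure"
  assumes t: "0 < t" and X: "std_normal_vector M n X"
  shows "concentrates M n r p t X (norm_IVa n r p) (S_IVa 360 10 n r p t)
    (228 * ln (real n) powr (3-2*p) * S_IVa 360 10 n r p t powr (2*(p-1))) 1"
proof (rule concentrates_if_typical[OF X])
  show "(\<lambda>\<omega>. norm_IVa n r p (X \<omega>)) \<in> borel_measurable M"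
    unfolding norm_IVa_def by (rule weighted_rearr_measurable[OF X idx_e_subset])
  show "norm_IVa n r p x \<le> S_IVa 360 10 n r p t" if "typical n t x" for x
    using norm_IVa_typical_le[OF t that] .
  fix x assume N: "norm_IVa n r p x \<le> S_IVa 360 10 n r p t"
  have "0 \<le> norm_IVa n r p x"
    unfolding norm_IVa_def using idx_e_subset[of n] rearr_nonneg[of _ n x] coef_IV_pos
    by (intro sum_nonneg mult_nonneg_nonneg) (auto intro: less_imp_le)
  then have "pow0 (norm_IVa n r p x) (2*(p-1)) \<le> S_IVa 360 10 n r p t powr (2*(p-1))"
    using N p by (auto simp: pow0_def intro: powr_mono2)
  then have "228 * ln (real n) powr (3-2*p) * pow0 (norm_IVa n r p x) (2*(p-1)) \<le>
      228 * ln (real n) powr (3-2*p) * S_IVa 360 10 n r p t powr (2*(p-1))"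
    by (intro mult_left_mono) auto
  then show "wsum n r p x \<le> 228 * ln (real n) powr (3-2*p) * S_IVa 360 10 n r p t powr (2*(p-1))"
    using wsum_le_IVa[of x] by linarith
qed

end

section \<open>Case IVb: the Euclidean norm\<close>

text \<open>With \<open>\<theta>\<close> = p - 1 the weight i^(-2r) is (1/i)^(1-\<theta>), so
  Hoelder's inequality interpolates between the harmonic sum and the sum of all squares, which
  sorting does not change.\<close>

lemma wsum_le_IVb:
  assumes n: "3 \<le> n" and r: "1/4 < r" "r \<le> 1/2" and rp: "p = 2*(1-r)"
  shows "wsum n r p x \<le> 2 * ln (real n) * pow0 (norm_IVb n x) (2*(p-1))"
proof -
  have l: "1 \<le> ln (real n)" using n by (rule ln_of_nat_ge_1)
  define \<theta> where "\<theta> = p - 1"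
  have \<theta>: "0 \<le> \<theta>" "\<theta> < 1" "1 - \<theta> = 2*r" "2 * r \<le> 1" using r rp by (auto simp: \<theta>_def)
  have "wsum n r p x = (\<Sum>i=1..n. (1 / real i) powr (1-\<theta>) * pow0 ((rearr n x i)\<^sup>2) \<theta>)"
    unfolding wsum_def \<theta>_def[symmetric] \<theta>(3)
  proof (intro sum.cong refl)
    fix i assume i: "i \<in> {1..n}"
    have "(1 / real i) powr (2*r) = real i powr (-2*r)"
      using i by (simp add: powr_divide powr_minus_divide)
    then show "real i powr (-2*r) * pow0 (rearr n x i) (2*\<theta>) = (1 / real i) powr (2*r) * pow0 ((rearr n x i)\<^sup>2) \<theta>"
      using rearr_nonneg[OF i, of x] by (simp add: pow0_double)
  qed
  also have "\<dots> \<le> (\<Sum>i=1..n. 1 / real i) powr (1-\<theta>) * pow0 (\<Sum>i=1..n. (rearr n x i)\<^sup>2) \<theta>"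
    using \<theta> by (intro Holder_pow0) auto
  also have "(\<Sum>i=1..n. (rearr n x i)\<^sup>2) = (norm_IVb n x)\<^sup>2"
    using sum_all_rearr[of "\<lambda>u. u\<^sup>2" n x] by (simp add: norm_IVb_def L2_set_def sum_nonneg)
  also have "pow0 ((norm_IVb n x)\<^sup>2) \<theta> = pow0 (norm_IVb n x) (2*(p-1))"
    unfolding \<theta>_def by (rule pow0_double[symmetric]) (simp add: norm_IVb_def)
  also have "(\<Sum>i=1..n. 1 / real i) powr (1-\<theta>) \<le> (2 * ln (real n)) powr (1-\<theta>)"
    using n l sum_inverse_le[of n] \<theta> by (intro powr_mono2 sum_nonneg) auto
  also have "\<dots> \<le> (2 * ln (real n)) powr 1" using \<theta> l by (intro powr_mono) auto
  also have "\<dots> = 2 * ln (real n)" using l by simp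
  finally show ?thesis by (simp add: mult_right_mono pow0_nonneg)
qed

text \<open>The Chernoff bound with the optimal parameter \<open>(1 - n/s\<^sup>2)/2\<close>, needed here because \<open>t\<close>
  enters \<open>s\<close> with coefficient exactly 1.\<close>

lemma prob_norm_IVb:
  assumes n: "3 \<le> n" and t: "0 < t" and X: "std_normal_vector M n X"
  shows "1 - exp (- t\<^sup>2 / 2) \<le> measure M {\<omega> \<in> space M. norm_IVb n (X \<omega>) \<le> 2 * real n powr (1/2) + t}"
proof -
  interpret prob_space M using X by (simp add: std_normal_vector_def)
  define w where "w = sqrt (real n)"
  have w: "0 < w" "w\<^sup>2 = real n" using n by (auto simp: w_def)
  define s where "s = 2 * w + t"
  have s: "0 < s" "w < s" using w t by (auto simp: s_def)
  define A where "A = {\<omega> \<in> space M. norm_IVb n (X \<omega>) \<le> s}"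
  have [measurable]: "(\<lambda>\<omega>. \<Sum>j\<in>{1..n}. (X \<omega> j)\<^sup>2) \<in> borel_measurable M"
    using std_normal_vector_measurable[OF X] by (intro borel_measurable_sum borel_measurable_power) auto
  have [measurable]: "(\<lambda>\<omega>. norm_IVb n (X \<omega>)) \<in> borel_measurable M"
    unfolding norm_IVb_def L2_set_def by measurable
  have A: "A \<in> sets M" unfolding A_def by measurable
  define l where "l = (1 - real n / s\<^sup>2) / 2"
  have "real n < s\<^sup>2" unfolding w(2)[symmetric] using s w by (intro power_strict_mono) auto
  then have l: "0 \<le> l" "l < 1/2" using n s by (auto simp: l_def)
  have one: "1 - 2*l = (w / s)\<^sup>2" 
  proof -
    have "1 - 2 * ((1 - x) / 2) = x" for x :: real by (simp add: field_simps)
    then show ?thesis unfolding l_def power_divide w(2) .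
  qed
  have "1 - prob A = prob (space M - A)" using prob_compl[OF A] by simp
  also have "\<dots> \<le> prob {\<omega> \<in> space M. s\<^sup>2 \<le> (\<Sum>j\<in>{1..n}. (X \<omega> j)\<^sup>2)}"
  proof (rule finite_measure_mono)
    show "space M - A \<subseteq> {\<omega> \<in> space M. s\<^sup>2 \<le> (\<Sum>j\<in>{1..n}. (X \<omega> j)\<^sup>2)}"
    proof
      fix \<omega> assume "\<omega> \<in> space M - A"
      then have \<omega>: "\<omega> \<in> space M" "s < norm_IVb n (X \<omega>)" by (auto simp: A_def)
      then have "s\<^sup>2 \<le> (norm_IVb n (X \<omega>))\<^sup>2" using s by (intro power_mono) auto
      then show "\<omega> \<in> {\<omega> \<in> space M. s\<^sup>2 \<le> (\<Sum>j\<in>{1..n}. (X \<omega> j)\<^sup>2)}"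
        using \<omega> by (simp add: norm_IVb_def L2_set_def sum_nonneg)
    qed
  qed measurable
  also have "\<dots> \<le> (1-2*l) powr (- real (card {1..n}) / 2) * exp (- l * s\<^sup>2)"
    by (rule sum_squares_tail[OF X _ l]) simp
  also have "(1-2*l) powr (- real (card {1..n}) / 2) = exp (real n * ln (s / w))"
  proof -
    have "ln ((w / s)\<^sup>2) = 2 * ln (w / s)" using w s by (subst ln_realpow) auto
    also have "\<dots> = - 2 * ln (s / w)" using w s by (simp add: ln_div)
    finally show ?thesis unfolding one using w s by (simp add: powr_def)
  qed
  also have "exp (real n * ln (s / w)) * exp (- l * s\<^sup>2) = exp (real n * ln (s / w) - l * s\<^sup>2)"
    by (simp add: mult_exp_exp)
  also have "\<dots> \<le> exp (- t\<^sup>2 / 2)"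
  proof (subst exp_le_cancel_iff)
    \<comment> \<open>The linear bound on the logarithm suffices: it gives w^2 + w t, which is
      absorbed by the terms of l s^2 other than t^2/2.\<close>
    have "real n * ln (s / w) \<le> w\<^sup>2 * (s / w - 1)"
      unfolding w(2) using w s by (intro mult_left_mono ln_le_minus_one) auto
    also have "\<dots> = w * s - w\<^sup>2" using w(1) by (simp add: field_simps power2_eq_square)
    also have "\<dots> = w\<^sup>2 + w * t" by (simp add: s_def algebra_simps power2_eq_square)
    finally have 1: "real n * ln (s / w) \<le> w\<^sup>2 + w * t" .
    have "l * s\<^sup>2 = (s\<^sup>2 - w\<^sup>2) / 2" unfolding l_def w(2) using s by (simp add: field_simps)
    also have "\<dots> = 3/2 * w\<^sup>2 + 2 * (w * t) + t\<^sup>2 / 2" by (simp add: s_def algebra_simps power2_eq_square)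
    finally have 2: "l * s\<^sup>2 = 3/2 * w\<^sup>2 + 2 * (w * t) + t\<^sup>2 / 2" .
    have "0 \<le> w * t" "0 \<le> w\<^sup>2" using w t by auto
    with 1 2 show "real n * ln (s / w) - l * s\<^sup>2 \<le> - t\<^sup>2 / 2" by linarith
  qed
  finally show ?thesis by (simp add: A_def s_def w_def powr_half_sqrt)
qed

lemma case_IVb_concentrates:
  fixes M :: "'a measure"
  assumes n: "3 \<le> n" and r: "1/4 < r" "r \<le> 1/2" and rp: "p = 2*(1-r)" and t: "0 < t"
    and X: "std_normal_vector M n X"
  shows "concentrates M n r p t X (norm_IVb n) (2 * real n powr (1/2) + t)
    (2 * ln (real n) * (2 * real n powr (1/2) + t) powr (2*(p-1))) 1"
  unfolding concentrates_def
proof (intro conjI ballI impI)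
  show "1 - 1 * exp (- t\<^sup>2 / 2) \<le> measure M {\<omega> \<in> space M. norm_IVb n (X \<omega>) \<le> 2 * real n powr (1/2) + t}"
    using prob_norm_IVb[OF n t X] by simp
  fix \<omega> assume N: "norm_IVb n (X \<omega>) \<le> 2 * real n powr (1/2) + t"
  have l: "1 \<le> ln (real n)" using n by (rule ln_of_nat_ge_1)
  have S: "0 < 2 * real n powr (1/2) + t" using t by (intro add_nonneg_pos) auto
  have "pow0 (norm_IVb n (X \<omega>)) (2*(p-1)) \<le> (2 * real n powr (1/2) + t) powr (2*(p-1))"
    unfolding pow0_pos[OF S, symmetric] using N r rp by (intro pow0_mono) (auto simp: norm_IVb_def)
  then have "2 * ln (real n) * pow0 (norm_IVb n (X \<omega>)) (2*(p-1)) \<le>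
      2 * ln (real n) * (2 * real n powr (1/2) + t) powr (2*(p-1))"
    using l by (intro mult_left_mono) auto
  then show "wsum n r p (X \<omega>) \<le> 2 * ln (real n) * (2 * real n powr (1/2) + t) powr (2*(p-1))"
    using wsum_le_IVb[OF n r rp, of "X \<omega>"] by linarith
qed

text \<open>As p - 1 = 1 - 2r, the power 2(p-1) of sqrt n is n^(1-2r) = exp ((1-2r) ln n), at most
  e^e under the condition of this case. The factor \<open>max 1 t\<close> absorbs this
  constant.\<close>

lemma R_IVb_le:
  assumes n: "3 \<le> n" and r: "1/4 < r" "r \<le> 1/2" and rp: "p = 2*(1-r)" and t: "0 < t"
    and small: "(1-2*r) * ln (real n) < exp 1"
  shows "2 * ln (real n) * (2 * real n powr (1/2) + t) powr (2*(p-1)) \<le>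
    (4 * exp (exp 1) + 2) * ln (real n) * max 1 t powr (2*(p-1))"
proof -
  define q where "q = 2*(p-1)"
  have q: "0 \<le> q" "q \<le> 1" "1/2*q = 1-2*r" using r rp by (auto simp: q_def)
  have l: "1 \<le> ln (real n)" using n by (rule ln_of_nat_ge_1)
  define m where "m = max 1 t powr q"
  have m: "1 \<le> m" unfolding m_def using q by (intro ge_one_powr_ge_zero) auto
  have "(2 * real n powr (1/2) + t) powr q \<le> (2 * real n powr (1/2)) powr q + t powr q"
    using q t by (intro powr_add_le) auto
  also have "(2 * real n powr (1/2)) powr q = 2 powr q * real n powr (1-2*r)"
    by (simp only: powr_mult powr_powr q(3))
  also have "\<dots> \<le> 2 * exp (exp 1)"
  proof (rule mult_mono)
    show "2 powr q \<le> (2::real)" using q powr_mono[of q 1 2] by simp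
    show "real n powr (1-2*r) \<le> exp (exp 1)" using small n by (simp add: powr_def)
  qed auto
  also have "\<dots> \<le> 2 * exp (exp 1) * m" using m by simp
  also have "t powr q \<le> m" unfolding m_def using q t by (intro powr_mono2) auto
  finally have "(2 * real n powr (1/2) + t) powr q \<le> (2 * exp (exp 1) + 1) * m"
    by (simp add: distrib_right)
  then have "2 * ln (real n) * (2 * real n powr (1/2) + t) powr q \<le> 2 * ln (real n) * ((2 * exp (exp 1) + 1) * m)"
    using l by (intro mult_left_mono) auto
  also have "\<dots> = (4 * exp (exp 1) + 2) * ln (real n) * m" by (simp add: algebra_simps)
  finally show ?thesis unfolding m_def q_def .
qed

section \<open>Choice of the universal constants\<close>

lemma exI_pos:
  fixes c :: real
  shows "0 < c \<Longrightarrow> P c \<Longrightarrow> \<exists>x>0. P x"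
  by blast

theorem theorem7:
  shows
   "(\<comment> \<open>Case I\<close>
     \<exists>C0>0. \<exists>C1>0. \<exists>C2>0. \<exists>C3>0. \<exists>C4>0. \<exists>C5>0. \<forall>(n::nat) (r::real) (p::real) (t::real).
       3 \<le> n \<and> 0 \<le> r \<and> 3/2 \<le> p \<and> 0 < t \<longrightarrow>
       (let R = A_I C1 C2 C3 n r p + B_I C4 C5 n r p * t powr (2*(p-1));
            S = R powr (1 / (2*(p-1)))
        in R = S powr (2*(p-1)) \<and>
           (\<forall>(M::'a measure) X. std_normal_vector M n X \<longrightarrow>
              concentrates M n r p t X (norm_I n r p) S R C0) \<and>
           is_norm n (norm_I n r p)))
    \<and>
    (\<comment> \<open>Case II; \<open>S\<close> and \<open>R\<close> are the same sum up to the value of the universal constant.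
        With one common constant the implication fails as \<open>p\<close> tends to \<open>3/2\<close>.\<close>
     \<exists>C0>0. \<exists>C1>0. \<exists>C2>0. \<exists>C3>0. \<exists>C4>0. \<exists>C5>0. \<exists>C6>0. \<forall>(n::nat) (r::real) (p::real) (t::real).
       3 \<le> n \<and> 0 \<le> r \<and> 1 \<le> p \<and> p < 3/2 \<and> 0 < t \<longrightarrow>
       (let S = C2 * sum_II n r p t;
            R = C3 * sum_II n r p t
        in (\<forall>x. wsum n r p x \<le>
                 C1 * sum_II n r p t powr (3-2*p) * pow0 (norm_II n r p t x) (2*(p-1))) \<and>
           (\<forall>(M::'a measure) X. std_normal_vector M n X \<longrightarrow>
              concentrates M n r p t X (norm_II n r p t) S R C0) \<and>
           S \<le> bound_II C4 C5 C6 n r p t \<and>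
           R \<le> bound_II C4 C5 C6 n r p t \<and>
           (3/2 - 2*r \<le> p \<longrightarrow> is_norm n (norm_II n r p t))))
    \<and>
    (\<comment> \<open>Case III\<close>
     \<exists>C0>0. \<exists>C1>0. \<exists>C2>0. \<exists>C3>0. \<exists>C4>0. \<exists>C5>0. \<exists>C6>0. \<forall>(n::nat) (r::real) (p::real) (t::real).
       3 \<le> n \<and> 0 \<le> r \<and> 1 \<le> p \<and> p < 3/2 - 2*r \<and> 0 < t \<longrightarrow>
       (let S = S_III C2 C3 n r t;
            R = C4 * real n powr ((1-2*r)*(3-2*p)) * S powr (2*(p-1))
        in r < 1/4 \<and> p < 3/2 \<and>
           (\<forall>x. wsum n r p x \<le>
                 C1 * real n powr ((1-2*r)*(3-2*p)) * pow0 (norm_III n r x) (2*(p-1))) \<and>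
           (\<forall>(M::'a measure) X. std_normal_vector M n X \<longrightarrow>
              concentrates M n r p t X (norm_III n r) S R C0) \<and>
           R \<le> C5 * real n powr (1-2*r)
               + C6 * real n powr (2-2*r-p)
                 * (ln (real n) / (1 + (1-4*r) * ln (real n))) powr (p-1) * t powr (2*(p-1))))
    \<and>
    (\<comment> \<open>Case IVa\<close>
     \<exists>C0>0. \<exists>C1>0. \<exists>C2>0. \<exists>C3>0. \<exists>C4>0. \<exists>C5>0. \<exists>C6>0. \<forall>(n::nat) (r::real) (p::real) (t::real).
       3 \<le> n \<and> 1/4 < r \<and> r \<le> 1/2 \<and> p = 2*(1-r) \<and> exp 1 \<le> (1-2*r) * ln (real n) \<and> 0 < t \<longrightarrow>
       (let S = S_IVa C2 C3 n r p t;
            R = C4 * ln (real n) powr (3-2*p) * S powr (2*(p-1))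
        in 1 \<le> p \<and> p < 3/2 \<and> p \<noteq> 1 \<and>
           (\<forall>x. wsum n r p x \<le>
                 C1 * ln (real n) powr (3-2*p) * pow0 (norm_IVa n r p x) (2*(p-1))) \<and>
           (\<forall>i\<in>idx_e n. \<forall>j\<in>idx_e n. i \<le> j \<longrightarrow> coef_IV n r p j \<le> coef_IV n r p i) \<and>
           is_norm n (norm_IVa n r p) \<and>
           (\<forall>(M::'a measure) X. std_normal_vector M n X \<longrightarrow>
              concentrates M n r p t X (norm_IVa n r p) S R C0) \<and>
           R \<le> C5 * (1-2*r) powr (-1) * real n powr (1-2*r)
               + C6 * ln (real n) powr (2-p) * t powr (2*(p-1))))
    \<and>
    (\<comment> \<open>Case IVb; in the last bound, \<open>max 1 t\<close> is \<open>t\<close> for \<open>t \<ge> 1\<close>.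
        With \<open>t\<close> itself the bound fails as \<open>t\<close> tends to 0, since \<open>S \<ge> C2 * sqrt n\<close>.\<close>
     \<exists>C0>0. \<exists>C1>0. \<exists>C2>0. \<exists>C3>0. \<exists>C4>0. \<forall>(n::nat) (r::real) (p::real) (t::real).
       3 \<le> n \<and> 1/4 < r \<and> r \<le> 1/2 \<and> p = 2*(1-r) \<and> (1-2*r) * ln (real n) < exp 1 \<and> 0 < t \<longrightarrow>
       (let S = C2 * real n powr (1/2) + t;
            R = C3 * ln (real n) * S powr (2*(p-1))
        in 1 \<le> p \<and> p < 3/2 \<and>
           (\<forall>x. wsum n r p x \<le> C1 * ln (real n) * pow0 (norm_IVb n x) (2*(p-1))) \<and>
           (\<forall>(M::'a measure) X. std_normal_vector M n X \<longrightarrow>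
              concentrates M n r p t X (norm_IVb n) S R C0) \<and>
           R \<le> C4 * ln (real n) * max 1 t powr (2*(p-1))))"
proof (intro conjI, goal_cases)
  case 1
  show ?case
  proof (rule exI_pos[of 1], simp, rule exI_pos[of 192], simp, rule exI_pos[of 48], simp,
      rule exI_pos[of 48], simp, rule exI_pos[of 96], simp, rule exI_pos[of 24], simp,
      intro allI impI, elim conjE, goal_cases)
    case (1 n r p t)
    show ?case unfolding Let_def by (intro conjI allI impI case_I[OF 1])
  qed
next
  case 2
  show ?case
  proof (rule exI_pos[of 1], simp, rule exI_pos[of 6], simp, rule exI_pos[of 5], simp,
      rule exI_pos[of 30], simp, rule exI_pos[of 4320], simp, rule exI_pos[of 120], simp,
      rule exI_pos[of 120], simp, intro allI impI, elim conjE, goal_cases)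
    case (1 n r p t)
    have R: "30 * sum_II n r p t \<le> bound_II 4320 120 120 n r p t"
      by (rule sum_II_le_bound_II[OF 1])
    then have S: "5 * sum_II n r p t \<le> bound_II 4320 120 120 n r p t"
      using sum_II_nonneg[of n r p t] by linarith
    show ?case unfolding Let_def
      by (intro conjI allI impI wsum_le_II[OF 1(1-4)] case_II_concentrates[OF 1(1-4)] R S
          is_norm_norm_II[OF 1(1,4)])
  qed
next
  case 3
  show ?case
  proof (rule exI_pos[of 1], simp, rule exI_pos[of 2], simp, rule exI_pos[of 720], simp,
      rule exI_pos[of 10], simp, rule exI_pos[of 2], simp, rule exI_pos[of 1440], simp,
      rule exI_pos[of 20], simp, intro allI impI, elim conjE, goal_cases)
    case (1 n r p t)
    have "r < 1/4" "p < 3/2" using 1 by simp_all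
    then show ?case unfolding Let_def
      by (intro conjI allI impI wsum_le_III[OF 1(1-4)] case_III_concentrates[OF 1] R_III_le[OF 1])
  qed
next
  case 4
  show ?case
  proof (rule exI_pos[of 1], simp, rule exI_pos[of 228], simp, rule exI_pos[of 360], simp,
      rule exI_pos[of 10], simp, rule exI_pos[of 228], simp, rule exI_pos[of 88646400], simp,
      rule exI_pos[of 22800], simp, intro allI impI, elim conjE, goal_cases)
    case (1 n r p t)
    \<comment> \<open>The condition of Case IVa excludes r = 1/2 and hence gives p > 1, as the
      results for this line require.\<close>
    have "0 < (1-2*r) * ln (real n)" using 1(5) exp_gt_zero[of "1::real"] by linarith
    then have "0 < 1 - 2*r" using ln_of_nat_ge_1[OF 1(1)] by (simp add: zero_less_mult_iff)
    then have p: "1 < p" "p < 3/2" using 1 by simp_all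
    then have p': "1 \<le> p" "p \<noteq> 1" by simp_all
    note c = 1(1) p 1(4)
    show ?case unfolding Let_def
      by (intro conjI allI ballI impI p' p(2) wsum_le_IVa[OF c] coef_IV_antimono[OF c]
          is_norm_norm_IVa[OF c] case_IVa_concentrates[OF c 1(6)] R_IVa_le[OF c 1(6)])
  qed
next
  case 5
  show ?case
  proof (rule exI_pos[of 1], simp, rule exI_pos[of 2], simp, rule exI_pos[of 2], simp,
      rule exI_pos[of 2], simp, rule exI_pos[of "4 * exp (exp 1) + 2"], simp add: add_pos_pos,
      intro allI impI, elim conjE, goal_cases)
    case (1 n r p t)
    have p: "1 \<le> p" "p < 3/2" using 1 by simp_all
    show ?case unfolding Let_def
      by (intro conjI allI impI p wsum_le_IVb[OF 1(1-4)] case_IVb_concentrates[OF 1(1-4,6)]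
          R_IVb_le[OF 1(1-4,6,5)])
  qed
qed

end
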